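(* Let $G$ be a profinite group. Then $\mathcal{S}(G)$ is homeomorphic to the Cantor set if and only if $G$ is countably based and it is not the case that ($G$ is topologically finitely generated, virtually pronilpotent, and only finitely many primes divide the order of $G$).
   Context: For a profinite group $G$, $\mathcal{S}(G)$ is the set of closed subgroups of $G$ with the profinite topology obtained from $\mathcal{S}(G)=\varprojlim\mathcal{S}(G_\lambda)$, where $G=\varprojlim G_\lambda$ with $G_\lambda$ finite and each finite set $\mathcal{S}(G_\lambda)$ is discrete; equivalently, the sets $B(H,N)=\{K \text{ a closed subgroup of } G\mid KN=HN\}$, with $N$ ranging over the open normal subgroups of $G$, form a base of open neighbourhoods of $H\in\mathcal{S}(G)$. Countably based means that the topology has a countable base. The order of $G$ is the supernatural number given by the least common multiple of the indices $|G:N|$, $N$ open normal. Pronilpotent means an inverse limit of finite nilpotent groups; virtually pronilpotent means having an open pronilpotent subgroup. *)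

theory Defs
  imports
    "HOL-Analysis.Analysis"
    "HOL-Algebra.Product_Groups"
    "HOL-Library.Extended_Nat"
begin

definition topological_group :: "('a, 'm) monoid_scheme \<Rightarrow> 'a topology \<Rightarrow> bool" where
  "topological_group G T \<longleftrightarrow>
     group G \<and> topspace T = carrier G \<and>
     continuous_map (prod_topology T T) T (\<lambda>(x, y). x \<otimes>\<^bsub>G\<^esub> y) \<and>
     continuous_map T T (\<lambda>x. inv\<^bsub>G\<^esub> x)"

definition inverse_system ::
  "'i set \<Rightarrow> ('i \<Rightarrow> 'i \<Rightarrow> bool) \<Rightarrow> ('i \<Rightarrow> ('b, 'm) monoid_scheme) \<Rightarrow> ('i \<Rightarrow> 'i \<Rightarrow> 'b \<Rightarrow> 'b) \<Rightarrow> bool" where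
  "inverse_system I leq F \<phi> \<longleftrightarrow>
     I \<noteq> {} \<and>
     (\<forall>i\<in>I. leq i i) \<and>
     (\<forall>i\<in>I. \<forall>j\<in>I. leq i j \<longrightarrow> leq j i \<longrightarrow> i = j) \<and>
     (\<forall>i\<in>I. \<forall>j\<in>I. \<forall>k\<in>I. leq i j \<longrightarrow> leq j k \<longrightarrow> leq i k) \<and>
     (\<forall>i\<in>I. \<forall>j\<in>I. \<exists>k\<in>I. leq i k \<and> leq j k) \<and>
     (\<forall>i\<in>I. group (F i)) \<and>
     (\<forall>i\<in>I. \<forall>j\<in>I. leq i j \<longrightarrow> \<phi> i j \<in> hom (F j) (F i)) \<and>
     (\<forall>i\<in>I. \<forall>x\<in>carrier (F i). \<phi> i i x = x) \<and>
     (\<forall>i\<in>I. \<forall>j\<in>I. \<forall>k\<in>I. leq i j \<longrightarrow> leq j k \<longrightarrow>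
        (\<forall>x\<in>carrier (F k). \<phi> i j (\<phi> j k x) = \<phi> i k x))"

definition inverse_limit_group ::
  "'i set \<Rightarrow> ('i \<Rightarrow> 'i \<Rightarrow> bool) \<Rightarrow> ('i \<Rightarrow> ('b, 'm) monoid_scheme) \<Rightarrow> ('i \<Rightarrow> 'i \<Rightarrow> 'b \<Rightarrow> 'b) \<Rightarrow> ('i \<Rightarrow> 'b) monoid" where
  "inverse_limit_group I leq F \<phi> =
     (product_group I F)
       \<lparr>carrier := {x \<in> carrier (product_group I F). \<forall>i\<in>I. \<forall>j\<in>I. leq i j \<longrightarrow> \<phi> i j (x j) = x i}\<rparr>"

definition inverse_limit_topology ::
  "'i set \<Rightarrow> ('i \<Rightarrow> 'i \<Rightarrow> bool) \<Rightarrow> ('i \<Rightarrow> ('b, 'm) monoid_scheme) \<Rightarrow> ('i \<Rightarrow> 'i \<Rightarrow> 'b \<Rightarrow> 'b) \<Rightarrow> ('i \<Rightarrow> 'b) topology" where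
  "inverse_limit_topology I leq F \<phi> =
     subtopology (product_topology (\<lambda>i. discrete_topology (carrier (F i))) I)
       (carrier (inverse_limit_group I leq F \<phi>))"

text \<open>
  HOL cannot quantify over types inside a definition, so the types of the indices and of the
  elements of the groups of the system are fixed to be \<^typ>\<open>'a set\<close>. For classes closed under
  isomorphism and subgroups, such as the two used below, this loses no generality: if
  \<open>G\<close> is the inverse limit of any system of such groups, indexed over any type, then it is
  also the inverse limit of the groups \<open>G Mod N\<close>, where \<open>N\<close> ranges over the kernels of the
  projections of \<open>G\<close> to the members of the system.
\<close>

definition inverse_limit_of_class ::
  "('a set monoid \<Rightarrow> bool) \<Rightarrow> ('a, 'm) monoid_scheme \<Rightarrow> 'a topology \<Rightarrow> bool" where
  "inverse_limit_of_class P G T \<longleftrightarrow>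
     topological_group G T \<and>
     (\<exists>(I :: 'a set set) leq (F :: 'a set \<Rightarrow> 'a set monoid) \<phi> f.
        inverse_system I leq F \<phi> \<and>
        (\<forall>i\<in>I. P (F i)) \<and>
        f \<in> iso G (inverse_limit_group I leq F \<phi>) \<and>
        homeomorphic_map T (inverse_limit_topology I leq F \<phi>) f)"

definition profinite_group :: "('a, 'm) monoid_scheme \<Rightarrow> 'a topology \<Rightarrow> bool" where
  "profinite_group G T \<longleftrightarrow> inverse_limit_of_class (\<lambda>F. finite (carrier F)) G T"

primrec lower_central_series :: "('a, 'm) monoid_scheme \<Rightarrow> nat \<Rightarrow> 'a set" where
  "lower_central_series G 0 = carrier G"
| "lower_central_series G (Suc n) =
     generate G {x \<otimes>\<^bsub>G\<^esub> y \<otimes>\<^bsub>G\<^esub> inv\<^bsub>G\<^esub> x \<otimes>\<^bsub>G\<^esub> inv\<^bsub>G\<^esub> y | x y. x \<in> lower_central_series G n \<and> y \<in> carrier G}"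

definition nilpotent_group :: "('a, 'm) monoid_scheme \<Rightarrow> bool" where
  "nilpotent_group G \<longleftrightarrow> group G \<and> (\<exists>n. lower_central_series G n = {\<one>\<^bsub>G\<^esub>})"

definition pronilpotent_group :: "('a, 'm) monoid_scheme \<Rightarrow> 'a topology \<Rightarrow> bool" where
  "pronilpotent_group G T \<longleftrightarrow>
     inverse_limit_of_class (\<lambda>F. finite (carrier F) \<and> nilpotent_group F) G T"

definition virtually_pronilpotent :: "('a, 'm) monoid_scheme \<Rightarrow> 'a topology \<Rightarrow> bool" where
  "virtually_pronilpotent G T \<longleftrightarrow>
     (\<exists>H. subgroup H G \<and> openin T H \<and> pronilpotent_group (G\<lparr>carrier := H\<rparr>) (subtopology T H))"

definition topologically_finitely_generated :: "('a, 'm) monoid_scheme \<Rightarrow> 'a topology \<Rightarrow> bool" where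
  "topologically_finitely_generated G T \<longleftrightarrow>
     (\<exists>S. finite S \<and> S \<subseteq> carrier G \<and> T closure_of (generate G S) = carrier G)"

text \<open>
  A supernatural number is represented by its exponent function on primes, with values in
  \<^typ>\<open>enat\<close>; least common multiples are then pointwise suprema.
\<close>

definition profinite_order :: "('a, 'm) monoid_scheme \<Rightarrow> 'a topology \<Rightarrow> nat \<Rightarrow> enat" where
  "profinite_order G T p =
     (SUP N \<in> {N. N \<lhd> G \<and> openin T N}. enat (multiplicity p (card (rcosets\<^bsub>G\<^esub> N))))"

definition order_prime_divisors :: "('a, 'm) monoid_scheme \<Rightarrow> 'a topology \<Rightarrow> nat set" where
  "order_prime_divisors G T = {p. Factorial_Ring.prime p \<and> profinite_order G T p \<ge> 1}"

definition closed_subgroups :: "('a, 'm) monoid_scheme \<Rightarrow> 'a topology \<Rightarrow> 'a set set" where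
  "closed_subgroups G T = {H. subgroup H G \<and> closedin T H}"

definition basic_nbhd :: "('a, 'm) monoid_scheme \<Rightarrow> 'a topology \<Rightarrow> 'a set \<Rightarrow> 'a set \<Rightarrow> 'a set set" where
  "basic_nbhd G T H N = {K \<in> closed_subgroups G T. K <#>\<^bsub>G\<^esub> N = H <#>\<^bsub>G\<^esub> N}"

definition subgroup_space :: "('a, 'm) monoid_scheme \<Rightarrow> 'a topology \<Rightarrow> 'a set topology" where
  "subgroup_space G T =
     topology_generated_by
       {basic_nbhd G T H N | H N. H \<in> closed_subgroups G T \<and> N \<lhd> G \<and> openin T N}"

primrec cantor_stage :: "nat \<Rightarrow> real set" where
  "cantor_stage 0 = {0..1}"
| "cantor_stage (Suc n) = (\<lambda>x. x / 3) ` cantor_stage n \<union> (\<lambda>x. (2 + x) / 3) ` cantor_stage n"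

definition cantor_set :: "real set" where
  "cantor_set = (\<Inter>n. cantor_stage n)"

end

theory Submission
  imports Defs "HOL-Algebra.Sylow" "HOL-Algebra.Zassenhaus" "HOL-Algebra.Multiplicative_Group" "HOL-Number_Theory.Cong"
begin

text \<open>
  Write \<open>S(G)\<close> for the space of closed subgroups. It is compact, its basic neighbourhoods \<open>B(H,N)\<close>
  are clopen and separate points, and countably many of them suffice as soon as \<open>G\<close> is countably
  based; conversely \<open>N \<mapsto> B(N,N)\<close> embeds the open normal subgroups into the clopen sets of \<open>S(G)\<close>,
  of which there are only countably many if \<open>S(G)\<close> is second countable. By Brouwer's
  characterisation of the Cantor set (\<open>homeomorphic_Cantor_space\<close>), \<open>S(G)\<close> is therefore a Cantor
  set if and only if \<open>G\<close> is countably based and \<open>S(G)\<close> has no isolated point.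

  Since \<open>B(H,N)\<close> contains \<open>HN\<close>, a closed subgroup \<open>H\<close> is isolated if and only if some open normal
  subgroup \<open>N\<close> of \<open>G\<close> lies in \<open>H\<close> and consists of non-generators of \<open>H\<close>: whenever \<open>K\<close> is a closed
  subgroup with \<open>KN = H\<close>, then \<open>K = H\<close> (\<open>isolated_subgroup_iff\<close>). In other words, \<open>H\<close> is open and
  so is its Frattini subgroup. It remains to show that such a pair \<open>H\<close>, \<open>N\<close> exists if and only if
  \<open>G\<close> is topologically finitely generated, virtually pronilpotent and of order divisible by finitely
  many primes.

  Suppose that \<open>H\<close> and \<open>N\<close> are given. Representatives of the cosets of \<open>N\<close> in \<open>H\<close> generate \<open>H\<close>
  topologically, because \<open>N\<close> consists of non-generators; adding representatives of the cosets of
  \<open>H\<close> one obtains generators of \<open>G\<close>. The other two properties are statements on finite groups, applied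
  to the quotients \<open>H/M\<close> with \<open>M \<subseteq> N\<close> open and normal: a normal subgroup \<open>E\<close> of a finite group
  \<open>Q\<close> which consists of non-generators is nilpotent, and each prime divisor of \<open>|Q|\<close> divides
  \<open>|Q : E|\<close>. Both are proved by climbing from \<open>M\<close> to \<open>N\<close> through central steps
  (\<open>nongenerators_nilpotent_and_primes\<close>). By the Frattini argument all Sylow subgroups of \<open>E\<close> are
  normal in \<open>Q\<close>, so that the centre of \<open>E\<close> is nontrivial if \<open>E\<close> is. And if a prime \<open>p\<close> divided the
  order of this centre \<open>A\<close> but not \<open>|Q : A|\<close>, then, as in the theorem of Schur and Zassenhaus, a
  crossed homomorphism \<open>Q \<rightarrow> A\<close> would produce a proper subgroup \<open>K\<close> with \<open>KA = Q\<close>.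

  Conversely, let \<open>H\<close> be an open pronilpotent subgroup of \<open>G\<close>. The maximal open subgroups of \<open>H\<close> are
  normal of prime index, and the index divides the order of \<open>G\<close>. So their indices in \<open>G\<close> are bounded
  if only finitely many primes divide that order, and then there are only finitely many of them if
  \<open>G\<close> is topologically finitely generated. Hence their intersection is open, and every open normal
  subgroup \<open>N\<close> of \<open>G\<close> inside it consists of non-generators of \<open>H\<close>: a proper closed subgroup
  \<open>K\<close> of \<open>H\<close> lies in a maximal open one, which then contains \<open>KN\<close>.
\<close>

section \<open>Finite groups: p-groups, Sylow subgroups and supplements\<close>

text \<open>
  The size of an orbit divides a power of \<open>p\<close>, so modulo \<open>p\<close> only the orbits of size one count. The
  action is given as a bare function, so that restrictions to the carrier need not be dealt with
  where the lemma is applied.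
\<close>

lemma p_group_fixed_points:
  fixes P (structure)
  assumes P: "group P" and ord: "order P = p ^ a" and p: "prime p" and X: "finite X"
    and closed: "\<And>g x. g \<in> carrier P \<Longrightarrow> x \<in> X \<Longrightarrow> act g x \<in> X"
    and one: "\<And>x. x \<in> X \<Longrightarrow> act \<one> x = x"
    and mult: "\<And>g h x. g \<in> carrier P \<Longrightarrow> h \<in> carrier P \<Longrightarrow> x \<in> X \<Longrightarrow> act (g \<otimes> h) x = act g (act h x)"
  shows "card {x \<in> X. \<forall>g\<in>carrier P. act g x = x} mod p = card X mod p"
proof -
  interpret P: group P by fact
  define \<phi> where "\<phi> = (\<lambda>g. restrict (act g) X)"
  have bij: "bij_betw (act g) X X" if g: "g \<in> carrier P" for g
  proof (rule bij_betw_byWitness[where f' = "act (inv g)"])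
    show "\<forall>x\<in>X. act (inv g) (act g x) = x"
      using g one mult[of "inv g" g] by simp
    show "\<forall>x\<in>X. act g (act (inv g) x) = x"
      using g one mult[of g "inv g"] by simp
    show "act g ` X \<subseteq> X" "act (inv g) ` X \<subseteq> X"
      using g closed by auto
  qed
  have \<phi>_Bij: "\<phi> g \<in> Bij X" if g: "g \<in> carrier P" for g
    using bij[OF g] by (auto simp: Bij_def \<phi>_def cong: bij_betw_cong)
  have \<phi>_mult: "\<phi> (g \<otimes> h) = \<phi> g \<otimes>\<^bsub>BijGroup X\<^esub> \<phi> h" if "g \<in> carrier P" "h \<in> carrier P" for g h
    using that \<phi>_Bij[OF that(1)] \<phi>_Bij[OF that(2)]
    by (auto simp: BijGroup_def compose_def \<phi>_def mult closed fun_eq_iff)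
  have "\<phi> \<in> hom P (BijGroup X)"
    using \<phi>_Bij \<phi>_mult by (auto simp: hom_def BijGroup_def)
  then interpret A: group_action P X \<phi>
    by (intro group_action.intro group_hom.intro group_hom_axioms.intro group_BijGroup P)
  let ?F = "{x \<in> X. \<forall>g\<in>carrier P. act g x = x}"
  let ?O = "orbits P X \<phi>"
  have finO: "finite ?O"
    using X by (simp add: orbits_def)
  have finR: "finite R" if "R \<in> ?O" for R
    using that finite_subset[OF Union_upper[OF that]] X A.orbits_coverture by simp
  have cardR: "card R dvd p ^ a" if "R \<in> ?O" for R
  proof -
    obtain x where x: "x \<in> X" "R = orbit P \<phi> x" using \<open>R \<in> ?O\<close> by (auto simp: orbits_def)
    then show ?thesis using A.orbit_stabilizer_theorem[OF x(1)] ord by (metis dvd_triv_left)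
  qed
  have orb: "orbit P \<phi> x = {x} \<longleftrightarrow> x \<in> ?F" if "x \<in> X" for x
  proof -
    have "orbit P \<phi> x = (\<lambda>g. act g x) ` carrier P" using that by (auto simp: orbit_def \<phi>_def)
    moreover have "x \<in> (\<lambda>g. act g x) ` carrier P" using one[OF that] P.one_closed by (metis imageI)
    ultimately show ?thesis using that by (auto simp: set_eq_iff image_iff)
  qed
  have 1: "{R \<in> ?O. card R = 1} = (\<lambda>x. {x}) ` ?F"
  proof (intro equalityI subsetI)
    fix R assume "R \<in> {R \<in> ?O. card R = 1}"
    then obtain x where x: "x \<in> X" "R = orbit P \<phi> x" "card R = 1" by (auto simp: orbits_def)
    have "x \<in> R" using x A.orbit_refl by blast
    then have "R = {x}" using x(3) by (auto simp: card_1_singleton_iff)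
    then show "R \<in> (\<lambda>x. {x}) ` ?F" using orb x by auto
  next
    fix R assume "R \<in> (\<lambda>x. {x}) ` ?F"
    then obtain x where x: "x \<in> ?F" "R = {x}" by auto
    then have "R = orbit P \<phi> x" using orb by auto
    moreover have "card R = 1" using x(2) by simp
    ultimately show "R \<in> {R \<in> ?O. card R = 1}" using x by (auto simp: orbits_def)
  qed
  have "card X = (\<Sum>R\<in>?O. card R)"
    using A.disjoint_sum[OF X, of "\<lambda>_. 1::nat"] by simp
  also have "\<dots> = (\<Sum>R\<in>{R \<in> ?O. card R = 1}. card R) + (\<Sum>R\<in>{R \<in> ?O. card R \<noteq> 1}. card R)"
    by (subst sum.union_disjoint[symmetric]) (use finO in \<open>auto intro!: sum.cong\<close>)
  also have "(\<Sum>R\<in>{R \<in> ?O. card R = 1}. card R) = card ?F"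
    by (subst 1, subst sum.reindex) auto
  finally have e: "card X = card ?F + (\<Sum>R\<in>{R \<in> ?O. card R \<noteq> 1}. card R)" .
  have "p dvd (\<Sum>R\<in>{R \<in> ?O. card R \<noteq> 1}. card R)"
  proof (rule dvd_sum)
    fix R assume R: "R \<in> {R \<in> ?O. card R \<noteq> 1}"
    then obtain k where "k \<le> a" "card R = p ^ k"
      using cardR p by (auto simp: divides_primepow_nat)
    then show "p dvd card R" using R by (cases k) auto
  qed
  then obtain k where "(\<Sum>R\<in>{R \<in> ?O. card R \<noteq> 1}. card R) = p * k" by (auto simp: dvd_def)
  then show ?thesis using e by simp
qed

text \<open>
  The fixed points of the conjugation action form the centre, which by the previous lemma has order
  divisible by \<open>p\<close>.
\<close>

lemma (in group) p_group_nontrivial_center: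
  assumes ord: "order G = p ^ a" and p: "prime p" and a: "0 < a"
  shows "\<exists>z\<in>carrier G. z \<noteq> \<one> \<and> (\<forall>x\<in>carrier G. z \<otimes> x = x \<otimes> z)"
proof -
  have fin: "finite (carrier G)"
    using ord p by (simp add: order_gt_0_iff_finite[symmetric] prime_gt_0_nat)
  let ?Z = "{z \<in> carrier G. \<forall>g\<in>carrier G. g \<otimes> z \<otimes> inv g = z}"
  have "card ?Z mod p = card (carrier G) mod p"
    by (rule p_group_fixed_points[OF is_group ord p fin]) (auto simp: m_assoc inv_mult_group)
  also have "\<dots> = 0" using ord a by (simp add: order_def)
  finally have "p dvd card ?Z" by auto
  moreover have "\<one> \<in> ?Z" by simp
  ultimately have "?Z \<noteq> {\<one>}" using p by (auto simp: not_prime_1 dest: prime_gt_1_nat)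
  then obtain z where z: "z \<in> ?Z" "z \<noteq> \<one>" using \<open>\<one> \<in> ?Z\<close> by blast
  have "z \<otimes> x = x \<otimes> z" if "x \<in> carrier G" for x
    using z that by (auto simp: inv_solve_right' dest!: bspec[where x=x])
  then show ?thesis using z by blast
qed

text \<open>
  The group \<open>P\<close> acts on the cosets of \<open>R\<close>, whose number \<open>m\<close> is prime to \<open>p\<close>. Hence there is a fixed
  coset \<open>R x\<close>, which means \<open>x P x\<^sup>-\<^sup>1 \<subseteq> R\<close>.
\<close>

lemma (in group) Sylow_conj:
  assumes fin: "finite (carrier G)" and P: "subgroup P G" and R: "subgroup R G"
    and cP: "card P = p ^ a" and cR: "card R = p ^ a" and p: "prime p"
    and ord: "order G = p ^ a * m" and m: "\<not> p dvd m"
  shows "\<exists>x\<in>carrier G. (\<lambda>h. x \<otimes> h \<otimes> inv x) ` P = R"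
proof -
  let ?GP = "G\<lparr>carrier := P\<rparr>"
  interpret P: subgroup P G by fact
  interpret R: subgroup R G by fact
  let ?X = "rcosets R"
  have finX: "finite ?X" using fin by (simp add: RCOSETS_def)
  have cX: "card ?X = m"
    using lagrange[OF R] cR ord p by (simp add: mult.commute prime_gt_0_nat)
  have "card {X \<in> ?X. \<forall>g\<in>carrier ?GP. X #> inv g = X} mod p = card ?X mod p"
  proof (rule p_group_fixed_points[where a = a])
    show "group ?GP" using P.subgroup_is_group is_group by blast
    show "order ?GP = p ^ a" using cP by (simp add: order_def)
    show "prime p" "finite ?X" by fact+
  next
    fix g X assume "g \<in> carrier ?GP" "X \<in> ?X"
    then show "X #> inv g \<in> ?X"
      using R.subset P.subset by (auto simp: RCOSETS_def coset_mult_assoc)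
  next
    fix X assume "X \<in> ?X"
    then show "X #> inv \<one>\<^bsub>?GP\<^esub> = X"
      using R.subset by (auto simp: RCOSETS_def coset_mult_assoc)
  next
    fix g h X assume "g \<in> carrier ?GP" "h \<in> carrier ?GP" "X \<in> ?X"
    then show "X #> inv (g \<otimes>\<^bsub>?GP\<^esub> h) = X #> inv h #> inv g"
      using R.subset P.subset by (auto simp: RCOSETS_def coset_mult_assoc inv_mult_group subset_iff m_assoc)
  qed
  also have "\<dots> \<noteq> 0" using cX m by (simp add: dvd_eq_mod_eq_0)
  finally have "{X \<in> ?X. \<forall>g\<in>P. X #> inv g = X} \<noteq> {}" by force
  then obtain x where x: "x \<in> carrier G" "\<And>g. g \<in> P \<Longrightarrow> R #> x #> inv g = R #> x"
    by (auto simp: RCOSETS_def)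
  have sub: "(\<lambda>h. x \<otimes> h \<otimes> inv x) ` P \<subseteq> R"
  proof
    fix y assume "y \<in> (\<lambda>h. x \<otimes> h \<otimes> inv x) ` P"
    then obtain h where h: "h \<in> P" "y = x \<otimes> h \<otimes> inv x" by auto
    have hc: "h \<in> carrier G" using h(1) P.subset by blast
    have "R #> (x \<otimes> h) = R #> x"
      using x(2)[of "inv h"] h x(1) hc R.subset by (simp add: coset_mult_assoc)
    then have "x \<otimes> h \<in> R #> x" using R.rcos_module R x(1) hc by (metis rcos_self m_closed)
    then show "y \<in> R" using R.rcos_module_imp[OF is_group x(1)] h by simp
  qed
  have "inj_on (\<lambda>h. x \<otimes> h \<otimes> inv x) P"
    using x(1) by (auto simp: inj_on_def)
  then have "card ((\<lambda>h. x \<otimes> h \<otimes> inv x) ` P) = card R" using cP cR by (simp add: card_image)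
  then have "(\<lambda>h. x \<otimes> h \<otimes> inv x) ` P = R"
    using sub R.subset fin by (simp add: card_subset_eq finite_subset)
  then show ?thesis using x(1) by blast
qed

lemma (in group) inv_mult_cancel:
  assumes "x \<in> carrier G" "y \<in> carrier G"
  shows "inv x \<otimes> (x \<otimes> y) = y" "x \<otimes> (inv x \<otimes> y) = y"
  using assms by (simp_all add: m_assoc[symmetric])

lemma (in group) subset_set_mult:
  assumes "K \<subseteq> carrier G"
  shows "\<one> \<in> N \<Longrightarrow> K \<subseteq> K <#> N" "\<one> \<in> N \<Longrightarrow> K \<subseteq> N <#> K"
proof -
  have "k = k \<otimes> \<one>" "k = \<one> \<otimes> k" if "k \<in> K" for k using that assms by auto
  then show "\<one> \<in> N \<Longrightarrow> K \<subseteq> K <#> N" "\<one> \<in> N \<Longrightarrow> K \<subseteq> N <#> K"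
    unfolding set_mult_def by blast+
qed

lemma (in group) set_mult_absorb:
  assumes M: "\<one> \<in> M" and K: "subgroup K G" and MK: "M \<subseteq> K"
  shows "K <#> M = K" "M <#> K = K"
proof -
  interpret K: subgroup K G by fact
  show "K <#> M = K" using subset_set_mult(1)[OF K.subset M] MK by (auto simp: set_mult_def)
  show "M <#> K = K" using subset_set_mult(2)[OF K.subset M] MK by (auto simp: set_mult_def)
qed

lemma (in group) set_mult_coarser:
  assumes M: "subgroup M G" and N: "subgroup N G" and MN: "M \<subseteq> N" and K: "K \<subseteq> carrier G"
  shows "(K <#> M) <#> N = K <#> N"
proof -
  have "(K <#> M) <#> N = K <#> (M <#> N)"
    using set_mult_assoc[OF K] M N subgroup.subset by blast
  then show ?thesis using set_mult_absorb(2)[OF subgroup.one_closed[OF M] N MN] by simp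
qed

lemma (in group) set_mult_normal_subgroup:
  assumes "subgroup K G" "N \<lhd> G" shows "subgroup (K <#> N) G"
  using mult_norm_subgroup[OF assms(2,1)] commut_normal[OF assms] by simp

lemma (in group) conj_image_comp:
  assumes "P \<subseteq> carrier G" "g \<in> carrier G" "x \<in> carrier G"
  shows "(\<lambda>h. (g \<otimes> x) \<otimes> h \<otimes> inv (g \<otimes> x)) ` P = (\<lambda>h. g \<otimes> h \<otimes> inv g) ` (\<lambda>h. x \<otimes> h \<otimes> inv x) ` P"
proof -
  have "(g \<otimes> x) \<otimes> h \<otimes> inv (g \<otimes> x) = g \<otimes> (x \<otimes> h \<otimes> inv x) \<otimes> inv g" if "h \<in> P" for h
    using that assms by (simp add: inv_mult_group m_assoc subset_iff)
  then show ?thesis unfolding image_image by (rule image_cong[OF refl])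
qed

lemma (in group) conj_image_inv:
  assumes "P \<subseteq> carrier G" "g \<in> carrier G"
  shows "(\<lambda>h. g \<otimes> h \<otimes> inv g) ` (\<lambda>h. inv g \<otimes> h \<otimes> g) ` P = P"
  using conj_image_comp[OF assms inv_closed[OF assms(2)]] assms by (auto simp: subset_iff image_iff)

lemma (in group) conj_stabilizer_subgroup:
  assumes "P \<subseteq> carrier G"
  shows "subgroup {g \<in> carrier G. (\<lambda>h. g \<otimes> h \<otimes> inv g) ` P = P} G"
proof
  fix g x assume "g \<in> {g \<in> carrier G. (\<lambda>h. g \<otimes> h \<otimes> inv g) ` P = P}" "x \<in> {g \<in> carrier G. (\<lambda>h. g \<otimes> h \<otimes> inv g) ` P = P}"
  then show "g \<otimes> x \<in> {g \<in> carrier G. (\<lambda>h. g \<otimes> h \<otimes> inv g) ` P = P}"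
    using conj_image_comp[OF assms] by simp
next
  show "\<one> \<in> {g \<in> carrier G. (\<lambda>h. g \<otimes> h \<otimes> inv g) ` P = P}"
    using assms by (auto simp: subset_iff image_iff)
next
  fix g assume g: "g \<in> {g \<in> carrier G. (\<lambda>h. g \<otimes> h \<otimes> inv g) ` P = P}"
  then have "(\<lambda>h. inv g \<otimes> h \<otimes> inv (inv g)) ` P = (\<lambda>h. inv g \<otimes> h \<otimes> inv (inv g)) ` (\<lambda>h. g \<otimes> h \<otimes> inv g) ` P"
    by simp
  also have "\<dots> = P"
    using conj_image_inv[OF assms, of "inv g"] g by simp
  finally show "inv g \<in> {g \<in> carrier G. (\<lambda>h. g \<otimes> h \<otimes> inv g) ` P = P}"
    using g by simp
qed auto

lemma (in group) subgroup_conj_image: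
  assumes "subgroup P G" "x \<in> carrier G"
  shows "subgroup ((\<lambda>h. x \<otimes> h \<otimes> inv x) ` P) G"
proof -
  have "(\<lambda>h. x \<otimes> h \<otimes> inv x) \<in> hom G G"
    using assms(2) by (auto simp: hom_def m_assoc) (simp add: m_assoc[symmetric])
  then interpret c: group_hom G G "\<lambda>h. x \<otimes> h \<otimes> inv x"
    by unfold_locales
  show ?thesis using c.subgroup_img_is_subgroup[OF assms(1)] .
qed

text \<open>
  The Frattini argument: each conjugate of \<open>P\<close> in \<open>G\<close> is a Sylow subgroup of \<open>E\<close>, hence conjugate to \<open>P\<close>
  by an element of \<open>E\<close>. Thus the normaliser of \<open>P\<close> together with \<open>E\<close> generates \<open>G\<close>, and elements of \<open>E\<close>
  are non-generators.
\<close>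

lemma (in group) Sylow_normal_if_nongenerators:
  assumes fin: "finite (carrier G)" and E: "E \<lhd> G" and P: "subgroup P G" and PE: "P \<subseteq> E"
    and cP: "card P = p ^ a" and cE: "card E = p ^ a * m" and p: "prime p" and m: "\<not> p dvd m"
    and frat: "\<And>K. subgroup K G \<Longrightarrow> K <#> E = carrier G \<Longrightarrow> K = carrier G"
  shows "P \<lhd> G"
proof -
  let ?GE = "G\<lparr>carrier := E\<rparr>"
  interpret E: normal E G by fact
  interpret P: subgroup P G by fact
  let ?N = "{g \<in> carrier G. (\<lambda>h. g \<otimes> h \<otimes> inv g) ` P = P}"
  have N: "subgroup ?N G" by (rule conj_stabilizer_subgroup[OF P.subset])
  have "g \<in> ?N <#> E" if g: "g \<in> carrier G" for g
  proof -
    let ?R = "(\<lambda>h. inv g \<otimes> h \<otimes> inv (inv g)) ` P"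
    have R: "subgroup ?R G" using subgroup_conj_image[OF P, of "inv g"] g by simp
    have RE: "?R \<subseteq> E" using PE g E.inv_op_closed2[of "inv g"] by blast
    have "inj_on (\<lambda>h. inv g \<otimes> h \<otimes> inv (inv g)) P"
      using g by (auto simp: inj_on_def)
    then have cR: "card ?R = p ^ a" using cP by (simp add: card_image)
    interpret EG: group "?GE" by (rule E.subgroup_is_group[OF is_group])
    have "\<exists>x\<in>carrier ?GE. (\<lambda>h. x \<otimes>\<^bsub>?GE\<^esub> h \<otimes>\<^bsub>?GE\<^esub> inv\<^bsub>?GE\<^esub> x) ` P = ?R"
    proof (rule EG.Sylow_conj)
      show "finite (carrier ?GE)" using fin E.subset finite_subset by auto
      show "subgroup P ?GE" "subgroup ?R ?GE"
        using subgroup_incl[OF P E.subgroup_axioms PE] subgroup_incl[OF R E.subgroup_axioms RE] by auto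
      show "order ?GE = p ^ a * m" using cE by (simp add: order_def)
    qed fact+
    then obtain x where x: "x \<in> E" "(\<lambda>h. x \<otimes> h \<otimes> inv x) ` P = ?R"
      by (auto simp: m_inv_consistent[OF E.subgroup_axioms] cong: image_cong)
    have xc: "x \<in> carrier G" using x(1) E.subset by blast
    have "(\<lambda>h. (g \<otimes> x) \<otimes> h \<otimes> inv (g \<otimes> x)) ` P = P"
      using conj_image_comp[OF P.subset g xc] conj_image_inv[OF P.subset g] x(2) g by simp
    then have "g \<otimes> x \<in> ?N" using g xc by simp
    moreover have "g = (g \<otimes> x) \<otimes> inv x" using g xc by (simp add: m_assoc)
    ultimately show ?thesis using x(1) by (auto simp: set_mult_def intro: E.m_inv_closed)
  qed
  then have "?N <#> E = carrier G"
    using set_mult_closed[of ?N E] E.subset by auto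
  then have "?N = carrier G" by (rule frat[OF N])
  then have "\<And>g h. g \<in> carrier G \<Longrightarrow> h \<in> P \<Longrightarrow> g \<otimes> h \<otimes> inv g \<in> P" by auto
  then show ?thesis using P normal_inv_iff by blast
qed

lemma (in group) card_subgroup_dvd:
  assumes "subgroup K G" "subgroup H G" "K \<subseteq> H"
  shows "card K dvd card H"
proof -
  have "card (rcosets\<^bsub>G\<lparr>carrier := H\<rparr>\<^esub> K) * card K = card H"
    using group.lagrange[OF subgroup.subgroup_is_group[OF assms(2) is_group] subgroup_incl[OF assms]]
    by (simp add: order_def)
  then show ?thesis by (metis dvd_triv_right)
qed

text \<open>
  All Sylow subgroups of \<open>E\<close> are normal, so those for different primes commute with each other. A
  nontrivial central element \<open>z\<close> of one of them thus commutes with all of them; its centraliser in \<open>E\<close>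
  then has order divisible by \<open>|E|\<close>.
\<close>

lemma (in group) nongenerators_nontrivial_center:
  assumes fin: "finite (carrier G)" and E: "E \<lhd> G" and E1: "E \<noteq> {\<one>}"
    and frat: "\<And>K. subgroup K G \<Longrightarrow> K <#> E = carrier G \<Longrightarrow> K = carrier G"
  shows "\<exists>z\<in>E. z \<noteq> \<one> \<and> (\<forall>x\<in>E. z \<otimes> x = x \<otimes> z)"
proof -
  let ?GE = "G\<lparr>carrier := E\<rparr>"
  interpret E: normal E G by fact
  interpret EG: group "?GE" by (rule E.subgroup_is_group[OF is_group])
  have finE: "finite E" using fin E.subset finite_subset by blast
  have cE0: "card E \<noteq> 0" using finE E.one_closed by (metis card_0_eq empty_iff)
  have cE1: "card E \<noteq> 1" using E1 E.one_closed by (metis card_1_singletonE singletonD)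
  have "\<exists>P. P \<lhd> G \<and> P \<subseteq> E \<and> card P = q ^ multiplicity q (card E)" if q: "prime q" for q
  proof -
    obtain m where m: "card E = q ^ multiplicity q (card E) * m" "\<not> q dvd m"
      using multiplicity_decompose'[of "card E" q] cE0 q by (metis not_prime_unit)
    obtain P where P: "subgroup P ?GE" "card P = q ^ multiplicity q (card E)"
      using sylow_thm[OF q EG.is_group, of "multiplicity q (card E)" m] m(1) finE by (auto simp: order_def)
    have PE: "P \<subseteq> E" using subgroup.subset[OF P(1)] by simp
    have "subgroup P G" using incl_subgroup[OF E.subgroup_axioms P(1)] .
    then have "P \<lhd> G"
      using Sylow_normal_if_nongenerators[OF fin E _ PE P(2) m(1) q m(2) frat] by blast
    then show ?thesis using PE P(2) by blast
  qed
  then obtain S where S: "\<And>q. prime q \<Longrightarrow> S q \<lhd> G"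
    "\<And>q. prime q \<Longrightarrow> S q \<subseteq> E"
    "\<And>q. prime q \<Longrightarrow> card (S q) = q ^ multiplicity q (card E)"
    by metis
  \<comment> \<open>For primes not dividing \<open>|E|\<close> the group \<open>S q\<close> is trivial, so no case distinction is needed below.\<close>
  obtain p where p: "prime p" "p dvd card E" using cE1 prime_factor_nat by blast
  interpret Sp: normal "S p" G by (rule S(1)[OF p(1)])
  interpret SpG: group "G\<lparr>carrier := S p\<rparr>" by (rule Sp.subgroup_is_group[OF is_group])
  have "0 < multiplicity p (card E)" using p cE0 by (simp add: prime_multiplicity_gt_zero_iff)
  then obtain z where z: "z \<in> S p" "z \<noteq> \<one>" "\<And>x. x \<in> S p \<Longrightarrow> z \<otimes> x = x \<otimes> z"
    using SpG.p_group_nontrivial_center[of p "multiplicity p (card E)"] S(3)[OF p(1)] p(1)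
    by (auto simp: order_def)
  have zE: "z \<in> E" using z(1) S(2)[OF p(1)] by blast
  let ?C = "{e \<in> E. z \<otimes> e = e \<otimes> z}"
  have C: "subgroup ?C ?GE"
  proof
    fix x y assume "x \<in> ?C" "y \<in> ?C"
    then have xy: "x \<in> E" "y \<in> E" "z \<otimes> x = x \<otimes> z" "z \<otimes> y = y \<otimes> z" by auto
    have c: "x \<in> carrier G" "y \<in> carrier G" "z \<in> carrier G" using xy zE by auto
    have "z \<otimes> (x \<otimes> y) = (x \<otimes> z) \<otimes> y" using xy(3) c m_assoc by metis
    also have "\<dots> = (x \<otimes> y) \<otimes> z" using xy(4) c by (simp add: m_assoc)
    finally show "x \<otimes>\<^bsub>?GE\<^esub> y \<in> ?C" using xy by simp
  next
    fix x assume x: "x \<in> ?C"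
    have c: "x \<in> carrier G" "z \<in> carrier G" using x zE by auto
    have "inv x \<otimes> (z \<otimes> x) \<otimes> inv x = inv x \<otimes> (x \<otimes> z) \<otimes> inv x" using x by simp
    then have "z \<otimes> inv x = inv x \<otimes> z"
      using c by (simp add: m_assoc inv_mult_cancel)
    then show "inv\<^bsub>?GE\<^esub> x \<in> ?C" using x by (simp add: m_inv_consistent[OF E.subgroup_axioms])
  qed (use zE in auto)
  have SqC: "S q \<subseteq> ?C" if q: "prime q" for q
  proof (cases "q = p")
    case True then show ?thesis using S(2)[OF p(1)] z(3) by auto
  next
    case False
    interpret Sq: normal "S q" G by (rule S(1)[OF q])
    let ?I = "S p \<inter> S q"
    have "subgroup ?I G" by (rule subgroups_Inter_pair[OF Sp.subgroup_axioms Sq.subgroup_axioms])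
    then have "card ?I dvd card (S p)" "card ?I dvd card (S q)"
      using card_subgroup_dvd Sp.subgroup_axioms Sq.subgroup_axioms by auto
    moreover have "coprime (card (S p)) (card (S q))"
      using S(3) p(1) q False by (simp add: primes_coprime)
    ultimately have "card ?I = 1" by (metis coprime_common_divisor_nat)
    then have I: "?I = {\<one>}" using Sp.one_closed Sq.one_closed by (metis IntI card_1_singletonE singletonD)
    have "z \<otimes> s = s \<otimes> z" if s: "s \<in> S q" for s
    proof -
      have c: "z \<in> carrier G" "s \<in> carrier G" using z(1) s by auto
      have "z \<otimes> (s \<otimes> inv z \<otimes> inv s) \<in> S p" using z(1) c Sp.inv_op_closed2 by simp
      moreover have "(z \<otimes> s \<otimes> inv z) \<otimes> inv s \<in> S q" using s c Sq.inv_op_closed2 by simp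
      ultimately have "(z \<otimes> s \<otimes> inv z) \<otimes> inv s \<in> ?I" using c by (simp add: m_assoc)
      then have "(z \<otimes> s) \<otimes> inv z \<otimes> inv s = \<one>" using I by blast
      then show ?thesis using c by (simp add: inv_solve_right')
    qed
    then show ?thesis using S(2)[OF q] by auto
  qed
  have SC: "card (S q) dvd card ?C" if q: "prime q" for q
  proof -
    interpret Sq: normal "S q" G by (rule S(1)[OF q])
    have C': "subgroup ?C G" using incl_subgroup[OF E.subgroup_axioms C] .
    show ?thesis
      using card_subgroup_dvd[OF Sq.subgroup_axioms C' SqC[OF q]] .
  qed
  have cC0: "card ?C \<noteq> 0" using finE E.one_closed zE by auto
  have "card E dvd card ?C"
  proof (rule multiplicity_le_imp_dvd[OF cE0])
    fix q :: nat assume q: "prime q"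
    have "q ^ multiplicity q (card E) dvd card ?C" using SC[OF q] S(3)[OF q] by simp
    then show "multiplicity q (card E) \<le> multiplicity q (card ?C)"
      using cC0 q not_prime_unit by (intro multiplicity_geI) auto
  qed
  then have "card E \<le> card ?C" using cC0 by (simp add: dvd_imp_le)
  then have "?C = E" using finE by (intro card_seteq) auto
  then have "\<forall>x\<in>E. z \<otimes> x = x \<otimes> z" by blast
  then show ?thesis using zE z(2) by blast
qed

text \<open>
  Conjugation by an element of \<open>G\<close> is an automorphism of the normal subgroup \<open>A\<close>, so it commutes with
  products taken in \<open>A\<close>.
\<close>

lemma (in group) finprod_conj:
  assumes A: "A \<lhd> G" and comm: "\<And>a b. a \<in> A \<Longrightarrow> b \<in> A \<Longrightarrow> a \<otimes> b = b \<otimes> a"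
    and q: "q \<in> carrier G" and f: "f \<in> S \<rightarrow> A" and S: "finite S"
  shows "finprod (G\<lparr>carrier := A\<rparr>) (\<lambda>X. q \<otimes> f X \<otimes> inv q) S = q \<otimes> finprod (G\<lparr>carrier := A\<rparr>) f S \<otimes> inv q"
proof -
  let ?GA = "G\<lparr>carrier := A\<rparr>"
  interpret A: normal A G by fact
  interpret AG: comm_group "?GA"
    using A.subgroup_is_group[OF is_group] comm by (intro group.group_comm_groupI) auto
  show ?thesis
    using S f
  proof (induction S)
    case empty then show ?case using q by simp
  next
    case (insert X S)
    have fX: "f X \<in> A" "f \<in> S \<rightarrow> A" using insert by auto
    have fq: "(\<lambda>X. q \<otimes> f X \<otimes> inv q) \<in> insert X S \<rightarrow> A" using insert q by (auto intro!: A.inv_op_closed2)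
    have 1: "finprod ?GA f (insert X S) = f X \<otimes> finprod ?GA f S"
      using insert fX by simp
    have 2: "finprod ?GA (\<lambda>X. q \<otimes> f X \<otimes> inv q) (insert X S)
      = (q \<otimes> f X \<otimes> inv q) \<otimes> finprod ?GA (\<lambda>X. q \<otimes> f X \<otimes> inv q) S"
      using insert fq by simp
    have 3: "finprod ?GA f S \<in> A" using AG.finprod_closed[of f S] fX by simp
    show ?case
      unfolding 1 2 insert.IH[OF fX(2)] using q fX(1) 3 A.subset
      by (simp add: m_assoc subset_iff inv_mult_cancel)
  qed
qed

text \<open>
  This is the part of the theorem of Schur and Zassenhaus needed later, under a weaker coprimality
  hypothesis. Choose a representative \<open>t X\<close> in each coset \<open>X\<close> of \<open>A\<close> and let \<open>q X\<close> denote the translate of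
  \<open>X\<close> by \<open>q\<close>. The elements \<open>c q X = q t(X) t(q X)\<^sup>-\<^sup>1\<close> of \<open>A\<close> measure how far \<open>t\<close> is from being
  equivariant, and their product \<open>D q\<close> over all \<open>X\<close> is a crossed homomorphism,
  \<open>D (q r) = (q D(r) q\<^sup>-\<^sup>1) D(q)\<close>, with \<open>D a = a\<^sup>n\<close> for \<open>a \<in> A\<close>, where \<open>n = |G : A|\<close>. Let \<open>m\<close>
  be the part of \<open>|A|\<close> prime to \<open>p\<close>. The kernel \<open>K\<close> of \<open>D\<^sup>m\<close> is a subgroup. It is proper: an element \<open>a\<close> of
  order \<open>p\<close> is mapped to \<open>a\<^sup>n\<^sup>m \<noteq> 1\<close>. It is a supplement of \<open>A\<close>: since \<open>n\<close> is invertible modulo the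
  \<open>p\<close>-part of \<open>|A|\<close>, each value of \<open>D\<^sup>m\<close> can be cancelled by multiplying with an element of \<open>A\<close>.
\<close>

lemma (in group) abelian_normal_supplement:
  assumes fin: "finite (carrier G)" and A: "A \<lhd> G"
    and comm: "\<And>a b. a \<in> A \<Longrightarrow> b \<in> A \<Longrightarrow> a \<otimes> b = b \<otimes> a"
    and p: "prime p" and pA: "p dvd card A" and pn: "\<not> p dvd card (rcosets A)"
  shows "\<exists>K. subgroup K G \<and> K \<noteq> carrier G \<and> K <#> A = carrier G"
proof -
  interpret A: normal A G by fact
  let ?AG = "G\<lparr>carrier := A\<rparr>"
  interpret AG: comm_group ?AG
    using A.subgroup_is_group[OF is_group] comm by (intro group.group_comm_groupI) auto
  let ?C = "rcosets A"
  have finA: "finite A" using fin A.subset finite_subset by blast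
  have finC: "finite ?C" using fin by (simp add: RCOSETS_def)
  define t :: "'a set \<Rightarrow> 'a" where "t X = (SOME x. x \<in> X)" for X
  have t: "t X \<in> X" "t X \<in> carrier G" "X = A #> t X" if X: "X \<in> ?C" for X
  proof -
    obtain x where x: "x \<in> carrier G" "X = A #> x" using X by (auto simp: RCOSETS_def)
    show 1: "t X \<in> X" unfolding t_def using x A.subgroup_axioms rcos_self by (metis someI)
    show 2: "t X \<in> carrier G" using 1 x A.subset r_coset_subset_G by blast
    show "X = A #> t X" using 1 x repr_independence A.subgroup_axioms by blast
  qed
  define \<sigma> where "\<sigma> q X = (A #> q) <#> X" for q X
  have \<sigma>: "\<sigma> q X \<in> ?C" "\<sigma> q X = A #> (q \<otimes> t X)" if q: "q \<in> carrier G" and X: "X \<in> ?C" for q X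
  proof -
    show "\<sigma> q X = A #> (q \<otimes> t X)" unfolding \<sigma>_def using t[OF X] q A.rcos_sum by metis
    then show "\<sigma> q X \<in> ?C" using q t(2)[OF X] by (auto simp: RCOSETS_def)
  qed
  have \<sigma>_mult: "\<sigma> (q \<otimes> r) X = \<sigma> q (\<sigma> r X)" if "q \<in> carrier G" "r \<in> carrier G" "X \<in> ?C" for q r X
  proof -
    have "\<sigma> q (\<sigma> r X) = (A #> q) <#> (A #> (r \<otimes> t X))" using that \<sigma>(2) by (simp add: \<sigma>_def)
    also have "\<dots> = A #> (q \<otimes> (r \<otimes> t X))" using that t(2)[of X] A.rcos_sum by simp
    finally show ?thesis using that t(2)[of X] \<sigma>(2) by (simp add: m_assoc)
  qed
  have \<sigma>_triv: "\<sigma> a X = X" if "a \<in> A" "X \<in> ?C" for a X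
    using that A.rcosets_mult_eq by (simp add: \<sigma>_def coset_join2 A.subgroup_axioms)
  have \<sigma>_bij: "bij_betw (\<sigma> r) ?C ?C" if r: "r \<in> carrier G" for r
  proof (rule bij_betw_byWitness[where f' = "\<sigma> (inv r)"])
    show "\<forall>X\<in>?C. \<sigma> (inv r) (\<sigma> r X) = X" "\<forall>X\<in>?C. \<sigma> r (\<sigma> (inv r) X) = X"
      using r \<sigma>_triv[OF A.one_closed] by (simp_all add: \<sigma>_mult[symmetric])
  qed (use r \<sigma> in auto)
  define c where "c q X = q \<otimes> t X \<otimes> inv (t (\<sigma> q X))" for q X
  have cA: "c q X \<in> A" if q: "q \<in> carrier G" and X: "X \<in> ?C" for q X
  proof -
    have "q \<otimes> t X \<in> \<sigma> q X" using \<sigma>(2)[OF q X] q t(2)[OF X] rcos_self A.subgroup_axioms by simp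
    then have "q \<otimes> t X \<in> A #> t (\<sigma> q X)" using t(3)[OF \<sigma>(1)[OF q X]] by simp
    then show ?thesis unfolding c_def
      using A.rcos_module_imp[OF is_group t(2)[OF \<sigma>(1)[OF q X]]] by blast
  qed
  have c_mult: "c (q \<otimes> r) X = (q \<otimes> c r X \<otimes> inv q) \<otimes> c q (\<sigma> r X)"
    if "q \<in> carrier G" "r \<in> carrier G" "X \<in> ?C" for q r X
    using that t(2)[of X] t(2)[OF \<sigma>(1), of r X] t(2)[OF \<sigma>(1)[OF _ \<sigma>(1)], of q r X]
    by (simp add: c_def \<sigma>_mult m_assoc inv_mult_cancel)
  define D where "D q = finprod ?AG (c q) ?C" for q
  have DA: "D q \<in> A" if "q \<in> carrier G" for q
    unfolding D_def using AG.finprod_closed[of "c q" ?C] cA[OF that] by auto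
  have D_mult: "D (q \<otimes> r) = (q \<otimes> D r \<otimes> inv q) \<otimes> D q" if qr: "q \<in> carrier G" "r \<in> carrier G" for q r
  proof -
    have "D (q \<otimes> r) = finprod ?AG (\<lambda>X. (q \<otimes> c r X \<otimes> inv q) \<otimes>\<^bsub>?AG\<^esub> c q (\<sigma> r X)) ?C"
      unfolding D_def
    proof (rule AG.finprod_cong')
      show "(\<lambda>X. (q \<otimes> c r X \<otimes> inv q) \<otimes>\<^bsub>?AG\<^esub> c q (\<sigma> r X)) \<in> ?C \<rightarrow> carrier ?AG"
        using qr cA \<sigma>(1) by (auto intro!: A.inv_op_closed2)
    qed (use c_mult qr in auto)
    also have "\<dots> = finprod ?AG (\<lambda>X. q \<otimes> c r X \<otimes> inv q) ?C \<otimes>\<^bsub>?AG\<^esub> finprod ?AG (\<lambda>X. c q (\<sigma> r X)) ?C"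
      by (rule AG.finprod_multf) (use qr cA \<sigma>(1) in \<open>auto intro!: A.inv_op_closed2\<close>)
    also have "finprod ?AG (\<lambda>X. q \<otimes> c r X \<otimes> inv q) ?C = q \<otimes> D r \<otimes> inv q"
      unfolding D_def by (rule finprod_conj[OF A comm]) (use qr cA finC in auto)
    also have "finprod ?AG (\<lambda>X. c q (\<sigma> r X)) ?C = finprod ?AG (c q) (\<sigma> r ` ?C)"
      by (rule AG.finprod_reindex[symmetric])
         (use \<sigma>_bij[OF qr(2)] cA qr \<sigma>(1) in \<open>auto simp: bij_betw_def\<close>)
    also have "\<sigma> r ` ?C = ?C" using \<sigma>_bij[OF qr(2)] by (simp add: bij_betw_def)
    finally show ?thesis by (simp add: D_def)
  qed
  let ?n = "card ?C"
  have D_A: "D a = a [^] ?n" if a: "a \<in> A" for a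
  proof -
    have "D a = finprod ?AG (\<lambda>X. a) ?C" unfolding D_def
    proof (rule AG.finprod_cong')
      fix X assume X: "X \<in> ?C"
      show "c a X = a" using a X \<sigma>_triv[OF a X] t(2)[OF X] A.subset by (auto simp: c_def m_assoc)
    qed (use a in auto)
    then show ?thesis using AG.finprod_const[of a ?C] a by (simp add: nat_pow_consistent[symmetric])
  qed
  define k where "k = multiplicity p (card A)"
  have cA0: "card A \<noteq> 0" using finA A.one_closed by (metis card_0_eq empty_iff)
  obtain m where m: "card A = p ^ k * m" "\<not> p dvd m"
    using multiplicity_decompose'[of "card A" p] cA0 p unfolding k_def by (metis not_prime_unit)
  have powA: "x [^] (card A) = \<one>" if "x \<in> A" for x
    using AG.pow_order_eq_1[of x] that by (simp add: order_def nat_pow_consistent[symmetric])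
  let ?K = "{q \<in> carrier G. D q [^] m = \<one>}"
  have D'_mult: "D (q \<otimes> r) [^] m = (q \<otimes> D r [^] m \<otimes> inv q) \<otimes> D q [^] m"
    if qr: "q \<in> carrier G" "r \<in> carrier G" for q r
  proof -
    have Dr: "D r \<in> carrier G" using DA[OF qr(2)] by simp
    have conj: "(q \<otimes> D r \<otimes> inv q) [^] (j::nat) = q \<otimes> D r [^] j \<otimes> inv q" for j
      by (induction j) (use qr Dr in \<open>simp_all add: m_assoc inv_mult_cancel\<close>)
    have "D (q \<otimes> r) [^] m = (q \<otimes> D r \<otimes> inv q) [^] m \<otimes> D q [^] m"
      unfolding D_mult[OF qr]
      using AG.nat_pow_distrib[of "q \<otimes> D r \<otimes> inv q" "D q" m] DA qr A.inv_op_closed2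
      by (simp add: nat_pow_consistent[symmetric])
    then show ?thesis by (simp add: conj)
  qed
  have pow_A: "x [^] (j::nat) \<in> A" if "x \<in> A" for x j
    using AG.nat_pow_closed[of x j] that by (simp add: nat_pow_consistent[symmetric])
  have K: "subgroup ?K G"
  proof (rule subgroupI)
    show "?K \<noteq> {}" using D_A[OF A.one_closed] by (auto intro!: exI[of _ \<one>])
  next
    fix x assume x: "x \<in> ?K"
    have xc: "x \<in> carrier G" "D x [^] m = \<one>" using x by auto
    have Dc: "D (inv x) \<in> carrier G" using DA[of "inv x"] xc by simp
    have "D (x \<otimes> inv x) [^] m = \<one>" using xc(1) D_A[OF A.one_closed] by simp
    then have "x \<otimes> D (inv x) [^] m \<otimes> inv x = \<one>"
      using D'_mult[OF xc(1) inv_closed[OF xc(1)]] xc Dc by simp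
    then have "D (inv x) [^] m = \<one>" using xc(1) Dc
      by (simp add: inv_solve_right')
    then show "inv x \<in> ?K" using x by simp
  next
    fix x y assume "x \<in> ?K" "y \<in> ?K"
    then show "x \<otimes> y \<in> ?K" using D'_mult[of x y] by simp
  qed auto
  have "?K \<noteq> carrier G"
  proof
    assume KG: "?K = carrier G"
    obtain P where P: "subgroup P ?AG" "card P = p ^ 1"
      using sylow_thm[OF p AG.is_group, of 1 "card A div p"] pA finA by (auto simp: order_def)
    have "P \<noteq> {\<one>}" using P(2) p by (auto simp: not_prime_1)
    then obtain a where a: "a \<in> P" "a \<noteq> \<one>"
      using subgroup.one_closed[OF P(1)] by auto
    have aA: "a \<in> A" using a(1) subgroup.subset[OF P(1)] by auto
    have "a [^] p = \<one>"
      using group.pow_order_eq_1[OF subgroup.subgroup_is_group[OF P(1) AG.is_group], of a] a(1) P(2)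
      by (simp add: order_def nat_pow_consistent[symmetric])
    then have "ord a dvd p" using aA pow_eq_id by auto
    moreover have "a \<in> ?K" unfolding KG using aA by simp
    then have "D a [^] m = \<one>" by simp
    then have "a [^] (?n * m) = \<one>" using D_A[OF aA] aA by (simp add: nat_pow_pow)
    then have "ord a dvd ?n * m" using aA pow_eq_id by auto
    moreover have "coprime p (?n * m)" using pn m(2) p by (simp add: prime_imp_coprime_nat)
    ultimately have "ord a = 1" by (metis coprime_common_divisor_nat)
    then show False using a(2) aA ord_eq_1 by auto
  qed
  moreover have "q \<in> ?K <#> A" if q: "q \<in> carrier G" for q
  proof -
    have "coprime (p ^ k) ?n" using pn p by (simp add: prime_imp_coprime_nat)
    \<comment> \<open>The value \<open>b = D(q)\<^sup>m\<close> has order dividing \<open>p\<^sup>k\<close>, so the power \<open>a\<close> of \<open>D q\<close> below satisfies \<open>D(a)\<^sup>m = b\<^sup>-\<^sup>1\<close>.\<close>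
    then obtain i where i: "[?n * i = 1] (mod p ^ k)"
      using cong_solve_coprime_nat[of ?n "p ^ k"] by (auto simp: coprime_commute)
    let ?b = "D q [^] m"
    have b: "?b \<in> A" using DA[OF q] pow_A by blast
    define a where "a = inv (D q [^] i)"
    have aA: "a \<in> A" unfolding a_def using DA[OF q] pow_A by simp
    have bpk: "?b [^] (p ^ k) = \<one>"
      using DA[OF q] powA[of "D q"] m(1) by (simp add: nat_pow_pow mult.commute)
    have "D a [^] m = inv (?b [^] (?n * i))"
      using D_A[OF aA] DA[OF q] by (simp add: a_def nat_pow_inv[symmetric] nat_pow_pow ac_simps)
    also have "?b [^] (?n * i) = ?b [^] (1::nat)"
    proof -
      have bc: "?b \<in> carrier G" using b by simp
      have "?b [^] j = ?b [^] (j mod p ^ k)" for j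
      proof -
        have "?b [^] j = ?b [^] (p ^ k * (j div p ^ k) + j mod p ^ k)" by simp
        also have "\<dots> = (?b [^] (p ^ k)) [^] (j div p ^ k) \<otimes> ?b [^] (j mod p ^ k)"
          using bc by (simp only: nat_pow_mult[symmetric] nat_pow_pow[symmetric])
        finally show ?thesis using bpk bc by (simp del: mult_div_mod_eq)
      qed
      then show ?thesis using i unfolding cong_def by metis
    qed
    finally have Da: "D a [^] m = inv ?b" using b by simp
    have "D (a \<otimes> q) [^] m = (a \<otimes> ?b \<otimes> inv a) \<otimes> inv ?b"
      using D'_mult[of a q] aA q Da by simp
    also have "\<dots> = \<one>" using comm[OF aA b] aA b by (simp add: m_assoc)
    finally have "a \<otimes> q \<in> ?K" using aA q by simp
    then have "inv (a \<otimes> q) \<in> ?K" using subgroup.m_inv_closed[OF K] by blast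
    have "q = (a \<otimes> q) \<otimes> (inv q \<otimes> inv a \<otimes> q)" using q aA by (simp add: m_assoc inv_mult_cancel)
    moreover have "inv q \<otimes> inv a \<otimes> q \<in> A" using A.inv_op_closed1[OF q, of "inv a"] aA by simp
    ultimately show ?thesis using \<open>a \<otimes> q \<in> ?K\<close> unfolding set_mult_def by blast
  qed
  then have "?K <#> A = carrier G" using set_mult_closed[of ?K A] A.subset by auto
  ultimately show ?thesis using K by blast
qed

section \<open>Normal subgroups consisting of non-generators\<close>

text \<open>
  Once representatives \<open>t X\<close> of the cosets of \<open>L\<close> are fixed, a coset of \<open>K\<close> is uniquely of the form
  \<open>K l t(X)\<close> with \<open>l \<in> L\<close>. This is a bijection, so the formula holds for infinite indices as well.
\<close>

lemma (in group) card_rcosets_tower: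
  assumes K: "subgroup K G" and L: "subgroup L G" and KL: "K \<subseteq> L"
  shows "card (rcosets K) = card (rcosets L) * card (rcosets\<^bsub>G\<lparr>carrier := L\<rparr>\<^esub> K)"
proof -
  let ?GL = "G\<lparr>carrier := L\<rparr>"
  interpret K: subgroup K G by fact
  interpret L: subgroup L G by fact
  define t :: "'a set \<Rightarrow> 'a" where "t X = (SOME x. x \<in> X)" for X
  have t: "t X \<in> carrier G" "X = L #> t X" if X: "X \<in> rcosets L" for X
  proof -
    obtain x where x: "x \<in> carrier G" "X = L #> x" using X by (auto simp: RCOSETS_def)
    have 1: "t X \<in> X" unfolding t_def using x L rcos_self by (metis someI)
    show "t X \<in> carrier G" using 1 x L.subset r_coset_subset_G by blast
    show "X = L #> t X" using 1 x repr_independence L by blast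
  qed
  let ?f = "\<lambda>(X, R). R #> t X"
  have RL: "rcosets\<^bsub>?GL\<^esub> K = (\<lambda>l. K #> l) ` L"
    by (auto simp: RCOSETS_def)
  have f: "?f (X, K #> l) = K #> (l \<otimes> t X)" if "X \<in> rcosets L" "l \<in> L" for X l
    using that t(1) K.subset L.subset by (simp add: coset_mult_assoc subset_iff)
  have same: "x \<otimes> inv y \<in> K" if "K #> x = K #> y" "x \<in> carrier G" "y \<in> carrier G" for x y
    using that K.rcos_module_imp[OF is_group, of y x] rcos_self[OF that(2) K] by simp
  have "inj_on ?f ((rcosets L) \<times> (\<lambda>l. K #> l) ` L)"
  proof (rule inj_onI, clarify)
    fix X Y l m assume X: "X \<in> rcosets L" and Y: "Y \<in> rcosets L" and l: "l \<in> L" and m: "m \<in> L"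
      and eq: "(K #> l) #> t X = (K #> m) #> t Y"
    have lc: "l \<in> carrier G" "m \<in> carrier G" using l m by auto
    note tc = t(1)[OF X] t(1)[OF Y]
    have eq': "K #> (l \<otimes> t X) = K #> (m \<otimes> t Y)" using eq f[OF X l] f[OF Y m] by simp
    then have "(l \<otimes> t X) \<otimes> inv (m \<otimes> t Y) \<in> L" using same lc tc KL by blast
    then have "inv l \<otimes> ((l \<otimes> t X) \<otimes> inv (m \<otimes> t Y)) \<otimes> m \<in> L" using l m by blast
    then have "t X \<otimes> inv (t Y) \<in> L"
      using lc tc by (simp add: inv_mult_group m_assoc inv_mult_cancel)
    then have "t X \<in> L #> t Y" using L.rcos_module_rev[OF is_group tc(2) tc(1)] by blast
    then have "L #> t X = L #> t Y" using repr_independence[OF _ tc(2) L] by simp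
    then have XY: "X = Y" using t(2) X Y by metis
    have "K #> l = K #> (l \<otimes> t X) #> inv (t X)"
      using lc tc K.subset by (simp add: coset_mult_assoc m_assoc)
    also have "\<dots> = K #> m"
      unfolding eq' using XY lc tc K.subset by (simp add: coset_mult_assoc m_assoc)
    finally show "X = Y \<and> K #> l = K #> m" using XY by simp
  qed
  moreover have "?f ` ((rcosets L) \<times> (\<lambda>l. K #> l) ` L) = rcosets K"
  proof (intro equalityI subsetI)
    fix R assume "R \<in> ?f ` ((rcosets L) \<times> (\<lambda>l. K #> l) ` L)"
    then obtain X l where X: "X \<in> rcosets L" "l \<in> L" "R = ?f (X, K #> l)" by auto
    then show "R \<in> rcosets K" using f[OF X(1,2)] t(1)[OF X(1)] L.subset
      by (auto simp: RCOSETS_def)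
  next
    fix R assume "R \<in> rcosets K"
    then obtain g where g: "g \<in> carrier G" "R = K #> g" by (auto simp: RCOSETS_def)
    define X where "X = L #> g"
    have X: "X \<in> rcosets L" using g L.subset by (auto simp: X_def RCOSETS_def)
    have "g \<in> L #> t X" using t(2)[OF X] rcos_self[OF g(1) L] X_def by simp
    then have l: "g \<otimes> inv (t X) \<in> L" using L.rcos_module_imp[OF is_group t(1)[OF X]] by blast
    have "R = ?f (X, K #> (g \<otimes> inv (t X)))" using f[OF X l] g t(1)[OF X] by (simp add: m_assoc)
    then show "R \<in> ?f ` ((rcosets L) \<times> (\<lambda>l. K #> l) ` L)" using X l by blast
  qed
  ultimately have "card (rcosets K) = card ((rcosets L) \<times> (\<lambda>l. K #> l) ` L)"
    by (metis card_image)
  then show ?thesis by (simp add: card_cartesian_product RL)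
qed

lemma (in group) coset_representatives:
  assumes N: "subgroup N G" and fin: "finite (rcosets N)" and H: "subgroup H G" and NH: "N \<subseteq> H"
  obtains R where "finite R" "R \<subseteq> H" "\<And>L. N \<subseteq> L \<Longrightarrow> subgroup L G \<Longrightarrow> R \<subseteq> L \<Longrightarrow> H \<subseteq> L"
proof -
  define r :: "'a set \<Rightarrow> 'a" where "r X = (SOME x. x \<in> X)" for X
  have r: "r (N #> h) \<in> N #> h" if "h \<in> H" for h
    unfolding r_def using rcos_self[OF subgroup.mem_carrier[OF H that] N] by (rule someI)
  let ?R = "r ` ((\<lambda>h. N #> h) ` H)"
  show thesis
  proof (rule that[of ?R])
    have "(\<lambda>h. N #> h) ` H \<subseteq> rcosets N" using subgroup.subset[OF H] by (auto simp: RCOSETS_def)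
    then show "finite ?R" using fin finite_subset by blast
    have "N #> h \<subseteq> H" if "h \<in> H" for h using that NH subgroup.m_closed[OF H] by (auto simp: r_coset_def)
    then show "?R \<subseteq> H" using r by blast
    fix L assume L: "N \<subseteq> L" "subgroup L G" "?R \<subseteq> L"
    interpret L: subgroup L G by fact
    show "H \<subseteq> L"
    proof
      fix h assume h: "h \<in> H"
      have hc: "h \<in> carrier G" using subgroup.mem_carrier[OF H h] .
      obtain n where n: "n \<in> N" "r (N #> h) = n \<otimes> h" using r[OF h] by (auto simp: r_coset_def)
      have nc: "n \<in> L" "n \<in> carrier G" using n(1) L(1) by auto
      have "n \<otimes> h \<in> L" using L(3) h n(2) by force
      then have "inv n \<otimes> (n \<otimes> h) \<in> L" using nc by blast
      then show "h \<in> L" using nc hc by (simp add: inv_mult_cancel)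
    qed
  qed
qed

lemma (in group) center_of_normal_subgroup_normal:
  assumes "E \<lhd> G"
  shows "{z \<in> E. \<forall>x\<in>E. z \<otimes> x = x \<otimes> z} \<lhd> G"
proof -
  interpret E: normal E G by fact
  let ?Z = "{z \<in> E. \<forall>x\<in>E. z \<otimes> x = x \<otimes> z}"
  have "subgroup ?Z G"
  proof (rule subgroupI)
    show "?Z \<noteq> {}" using E.one_closed by (auto intro!: exI[of _ \<one>])
  next
    fix x assume x: "x \<in> ?Z"
    have "inv x \<otimes> y = y \<otimes> inv x" if y: "y \<in> E" for y
    proof -
      have c: "x \<in> carrier G" "y \<in> carrier G" using x y by auto
      have "x \<otimes> y = y \<otimes> x" using x y by blast
      then have "inv x \<otimes> (x \<otimes> y) \<otimes> inv x = inv x \<otimes> (y \<otimes> x) \<otimes> inv x" by simp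
      then show ?thesis using c by (simp add: m_assoc inv_mult_cancel)
    qed
    then show "inv x \<in> ?Z" using x by auto
  next
    fix x y assume xy: "x \<in> ?Z" "y \<in> ?Z"
    have "(x \<otimes> y) \<otimes> z = z \<otimes> (x \<otimes> y)" if z: "z \<in> E" for z
    proof -
      have c: "x \<in> carrier G" "y \<in> carrier G" "z \<in> carrier G" using xy z by auto
      have e: "x \<otimes> z = z \<otimes> x" "y \<otimes> z = z \<otimes> y" using xy z by auto
      have "(x \<otimes> y) \<otimes> z = x \<otimes> (z \<otimes> y)" using c e(2) by (simp add: m_assoc)
      also have "\<dots> = (z \<otimes> x) \<otimes> y" using c e(1) by (simp add: m_assoc[symmetric])
      finally show ?thesis using c by (simp add: m_assoc)
    qed
    moreover have "x \<otimes> y \<in> E" using xy by blast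
    ultimately show "x \<otimes> y \<in> ?Z" by simp
  qed auto
  moreover have "g \<otimes> z \<otimes> inv g \<in> ?Z" if g: "g \<in> carrier G" and z: "z \<in> ?Z" for g z
  proof -
    have "(g \<otimes> z \<otimes> inv g) \<otimes> x = x \<otimes> (g \<otimes> z \<otimes> inv g)" if x: "x \<in> E" for x
    proof -
      have c: "g \<in> carrier G" "z \<in> carrier G" "x \<in> carrier G" using g z x by auto
      have "z \<otimes> (inv g \<otimes> x \<otimes> g) = (inv g \<otimes> x \<otimes> g) \<otimes> z"
        using z E.inv_op_closed1[OF g x] by blast
      then have "g \<otimes> (z \<otimes> (inv g \<otimes> x \<otimes> g)) \<otimes> inv g = g \<otimes> ((inv g \<otimes> x \<otimes> g) \<otimes> z) \<otimes> inv g" by simp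
      then show ?thesis using c by (simp add: m_assoc inv_mult_cancel)
    qed
    then show ?thesis using E.inv_op_closed2[OF g] z by auto
  qed
  ultimately show ?thesis using normal_inv_iff by blast
qed

text \<open>
  Pass to the finite group \<open>Q = G/M\<close>, where the image \<open>E\<close> of \<open>N\<close> consists of non-generators. The centre
  \<open>C\<close> of \<open>E\<close> is nontrivial, and \<open>Z\<close> is its preimage. A prime dividing \<open>|C|\<close> but not \<open>|Q : C|\<close> would give
  a proper supplement of \<open>C\<close>, hence of \<open>E\<close>.
\<close>

lemma (in group) nongenerator_central_step:
  assumes N: "N \<lhd> G" and M: "M \<lhd> G" and MN: "M \<subset> N" and fin: "finite (rcosets M)"
    and frat: "\<forall>K. subgroup K G \<longrightarrow> M \<subseteq> K \<longrightarrow> K <#> N = carrier G \<longrightarrow> K = carrier G"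
  shows "\<exists>Z. Z \<lhd> G \<and> M \<subset> Z \<and> Z \<subseteq> N \<and> (\<forall>z\<in>Z. \<forall>x\<in>N. z \<otimes> x \<otimes> inv z \<otimes> inv x \<in> M) \<and>
    (\<forall>p. prime p \<longrightarrow> p dvd card (rcosets M) \<longrightarrow> p dvd card (rcosets Z))"
proof -
  interpret N: normal N G by fact
  interpret M: normal M G by fact
  define Q where "Q = G Mod M"
  interpret Q: group Q unfolding Q_def by (rule M.factorgroup_is_group)
  define \<pi> where "\<pi> x = M #> x" for x
  interpret h: group_hom G Q \<pi>
    using M.r_coset_hom_Mod by unfold_locales (simp add: \<pi>_def[abs_def] Q_def)
  have surj: "\<pi> ` carrier G = carrier Q" by (simp add: \<pi>_def Q_def carrier_FactGroup)
  have ker: "\<pi> x = \<one>\<^bsub>Q\<^esub> \<longleftrightarrow> x \<in> M" if "x \<in> carrier G" for x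
    using that coset_join1[of M x] coset_join2[OF that] M.subgroup_axioms M.subset by (auto simp: \<pi>_def Q_def)
  have eq: "x \<otimes> inv y \<in> M" if "\<pi> x = \<pi> y" "x \<in> carrier G" "y \<in> carrier G" for x y
    using that ker[of "x \<otimes> inv y"] by simp
  have finQ: "finite (carrier Q)" using fin by (simp add: Q_def FactGroup_def)
  define E where "E = \<pi> ` N"
  have \<pi>N: "x \<in> N" if x: "x \<in> carrier G" "\<pi> x \<in> E" for x
  proof -
    obtain n where n: "n \<in> N" "\<pi> x = \<pi> n" using x(2) by (auto simp: E_def)
    then have "x \<otimes> inv n \<in> N" using eq[OF n(2) x(1)] MN by auto
    then have "x \<otimes> inv n \<otimes> n \<in> N" using n(1) by blast
    then show ?thesis using x(1) n(1) by (simp add: m_assoc)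
  qed
  have E: "E \<lhd> Q"
    unfolding E_def
  proof (rule Q.normal_inv_iff[THEN iffD2], intro conjI ballI)
    show "subgroup (\<pi> ` N) Q" by (rule h.subgroup_img_is_subgroup[OF N.subgroup_axioms])
    fix X Y assume X: "X \<in> carrier Q" and Y: "Y \<in> \<pi> ` N"
    obtain x n where x: "x \<in> carrier G" "X = \<pi> x" "n \<in> N" "Y = \<pi> n" using X Y unfolding surj[symmetric] by blast
    have "X \<otimes>\<^bsub>Q\<^esub> Y \<otimes>\<^bsub>Q\<^esub> inv\<^bsub>Q\<^esub> X = \<pi> (x \<otimes> n \<otimes> inv x)"
      using x h.hom_mult h.hom_inv N.mem_carrier by simp
    then show "X \<otimes>\<^bsub>Q\<^esub> Y \<otimes>\<^bsub>Q\<^esub> inv\<^bsub>Q\<^esub> X \<in> \<pi> ` N"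
      using N.inv_op_closed2[OF x(1,3)] by blast
  qed
  interpret E: normal E Q by fact
  have E1: "E \<noteq> {\<one>\<^bsub>Q\<^esub>}"
  proof
    assume "E = {\<one>\<^bsub>Q\<^esub>}"
    then have "\<pi> n = \<one>\<^bsub>Q\<^esub>" if "n \<in> N" for n using that unfolding E_def by blast
    then have "N \<subseteq> M" using ker N.subset by (metis subsetD subsetI)
    then show False using MN by blast
  qed
  have pre: "subgroup {x \<in> carrier G. \<pi> x \<in> K} G" if K: "subgroup K Q" for K
    by (rule subgroupI)
       (use subgroup.one_closed[OF K] subgroup.m_closed[OF K] subgroup.m_inv_closed[OF K] in
         \<open>auto simp: h.hom_one intro!: exI[of _ \<one>]\<close>)
  have preM: "M \<subseteq> {x \<in> carrier G. \<pi> x \<in> K}" if K: "subgroup K Q" for K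
  proof
    fix m assume m: "m \<in> M"
    then have mc: "m \<in> carrier G" using M.subset by blast
    then have "\<pi> m = \<one>\<^bsub>Q\<^esub>" using ker m by blast
    then show "m \<in> {x \<in> carrier G. \<pi> x \<in> K}" using subgroup.one_closed[OF K] mc by simp
  qed
  have fratQ: "K = carrier Q" if K: "subgroup K Q" and KE: "K <#>\<^bsub>Q\<^esub> E = carrier Q" for K
  proof -
    let ?K = "{x \<in> carrier G. \<pi> x \<in> K}"
    have "g \<in> ?K <#> N" if g: "g \<in> carrier G" for g
    proof -
      have "\<pi> g \<in> K <#>\<^bsub>Q\<^esub> E" using g surj KE by blast
      then obtain X Y where XY: "X \<in> K" "Y \<in> E" "\<pi> g = X \<otimes>\<^bsub>Q\<^esub> Y" by (auto simp: set_mult_def)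
      obtain n where n: "n \<in> N" "Y = \<pi> n" using XY(2) by (auto simp: E_def)
      have Xc: "X \<in> carrier Q" using XY(1) subgroup.subset[OF K] by blast
      have "\<pi> (g \<otimes> inv n) = X \<otimes>\<^bsub>Q\<^esub> Y \<otimes>\<^bsub>Q\<^esub> inv\<^bsub>Q\<^esub> Y"
        using g n XY(3) by simp
      also have "\<dots> = X" using Xc n N.mem_carrier by (simp add: Q.m_assoc)
      finally have "g \<otimes> inv n \<in> ?K" using g n XY(1) by simp
      moreover have "g = (g \<otimes> inv n) \<otimes> n" using g n by (simp add: m_assoc)
      ultimately show ?thesis using n(1) unfolding set_mult_def by blast
    qed
    then have "?K <#> N = carrier G" using set_mult_closed[of ?K N] N.subset by auto
    then have "?K = carrier G" using frat pre[OF K] preM[OF K] by blast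
    then have "\<And>g. g \<in> carrier G \<Longrightarrow> \<pi> g \<in> K" by blast
    then have "carrier Q \<subseteq> K" unfolding surj[symmetric] by blast
    then show ?thesis using subgroup.subset[OF K] by blast
  qed
  define C where "C = {z \<in> E. \<forall>x\<in>E. z \<otimes>\<^bsub>Q\<^esub> x = x \<otimes>\<^bsub>Q\<^esub> z}"
  have C: "C \<lhd> Q" unfolding C_def by (rule Q.center_of_normal_subgroup_normal[OF E])
  interpret C: normal C Q by fact
  define Z where "Z = {x \<in> carrier G. \<pi> x \<in> C}"
  have Z_iff: "x \<in> Z \<longleftrightarrow> x \<in> carrier G \<and> \<pi> x \<in> C" for x unfolding Z_def by (rule mem_Collect_eq)
  have Zsub: "subgroup Z G" unfolding Z_def by (rule pre[OF C.subgroup_axioms])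
  interpret Z: subgroup Z G by fact
  have Z: "Z \<lhd> G"
  proof (rule normal_inv_iff[THEN iffD2], intro conjI ballI Zsub)
    fix x z assume xz: "x \<in> carrier G" "z \<in> Z"
    then have "\<pi> x \<otimes>\<^bsub>Q\<^esub> \<pi> z \<otimes>\<^bsub>Q\<^esub> inv\<^bsub>Q\<^esub> \<pi> x \<in> C"
      using C.inv_op_closed2 h.hom_closed Z_iff by metis
    moreover have "\<pi> (x \<otimes> z \<otimes> inv x) = \<pi> x \<otimes>\<^bsub>Q\<^esub> \<pi> z \<otimes>\<^bsub>Q\<^esub> inv\<^bsub>Q\<^esub> \<pi> x"
      using xz(1) Z.mem_carrier[OF xz(2)] by simp
    moreover have "x \<otimes> z \<otimes> inv x \<in> carrier G" using xz(1) Z.mem_carrier[OF xz(2)] by simp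
    ultimately show "x \<otimes> z \<otimes> inv x \<in> Z" using Z_iff by metis
  qed
  have MZ: "M \<subseteq> Z" unfolding Z_def by (rule preM[OF C.subgroup_axioms])
  have "M \<noteq> Z"
  proof
    assume "M = Z"
    obtain z where z: "z \<in> E" "z \<noteq> \<one>\<^bsub>Q\<^esub>" "\<forall>x\<in>E. z \<otimes>\<^bsub>Q\<^esub> x = x \<otimes>\<^bsub>Q\<^esub> z"
      using Q.nongenerators_nontrivial_center[OF finQ E E1 fratQ] by blast
    obtain x where x: "x \<in> carrier G" "z = \<pi> x" using z(1) surj E.subset by blast
    have "z \<in> C" unfolding C_def using z(1,3) by blast
    then have "x \<in> Z" using x unfolding Z_def by blast
    then show False using \<open>M = Z\<close> ker[OF x(1)] x(2) z(2) by simp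
  qed
  then have MZ': "M \<subset> Z" using MZ by blast
  have CE: "C \<subseteq> E" unfolding C_def by blast
  have ZN: "Z \<subseteq> N" using \<pi>N CE unfolding Z_def by blast
  have comm: "z \<otimes> x \<otimes> inv z \<otimes> inv x \<in> M" if z: "z \<in> Z" and x: "x \<in> N" for z x
  proof -
    have c: "z \<in> carrier G" "x \<in> carrier G" using z x by auto
    have "\<pi> z \<in> C" "\<pi> x \<in> E" using z x Z_iff unfolding E_def by blast+
    then have "\<pi> z \<otimes>\<^bsub>Q\<^esub> \<pi> x = \<pi> x \<otimes>\<^bsub>Q\<^esub> \<pi> z" unfolding C_def by blast
    then have "\<pi> (z \<otimes> x) = \<pi> (x \<otimes> z)" using c by simp
    then have "(z \<otimes> x) \<otimes> inv (x \<otimes> z) \<in> M" using eq c by simp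
    then show ?thesis using c by (simp add: inv_mult_group m_assoc)
  qed
  have prime: "p dvd card (rcosets Z)" if p: "prime p" and dvd: "p dvd card (rcosets M)" for p
  proof (rule ccontr)
    assume np: "\<not> p dvd card (rcosets Z)"
    have tower: "card (rcosets M) = card (rcosets Z) * card (rcosets\<^bsub>G\<lparr>carrier := Z\<rparr>\<^esub> M)"
      by (rule card_rcosets_tower[OF M.subgroup_axioms Zsub MZ])
    have "C = \<pi> ` Z"
    proof
      show "\<pi> ` Z \<subseteq> C" using Z_iff by blast
      show "C \<subseteq> \<pi> ` Z"
      proof
        fix X assume X: "X \<in> C"
        then have "X \<in> \<pi> ` carrier G" unfolding surj using C.subset by blast
        then obtain x where "x \<in> carrier G" "X = \<pi> x" by blast
        then show "X \<in> \<pi> ` Z" using X Z_iff by blast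
      qed
    qed
    also have "\<dots> = rcosets\<^bsub>G\<lparr>carrier := Z\<rparr>\<^esub> M" by (auto simp: RCOSETS_def \<pi>_def)
    finally have CR: "C = rcosets\<^bsub>G\<lparr>carrier := Z\<rparr>\<^esub> M" .
    then have pC: "p dvd card C" using dvd np tower p by (simp add: prime_dvd_mult_iff)
    have "card (rcosets\<^bsub>Q\<^esub> C) * card C = card (rcosets M)"
      using Q.lagrange[OF C.subgroup_axioms] by (simp add: Q_def order_def FactGroup_def)
    moreover have "card C \<noteq> 0" using finQ C.subset C.one_closed finite_subset by (metis card_0_eq empty_iff)
    ultimately have "card (rcosets\<^bsub>Q\<^esub> C) = card (rcosets Z)" using tower CR by simp
    then have "\<not> p dvd card (rcosets\<^bsub>Q\<^esub> C)" using np by simp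
    then obtain K where K: "subgroup K Q" "K \<noteq> carrier Q" "K <#>\<^bsub>Q\<^esub> C = carrier Q"
      using Q.abelian_normal_supplement[OF finQ C _ p pC] unfolding C_def by blast
    have "carrier Q \<subseteq> K <#>\<^bsub>Q\<^esub> E" using K(3) mono_set_mult[of K K C E Q] CE by blast
    then have "K <#>\<^bsub>Q\<^esub> E = carrier Q"
      using Q.set_mult_closed[OF subgroup.subset[OF K(1)] E.subset] by blast
    then show False using fratQ[OF K(1)] K(2) by blast
  qed
  show ?thesis using Z MZ' ZN comm prime by blast
qed

definition commutators :: "('a, 'm) monoid_scheme \<Rightarrow> 'a set \<Rightarrow> 'a set" where
  "commutators G A =
    {x \<otimes>\<^bsub>G\<^esub> y \<otimes>\<^bsub>G\<^esub> inv\<^bsub>G\<^esub> x \<otimes>\<^bsub>G\<^esub> inv\<^bsub>G\<^esub> y | x y. x \<in> A \<and> y \<in> carrier G}"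

lemma commutators_mono: "A \<subseteq> B \<Longrightarrow> commutators G A \<subseteq> commutators G B"
  unfolding commutators_def by blast

lemma lower_central_series_Suc:
  "lower_central_series G (Suc n) = generate G (commutators G (lower_central_series G n))"
  by (simp add: commutators_def)

lemma (in group) commutators_in_carrier: "A \<subseteq> carrier G \<Longrightarrow> commutators G A \<subseteq> carrier G"
  by (auto simp: commutators_def)

lemma (in group) lower_central_series_subset: "lower_central_series G n \<subseteq> carrier G"
proof (induction n)
  case (Suc n)
  then show ?case unfolding lower_central_series_Suc by (intro generate_incl commutators_in_carrier)
qed simp

lemma (in group_hom) commutators_hom:
  assumes A: "A \<subseteq> carrier G"
  shows "h ` commutators G A \<subseteq> commutators H (h ` A)"
    and "h ` carrier G = carrier H \<Longrightarrow> commutators H (h ` A) \<subseteq> h ` commutators G A"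
proof -
  have h: "h (x \<otimes> y \<otimes> inv x \<otimes> inv y) = h x \<otimes>\<^bsub>H\<^esub> h y \<otimes>\<^bsub>H\<^esub> inv\<^bsub>H\<^esub> h x \<otimes>\<^bsub>H\<^esub> inv\<^bsub>H\<^esub> h y"
    if "x \<in> A" "y \<in> carrier G" for x y using that A by (auto simp: subset_iff)
  show "h ` commutators G A \<subseteq> commutators H (h ` A)"
  proof (rule image_subsetI)
    fix z assume "z \<in> commutators G A"
    then obtain x y where "x \<in> A" "y \<in> carrier G" "z = x \<otimes> y \<otimes> inv x \<otimes> inv y"
      unfolding commutators_def by blast
    then show "h z \<in> commutators H (h ` A)" using h hom_closed unfolding commutators_def by blast
  qed
  assume surj: "h ` carrier G = carrier H"
  show "commutators H (h ` A) \<subseteq> h ` commutators G A"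
  proof
    fix z assume "z \<in> commutators H (h ` A)"
    then obtain x v where x: "x \<in> A" "v \<in> carrier H"
      "z = h x \<otimes>\<^bsub>H\<^esub> v \<otimes>\<^bsub>H\<^esub> inv\<^bsub>H\<^esub> h x \<otimes>\<^bsub>H\<^esub> inv\<^bsub>H\<^esub> v"
      unfolding commutators_def by blast
    then obtain y where y: "y \<in> carrier G" "v = h y" using surj by blast
    then have "z = h (x \<otimes> y \<otimes> inv x \<otimes> inv y)" using x h by simp
    moreover have "x \<otimes> y \<otimes> inv x \<otimes> inv y \<in> commutators G A"
      using x(1) y(1) unfolding commutators_def by blast
    ultimately show "z \<in> h ` commutators G A" by blast
  qed
qed

lemma (in group_hom) lower_central_series_hom:
  "h ` lower_central_series G n \<subseteq> lower_central_series H n"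
proof (induction n)
  case (Suc n)
  let ?A = "lower_central_series G n"
  have A: "?A \<subseteq> carrier G" by (rule G.lower_central_series_subset)
  have "h ` generate G (commutators G ?A) = generate H (h ` commutators G ?A)"
    by (rule generate_img[symmetric, OF G.commutators_in_carrier[OF A]])
  also have "\<dots> \<subseteq> generate H (commutators H (lower_central_series H n))"
    by (rule H.mono_generate) (use commutators_hom(1)[OF A] commutators_mono[OF Suc, of H] in blast)
  finally show ?case unfolding lower_central_series_Suc .
qed auto

lemma (in group_hom) lower_central_series_surj_hom:
  assumes surj: "h ` carrier G = carrier H"
  shows "lower_central_series H n = h ` lower_central_series G n"
proof (induction n)
  case (Suc n)
  let ?A = "lower_central_series G n"
  have A: "?A \<subseteq> carrier G" by (rule G.lower_central_series_subset)
  have "h ` commutators G ?A = commutators H (h ` ?A)"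
    using commutators_hom[OF A] surj by blast
  then show ?case
    unfolding lower_central_series_Suc Suc using generate_img[OF G.commutators_in_carrier[OF A]] by simp
qed (simp add: surj)

text \<open>
  Induction on the index of \<open>M\<close>. The group \<open>Z\<close> given by \<open>nongenerator_central_step\<close> has smaller index
  and satisfies the same hypotheses; as \<open>Z/M\<close> is central in \<open>N/M\<close>, one more step of the lower central series leads
  from \<open>Z\<close> into \<open>M\<close>. The induction takes place among the subgroups of the fixed group \<open>G\<close> and not among
  its quotients, which are groups over ever changing types.
\<close>

lemma (in group) nongenerators_nilpotent_and_primes:
  assumes N: "N \<lhd> G" and M: "M \<lhd> G" and MN: "M \<subseteq> N" and fin: "finite (rcosets M)"
    and frat: "\<forall>K. subgroup K G \<longrightarrow> M \<subseteq> K \<longrightarrow> K <#> N = carrier G \<longrightarrow> K = carrier G"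
  shows "(\<exists>n. lower_central_series (G\<lparr>carrier := N\<rparr>) n \<subseteq> M) \<and>
    (\<forall>p. prime p \<longrightarrow> p dvd card (rcosets M) \<longrightarrow> p dvd card (rcosets N))"
  using M MN fin frat
proof (induction "card (rcosets M)" arbitrary: M rule: less_induct)
  case less
  let ?GN = "G\<lparr>carrier := N\<rparr>"
  interpret N: normal N G by fact
  interpret M: normal M G by fact
  show ?case
  proof (cases "M = N")
    case True
    then have "lower_central_series ?GN 0 \<subseteq> M" by simp
    then show ?thesis using True by blast
  next
    case False
    then have "M \<subset> N" using less.prems(2) by blast
    from nongenerator_central_step[OF N less.prems(1) this less.prems(3,4)]
    obtain Z where Z: "Z \<lhd> G" "M \<subset> Z" "Z \<subseteq> N"
      "\<forall>z\<in>Z. \<forall>x\<in>N. z \<otimes> x \<otimes> inv z \<otimes> inv x \<in> M"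
      "\<forall>p. prime p \<longrightarrow> p dvd card (rcosets M) \<longrightarrow> p dvd card (rcosets Z)"
      by (elim exE conjE) (rule that)
    interpret Z: normal Z G by fact
    have tower: "card (rcosets M) = card (rcosets Z) * card (rcosets\<^bsub>G\<lparr>carrier := Z\<rparr>\<^esub> M)"
      using card_rcosets_tower[OF M.subgroup_axioms Z.subgroup_axioms] Z(2) by blast
    have M0: "card (rcosets M) \<noteq> 0" using less.prems(3) M.subgroup_in_rcosets[OF is_group] by auto
    have finZ: "finite (rcosets Z)" using tower M0 card_gt_0_iff by fastforce
    have "card (rcosets\<^bsub>G\<lparr>carrier := Z\<rparr>\<^esub> M) \<noteq> 1"
    proof
      assume "card (rcosets\<^bsub>G\<lparr>carrier := Z\<rparr>\<^esub> M) = 1"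
      then obtain X where X: "rcosets\<^bsub>G\<lparr>carrier := Z\<rparr>\<^esub> M = {X}" by (rule card_1_singletonE)
      have "M #> z = X" if "z \<in> Z" for z using X that by (auto simp: RCOSETS_def)
      then have "M #> z = M #> \<one>" if "z \<in> Z" for z using that Z.one_closed by metis
      then have "z \<in> M" if "z \<in> Z" for z
        using that rcos_self[of z M] M.subgroup_axioms M.subset by auto
      then show False using Z(2) by blast
    qed
    then have "card (rcosets Z) < card (rcosets M)"
      using tower M0 by (cases "card (rcosets\<^bsub>G\<lparr>carrier := Z\<rparr>\<^esub> M)") auto
    then have IH: "(\<exists>n. lower_central_series ?GN n \<subseteq> Z) \<and>
      (\<forall>p. prime p \<longrightarrow> p dvd card (rcosets Z) \<longrightarrow> p dvd card (rcosets N))"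
      using Z less.prems(4) by (intro less.hyps[OF _ Z(1,3) finZ]) auto
    then obtain n where n: "lower_central_series ?GN n \<subseteq> Z" by blast
    have "lower_central_series ?GN (Suc n) \<subseteq> M"
      unfolding lower_central_series_Suc
    proof (rule group.generate_subgroup_incl)
      show "group ?GN" by (rule N.subgroup_is_group[OF is_group])
      show "subgroup M ?GN"
        by (rule subgroup_incl[OF M.subgroup_axioms N.subgroup_axioms less.prems(2)])
      show "commutators ?GN (lower_central_series ?GN n) \<subseteq> M"
      proof
        fix w assume "w \<in> commutators ?GN (lower_central_series ?GN n)"
        then obtain x y where w: "x \<in> lower_central_series ?GN n" "y \<in> N"
          "w = x \<otimes> y \<otimes> inv\<^bsub>?GN\<^esub> x \<otimes> inv\<^bsub>?GN\<^esub> y"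
          by (auto simp: commutators_def)
        then have "x \<in> Z" "x \<in> N" using n Z(3) by auto
        then show "w \<in> M" using Z(4) w by (simp add: m_inv_consistent[OF N.subgroup_axioms])
      qed
    qed
    then show ?thesis using IH Z(5) by blast
  qed
qed

text \<open>
  Let \<open>x\<close> be in the last term of the lower central series that is not contained in \<open>M\<close>. Commutators
  of \<open>x\<close> with elements of \<open>M\<close> lie in the next term and so in \<open>M\<close>; hence \<open>x\<close> normalises \<open>M\<close>. By maximality
  \<open>M\<close> is normal, and the quotient has no proper nontrivial subgroups.
\<close>

lemma (in group) maximal_subgroup_prime_index:
  assumes M: "subgroup M G" and ne: "M \<noteq> carrier G" and fin: "finite (rcosets M)"
    and max: "\<And>K. subgroup K G \<Longrightarrow> M \<subseteq> K \<Longrightarrow> K = M \<or> K = carrier G"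
    and nil: "lower_central_series G n \<subseteq> M"
  shows "prime (card (rcosets M))"
proof -
  interpret M: subgroup M G by fact
  have "\<exists>i. \<not> lower_central_series G i \<subseteq> M \<and> lower_central_series G (Suc i) \<subseteq> M"
  proof (rule ccontr)
    assume "\<not> ?thesis"
    then have "\<not> lower_central_series G i \<subseteq> M" for i
      by (induction i) (use ne M.subset in auto)
    then show False using nil by blast
  qed
  then obtain i x where i: "x \<in> lower_central_series G i" "x \<notin> M" "lower_central_series G (Suc i) \<subseteq> M" by blast
  note lcs = lower_central_series_subset
  have lcs_inv: "inv y \<in> lower_central_series G j" if y: "y \<in> lower_central_series G j" for y j
  proof (cases j)
    case 0 then show ?thesis using y by simp
  next
    case (Suc k)
    show ?thesis using y unfolding Suc lower_central_series_Suc
      by (intro generate_m_inv_closed commutators_in_carrier lcs)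
  qed
  have conj: "y \<otimes> m \<otimes> inv y \<in> M" if y: "y \<in> lower_central_series G i" and m: "m \<in> M" for y m
  proof -
    have c: "y \<in> carrier G" "m \<in> carrier G" using y m lcs by auto
    have "y \<otimes> m \<otimes> inv y \<otimes> inv m \<in> lower_central_series G (Suc i)"
      unfolding lower_central_series_Suc using y c by (intro generate.incl) (auto simp: commutators_def)
    then have "(y \<otimes> m \<otimes> inv y \<otimes> inv m) \<otimes> m \<in> M" using i(3) m by blast
    then show ?thesis using c by (simp add: m_assoc)
  qed
  let ?N = "{g \<in> carrier G. (\<lambda>h. g \<otimes> h \<otimes> inv g) ` M = M}"
  have N: "subgroup ?N G" by (rule conj_stabilizer_subgroup[OF M.subset])
  have xc: "x \<in> carrier G" using i(1) lcs by blast
  have "(\<lambda>h. x \<otimes> h \<otimes> inv x) ` M = M"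
  proof
    show "(\<lambda>h. x \<otimes> h \<otimes> inv x) ` M \<subseteq> M" using conj[OF i(1)] by blast
    have "(\<lambda>h. inv x \<otimes> h \<otimes> x) ` M \<subseteq> M" using conj[OF lcs_inv[OF i(1)]] xc by auto
    then show "M \<subseteq> (\<lambda>h. x \<otimes> h \<otimes> inv x) ` M" using conj_image_inv[OF M.subset xc] by blast
  qed
  then have "x \<in> ?N" using xc by simp
  moreover have "M \<subseteq> ?N"
  proof
    fix m assume m: "m \<in> M"
    have mc: "m \<in> carrier G" using m by auto
    have "(\<lambda>h. m \<otimes> h \<otimes> inv m) ` M \<subseteq> M" using m by auto
    moreover have "(\<lambda>h. inv m \<otimes> h \<otimes> m) ` M \<subseteq> M" using m by auto
    then have "M \<subseteq> (\<lambda>h. m \<otimes> h \<otimes> inv m) ` M" using conj_image_inv[OF M.subset mc] by (metis image_mono)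
    ultimately show "m \<in> ?N" using m by auto
  qed
  ultimately have "?N = carrier G" using max[OF N] i(2) by blast
  then have "\<And>g h. g \<in> carrier G \<Longrightarrow> h \<in> M \<Longrightarrow> g \<otimes> h \<otimes> inv g \<in> M" by auto
  then have Mn: "M \<lhd> G" using M normal_inv_iff by blast
  interpret M: normal M G by fact
  define Q where "Q = G Mod M"
  interpret Q: group Q unfolding Q_def by (rule M.factorgroup_is_group)
  interpret h: group_hom G Q "\<lambda>x. M #> x"
    using M.r_coset_hom_Mod by unfold_locales (simp add: Q_def)
  have ker: "M #> x = M \<longleftrightarrow> x \<in> M" if "x \<in> carrier G" for x
    using that coset_join1[of M x] coset_join2[OF that] M.subgroup_axioms M.subset by auto
  have oQ: "order Q = card (rcosets M)" by (simp add: Q_def order_def FactGroup_def)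
  have finQ: "finite (carrier Q)" using fin by (simp add: Q_def FactGroup_def)
  have "order Q \<noteq> 1"
  proof
    assume "order Q = 1"
    then have "carrier Q = {M}" using Q.order_one_triv_iff by (simp add: Q_def)
    then have "\<And>g. g \<in> carrier G \<Longrightarrow> M #> g = M" by (auto simp: Q_def carrier_FactGroup)
    then show False using ker ne M.subset by blast
  qed
  then obtain p where p: "prime p" "p dvd order Q" using prime_factor_nat by blast
  \<comment> \<open>The case of exponent one of the theorem of Sylow is the theorem of Cauchy.\<close>
  obtain P where P: "subgroup P Q" "card P = p ^ 1"
    using sylow_thm[OF p(1) Q.is_group, of 1 "order Q div p"] p(2) finQ by auto
  let ?P = "{x \<in> carrier G. M #> x \<in> P}"
  have preP: "subgroup ?P G"
    by (rule subgroupI)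
       (use subgroup.one_closed[OF P(1)] subgroup.m_closed[OF P(1)] subgroup.m_inv_closed[OF P(1)] in
         \<open>auto simp del: coset_mult_one simp: h.hom_one intro!: exI[of _ \<one>]\<close>)
  have MP: "M \<subseteq> ?P"
  proof
    fix m assume m: "m \<in> M"
    then have "M #> m = \<one>\<^bsub>Q\<^esub>" using ker M.subset by (auto simp: Q_def)
    then show "m \<in> ?P" using subgroup.one_closed[OF P(1)] m by auto
  qed
  have "?P \<noteq> M"
  proof
    assume "?P = M"
    then have "P \<subseteq> {M}" using subgroup.subset[OF P(1)] ker by (auto simp: Q_def carrier_FactGroup)
    then have "card P \<le> 1" by (metis card.empty card_insert_disjoint card_mono empty_iff finite.intros One_nat_def)
    then show False using P(2) p(1) prime_gt_1_nat[of p] by simp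
  qed
  then have "?P = carrier G" using max[OF preP MP] by blast
  then have "P = carrier Q" using subgroup.subset[OF P(1)] by (auto simp: Q_def carrier_FactGroup)
  then show ?thesis using P(2) p(1) oQ by (simp add: order_def)
qed

lemma nilpotent_quotient:
  assumes N: "N \<lhd> G" and nil: "lower_central_series G n \<subseteq> N"
  shows "nilpotent_group (G Mod N)"
proof -
  interpret N: normal N G by fact
  interpret Q: group "G Mod N" by (rule N.factorgroup_is_group)
  have hom: "group_hom G (G Mod N) (\<lambda>x. N #>\<^bsub>G\<^esub> x)"
    by (intro group_hom.intro group_hom_axioms.intro N.is_group Q.is_group N.r_coset_hom_Mod)
  have "lower_central_series (G Mod N) n = (\<lambda>x. N #>\<^bsub>G\<^esub> x) ` lower_central_series G n"
    by (rule group_hom.lower_central_series_surj_hom[OF hom]) (simp add: carrier_FactGroup)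
  also have "\<dots> \<subseteq> {\<one>\<^bsub>G Mod N\<^esub>}"
  proof (rule image_subsetI)
    fix x assume "x \<in> lower_central_series G n"
    then have "x \<in> N" using nil by blast
    then have "N #>\<^bsub>G\<^esub> x = N" using N.coset_join2 N.subgroup_axioms N.mem_carrier by blast
    then show "N #>\<^bsub>G\<^esub> x \<in> {\<one>\<^bsub>G Mod N\<^esub>}" by simp
  qed
  finally have sub: "lower_central_series (G Mod N) n \<subseteq> {\<one>\<^bsub>G Mod N\<^esub>}" .
  have "\<one>\<^bsub>G Mod N\<^esub> \<in> lower_central_series (G Mod N) n"
    by (cases n) (auto simp del: one_FactGroup intro: generate.one)
  then show ?thesis using sub Q.is_group unfolding nilpotent_group_def by blast
qed

section \<open>The Cantor space and the Cantor set\<close>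

definition splits :: "'a set \<Rightarrow> 'a set \<Rightarrow> bool" where
  "splits C A \<longleftrightarrow> A \<inter> C \<noteq> {} \<and> A - C \<noteq> {}"

text \<open>
  The value is arbitrary if no set of the sequence splits \<open>A\<close>. This does not happen for the cells
  below when there are no isolated points.
\<close>

definition first_split :: "(nat \<Rightarrow> 'a set) \<Rightarrow> 'a set \<Rightarrow> nat" where
  "first_split C A = (LEAST n. splits (C n) A)"

text \<open>
  The binary tree of ever smaller pieces of \<open>S\<close> on which Brouwer's proof rests, descended along the
  branch \<open>b\<close>.
\<close>

primrec cell :: "'a set \<Rightarrow> (nat \<Rightarrow> 'a set) \<Rightarrow> (nat \<Rightarrow> bool) \<Rightarrow> nat \<Rightarrow> 'a set" where
  "cell S C b 0 = S"
| "cell S C b (Suc n) = {y \<in> cell S C b n. (y \<in> C (first_split C (cell S C b n))) = b n}"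

text \<open>
  The descent in the same tree that always keeps the piece containing the given point. Its branch is the
  address of the point; the separate recursion avoids defining cells and addresses simultaneously.
\<close>

primrec cell_of :: "'a set \<Rightarrow> (nat \<Rightarrow> 'a set) \<Rightarrow> 'a \<Rightarrow> nat \<Rightarrow> 'a set" where
  "cell_of S C x 0 = S"
| "cell_of S C x (Suc n) =
    {y \<in> cell_of S C x n. y \<in> C (first_split C (cell_of S C x n)) \<longleftrightarrow> x \<in> C (first_split C (cell_of S C x n))}"

definition address :: "'a set \<Rightarrow> (nat \<Rightarrow> 'a set) \<Rightarrow> 'a \<Rightarrow> nat \<Rightarrow> bool" where
  "address S C x n \<longleftrightarrow> x \<in> C (first_split C (cell_of S C x n))"

lemma cell_cong: "(\<And>i. i < n \<Longrightarrow> b i = c i) \<Longrightarrow> cell S C b n = cell S C c n"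
  by (induction n) auto

lemma cell_of_eq_cell: "cell_of S C x n = cell S C (address S C x) n"
  by (induction n) (auto simp: address_def)

lemma mem_cell_address: "x \<in> S \<Longrightarrow> x \<in> cell S C (address S C x) n"
  by (induction n) (auto simp: address_def cell_of_eq_cell)

lemma mem_cell_imp_address: "x \<in> cell S C b n \<Longrightarrow> i < n \<Longrightarrow> address S C x i = b i"
proof (induction n arbitrary: i)
  case (Suc n)
  then have IH: "\<And>i. i < n \<Longrightarrow> address S C x i = b i" by simp
  then have "cell_of S C x n = cell S C b n" by (simp add: cell_of_eq_cell cong: cell_cong)
  then show ?case using Suc.prems IH by (cases "i = n") (auto simp: address_def)
qed simp

lemma cell_Suc_subset: "cell S C b (Suc n) \<subseteq> cell S C b n"
  by auto

text \<open>
  The index of the splitting set strictly increases from step to step, for a set that does not split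
  a cell does not split any smaller cell.
\<close>

lemma cell_unsplit: "m < n \<Longrightarrow> \<not> splits (C m) (cell S C b n)"
proof (induction n arbitrary: m)
  case (Suc n)
  show ?case
  proof
    assume s: "splits (C m) (cell S C b (Suc n))"
    then have s': "splits (C m) (cell S C b n)" by (auto simp: splits_def)
    then have "m = n" using Suc by (metis less_SucE)
    let ?s = "first_split C (cell S C b n)"
    have "splits (C ?s) (cell S C b n)" "?s \<le> m"
      unfolding first_split_def using s' by (auto intro: LeastI Least_le)
    then have "?s = m" using Suc.IH \<open>m = n\<close> by (metis le_neq_implies_less)
    then show False using s by (auto simp: splits_def)
  qed
qed simp

abbreviation Cantor_space :: "(nat \<Rightarrow> bool) topology" where
  "Cantor_space \<equiv> product_topology (\<lambda>_::nat. discrete_topology (UNIV::bool set)) UNIV"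

text \<open>
  Brouwer's theorem. Cells are clopen, and they are never empty: a nonempty open set in a space
  without isolated points has two points, so some member of the family splits it. Sending a point to
  its address is continuous, surjective by compactness, and injective because a cell of depth \<open>n + 1\<close>
  is not split by the first \<open>n + 1\<close> sets of the family.
\<close>

theorem homeomorphic_Cantor_space:
  fixes X :: "'a topology"
  assumes compact: "compact_space X" and ne: "topspace X \<noteq> {}"
    and perfect: "\<And>x. x \<in> topspace X \<Longrightarrow> \<not> openin X {x}"
    and countable: "countable \<C>" and clopen: "\<And>A. A \<in> \<C> \<Longrightarrow> openin X A \<and> closedin X A"
    and separates: "\<And>x y. x \<in> topspace X \<Longrightarrow> y \<in> topspace X \<Longrightarrow> x \<noteq> y \<Longrightarrow> \<exists>A\<in>\<C>. x \<in> A \<longleftrightarrow> y \<notin> A"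
  shows "X homeomorphic_space Cantor_space"
proof -
  \<comment> \<open>Adding the empty set, which splits nothing, makes the family nonempty, so that it can be enumerated.\<close>
  define C where "C = from_nat_into (insert {} \<C>)"
  have rangeC: "range C = insert {} \<C>"
    unfolding C_def using countable by (intro range_from_nat_into) auto
  have C_clopen: "openin X (C n)" "closedin X (C n)" for n
    using clopen rangeC by (metis insertE openin_empty closedin_empty rangeI)+
  have C_sep: "\<exists>n. x \<in> C n \<longleftrightarrow> y \<notin> C n" if "x \<in> topspace X" "y \<in> topspace X" "x \<noteq> y" for x y
    using separates[OF that] rangeC by (metis insertCI imageE)
  let ?S = "topspace X"
  let ?h = "address ?S C"
  have cell_step: "cell ?S C b (Suc n) = (if b n then cell ?S C b n \<inter> C (first_split C (cell ?S C b n))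
      else cell ?S C b n - C (first_split C (cell ?S C b n)))" for b n
    by auto
  have cell_clopen: "openin X (cell ?S C b n) \<and> closedin X (cell ?S C b n)" for b n
  proof (induction n)
    case (Suc n)
    then show ?case unfolding cell_step using C_clopen by (auto intro: openin_diff closedin_diff)
  qed auto
  have cell_ne: "cell ?S C b n \<noteq> {}" for b n
  proof (induction n)
    case 0 then show ?case using ne by simp
  next
    case (Suc n)
    let ?A = "cell ?S C b n"
    obtain x where x: "x \<in> ?A" using Suc by blast
    have sub: "?A \<subseteq> ?S" using cell_clopen closedin_subset by blast
    then have "?A \<noteq> {x}" using perfect[of x] x cell_clopen[of b n] by auto
    then obtain y where y: "y \<in> ?A" "y \<noteq> x" using x by blast
    obtain m where "x \<in> C m \<longleftrightarrow> y \<notin> C m" using C_sep[of x y] x y sub by blast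
    then have "splits (C m) ?A" using x y by (auto simp: splits_def)
    then have "splits (C (first_split C ?A)) ?A" unfolding first_split_def by (rule LeastI)
    then show ?case unfolding cell_step splits_def by auto
  qed
  have cont: "continuous_map X Cantor_space ?h"
    unfolding continuous_map_componentwise_UNIV
  proof
    fix n
    have "openin X {x \<in> ?S. ?h x n \<in> U}" for U
    proof (subst openin_subopen, intro ballI)
      fix x assume x: "x \<in> {x \<in> ?S. ?h x n \<in> U}"
      have "x \<in> cell ?S C (?h x) (Suc n)" by (rule mem_cell_address) (use x in blast)
      moreover have "cell ?S C (?h x) (Suc n) \<subseteq> {x \<in> ?S. ?h x n \<in> U}"
        using x mem_cell_imp_address[of _ ?S C "?h x" "Suc n" n]
          openin_subset[OF cell_clopen[THEN conjunct1], of "?h x" "Suc n"] by (auto simp del: cell.simps)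
      ultimately show "\<exists>T. openin X T \<and> x \<in> T \<and> T \<subseteq> {x \<in> ?S. ?h x n \<in> U}"
        using cell_clopen by blast
    qed
    then show "continuous_map X (discrete_topology UNIV) (\<lambda>x. ?h x n)"
      by (simp add: continuous_map_def)
  qed
  have surj: "?h ` ?S = UNIV"
  proof -
    have "b \<in> ?h ` ?S" for b
    proof -
      have "decseq (cell ?S C b)" by (intro decseq_SucI cell_Suc_subset)
      then have "(\<Inter>n. cell ?S C b n) \<noteq> {}"
        using compact_space_imp_nest[OF compact, of "cell ?S C b"] cell_clopen cell_ne by blast
      then obtain x where x: "\<And>n. x \<in> cell ?S C b n" by blast
      have "?h x = b" by (rule ext) (rule mem_cell_imp_address[OF x lessI])
      moreover have "x \<in> ?S" using x[of 0] by simp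
      ultimately show ?thesis by blast
    qed
    then show ?thesis by blast
  qed
  have inj: "inj_on ?h ?S"
  proof (rule inj_onI, rule ccontr)
    fix x y assume xy: "x \<in> ?S" "y \<in> ?S" "?h x = ?h y" "x \<noteq> y"
    then obtain m where m: "x \<in> C m \<longleftrightarrow> y \<notin> C m" using C_sep by blast
    have "x \<in> cell ?S C (?h x) (Suc m)" "y \<in> cell ?S C (?h x) (Suc m)"
      using mem_cell_address[OF xy(1)] mem_cell_address[OF xy(2)] xy(3) by metis+
    then have "splits (C m) (cell ?S C (?h x) (Suc m))" using m unfolding splits_def by blast
    then show False using cell_unsplit by (metis lessI)
  qed
  have "homeomorphic_map X Cantor_space ?h"
  proof (rule continuous_imp_homeomorphic_map[OF cont compact])
    show "Hausdorff_space Cantor_space"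
      by (simp add: Hausdorff_space_product_topology)
  qed (use surj inj in auto)
  then show ?thesis by (rule homeomorphic_map_imp_homeomorphic_space)
qed

lemma cantor_stage_subset: "cantor_stage n \<subseteq> {0..1}"
proof (induction n)
  case (Suc n)
  then show ?case by (auto simp: subset_iff)
qed auto

lemma compact_cantor_stage: "compact (cantor_stage n)"
proof (induction n)
  case (Suc n)
  then show ?case
    by (auto intro!: compact_Un compact_continuous_image continuous_intros)
qed auto

lemma cantor_set_unfold: "cantor_set = (\<lambda>x. x / 3) ` cantor_set \<union> (\<lambda>x. (2 + x) / 3) ` cantor_set"
proof
  show "cantor_set \<subseteq> (\<lambda>x. x / 3) ` cantor_set \<union> (\<lambda>x. (2 + x) / 3) ` cantor_set"
  proof
    fix x assume x: "x \<in> cantor_set"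
    then have st: "x \<in> cantor_stage (Suc n)" for n unfolding cantor_set_def by blast
    have b: "y \<in> cantor_stage n \<Longrightarrow> 0 \<le> y \<and> y \<le> 1" for y n using cantor_stage_subset by fastforce
    show "x \<in> (\<lambda>x. x / 3) ` cantor_set \<union> (\<lambda>x. (2 + x) / 3) ` cantor_set"
    \<comment> \<open>The point \<open>1/2\<close> lies in the gap between the two copies of the set.\<close>
    proof (cases "x \<le> 1/2")
      case True
      have "3 * x \<in> cantor_stage n" for n
      proof -
        obtain y where y: "y \<in> cantor_stage n" "x = y / 3 \<or> x = (2 + y) / 3" using st[of n] by auto
        then have "x = y / 3" using True b[of y n] by auto
        then have "3 * x = y" by simp
        then show ?thesis using y by simp
      qed
      then have "3 * x \<in> cantor_set" by (auto simp: cantor_set_def)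
      then show ?thesis by (intro UnI1 image_eqI[of _ _ "3 * x"]) auto
    next
      case False
      have "3 * x - 2 \<in> cantor_stage n" for n
      proof -
        obtain y where y: "y \<in> cantor_stage n" "x = y / 3 \<or> x = (2 + y) / 3" using st[of n] by auto
        then have "x = (2 + y) / 3" using False b[of y n] by auto
        then have "3 * x - 2 = y" by simp
        then show ?thesis using y by simp
      qed
      then have "3 * x - 2 \<in> cantor_set" by (auto simp: cantor_set_def)
      then show ?thesis by (intro UnI2 image_eqI[of _ _ "3 * x - 2"]) auto
    qed
  qed
next
  have dec: "cantor_stage (Suc n) \<subseteq> cantor_stage n" for n
  proof (induction n)
    case (Suc n)
    then show ?case by (simp, blast)
  qed auto
  have "y \<in> cantor_set" if "\<And>n. y \<in> cantor_stage (Suc n)" for y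
    using that dec by (auto simp: cantor_set_def simp del: cantor_stage.simps)
  moreover have "y \<in> cantor_stage (Suc n)"
    if "y \<in> (\<lambda>x. x / 3) ` cantor_set \<union> (\<lambda>x. (2 + x) / 3) ` cantor_set" for y n
    using that unfolding cantor_set_def cantor_stage.simps by blast
  ultimately show "(\<lambda>x. x / 3) ` cantor_set \<union> (\<lambda>x. (2 + x) / 3) ` cantor_set \<subseteq> cantor_set"
    by blast
qed

lemma cantor_set_ends: "0 \<in> cantor_set" "1 \<in> cantor_set"
proof -
  have "(0::real) \<in> cantor_stage n \<and> (1::real) \<in> cantor_stage n" for n
  proof (induction n)
    case (Suc n)
    have "(0::real) = 0 / 3" "(1::real) = (2 + 1) / 3" by auto
    then show ?case unfolding cantor_stage.simps using Suc by blast
  qed auto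
  then show "0 \<in> cantor_set" "1 \<in> cantor_set" by (auto simp: cantor_set_def)
qed

text \<open>
  A point of the Cantor set lies in one of the \<open>2\<^sup>n\<close> similar copies of the set of diameter \<open>3\<^sup>-\<^sup>n\<close>, and one of
  the two end points of that copy is different from it.
\<close>

lemma cantor_set_perfect_aux:
  "x \<in> cantor_set \<Longrightarrow> \<exists>y\<in>cantor_set. y \<noteq> x \<and> \<bar>x - y\<bar> \<le> (1/3) ^ n"
proof (induction n arbitrary: x)
  case 0
  have "x \<in> cantor_stage 0" using 0 unfolding cantor_set_def by blast
  then have "0 \<le> x \<and> x \<le> 1" by simp
  then show ?case using cantor_set_ends by (cases "x = 0") (auto intro: bexI[of _ 1] bexI[of _ 0])
next
  case (Suc n)
  then consider u where "u \<in> cantor_set" "x = u / 3" | u where "u \<in> cantor_set" "x = (2 + u) / 3"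
    using cantor_set_unfold by blast
  then show ?case
  proof cases
    case 1
    obtain v where v: "v \<in> cantor_set" "v \<noteq> u" "\<bar>u - v\<bar> \<le> (1/3) ^ n" using Suc.IH[OF 1(1)] by blast
    have "v / 3 \<in> cantor_set" using v(1) cantor_set_unfold by blast
    moreover have "\<bar>x - v / 3\<bar> \<le> (1/3) ^ Suc n" "v / 3 \<noteq> x" using v 1 by (auto simp: abs_if split: if_splits)
    ultimately show ?thesis by blast
  next
    case 2
    obtain v where v: "v \<in> cantor_set" "v \<noteq> u" "\<bar>u - v\<bar> \<le> (1/3) ^ n" using Suc.IH[OF 2(1)] by blast
    have "(2 + v) / 3 \<in> cantor_set" using v(1) cantor_set_unfold by blast
    moreover have "\<bar>x - (2 + v) / 3\<bar> \<le> (1/3) ^ Suc n" "(2 + v) / 3 \<noteq> x"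
      using v 2 by (auto simp: abs_if field_simps split: if_splits)
    ultimately show ?thesis by blast
  qed
qed

lemma cantor_stage_gap: "x < y \<Longrightarrow> {x..y} \<subseteq> cantor_stage n \<Longrightarrow> y - x \<le> (1/3) ^ n"
proof (induction n arbitrary: x y)
  case (Suc n)
  have b: "z \<in> cantor_stage n \<Longrightarrow> 0 \<le> z \<and> z \<le> 1" for z using cantor_stage_subset by fastforce
  have mem: "\<exists>u\<in>cantor_stage n. z = u / 3 \<or> z = (2 + u) / 3" if "z \<in> {x..y}" for z
    using subsetD[OF Suc.prems(2) that] unfolding cantor_stage.simps by blast
  have half: "1/2 \<notin> {x..y}"
  proof
    assume "1/2 \<in> {x..y}"
    from mem[OF this] obtain u where "u \<in> cantor_stage n" "1/2 = u / 3 \<or> 1/2 = (2 + u) / 3" by auto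
    then show False using b[of u] by auto
  qed
  then consider "y < 1/2" | "x > 1/2" using Suc.prems(1) by fastforce
  then show ?case
  proof cases
    case 1
    have "{3 * x..3 * y} \<subseteq> cantor_stage n"
    proof
      fix z assume z: "z \<in> {3 * x..3 * y}"
      then have "z / 3 \<in> {x..y}" by auto
      from mem[OF this] obtain u where u: "u \<in> cantor_stage n" "z / 3 = u / 3 \<or> z / 3 = (2 + u) / 3" by auto
      then show "z \<in> cantor_stage n" using b[of u] 1 z by auto
    qed
    then show ?thesis using Suc.IH[of "3 * x" "3 * y"] Suc.prems(1) by simp
  next
    case 2
    have "{3 * x - 2..3 * y - 2} \<subseteq> cantor_stage n"
    proof
      fix z assume z: "z \<in> {3 * x - 2..3 * y - 2}"
      then have "(2 + z) / 3 \<in> {x..y}" by auto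
      from mem[OF this] obtain u where u: "u \<in> cantor_stage n" "(2 + z) / 3 = u / 3 \<or> (2 + z) / 3 = (2 + u) / 3" by auto
      then show "z \<in> cantor_stage n" using b[of u] 2 z by auto
    qed
    then show ?thesis using Suc.IH[of "3 * x - 2" "3 * y - 2"] Suc.prems(1) by simp
  qed
qed (auto)

lemma cantor_set_perfect: "\<not> openin (top_of_set cantor_set) {x}"
proof
  assume op: "openin (top_of_set cantor_set) {x}"
  then have x: "x \<in> cantor_set" using openin_subset by fastforce
  obtain e where e: "e > 0" "ball x e \<inter> cantor_set \<subseteq> {x}" using op by (auto simp: openin_contains_ball)
  obtain n where n: "(1/3::real) ^ n < e" using real_arch_pow_inv[of e "1/3"] e by auto
  obtain y where y: "y \<in> cantor_set" "y \<noteq> x" "\<bar>x - y\<bar> \<le> (1/3) ^ n" using cantor_set_perfect_aux[OF x] by blast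
  then have "y \<in> ball x e" using n by (simp add: dist_real_def)
  then show False using e(2) y by blast
qed

lemma compact_cantor_set: "compact cantor_set"
  unfolding cantor_set_def using compact_cantor_stage by (intro compact_Inter) auto

lemma cantor_set_gap:
  fixes x y :: real
  assumes "x < y"
  shows "\<exists>q::rat. x < of_rat q \<and> of_rat q < y \<and> of_rat q \<notin> cantor_set"
proof -
  obtain n where n: "(1/3) ^ n < (y - x) / 2"
    using real_arch_pow_inv[of "(y - x) / 2" "1/3"] assms by auto
  \<comment> \<open>The interval is shrunk so that the point found outside the set is not an end point.\<close>
  define a b where "a = x + (y - x) / 8" and "b = y - (y - x) / 8"
  have "a < b" "b - a > (1/3) ^ n" using n assms by (auto simp: a_def b_def field_simps)
  then have "\<not> {a..b} \<subseteq> cantor_stage n" using cantor_stage_gap[of a b n] by auto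
  then obtain z where z: "z \<in> {a..b}" "z \<notin> cantor_set" unfolding cantor_set_def by blast
  have "open (- cantor_set \<inter> {x<..<y})"
    using compact_imp_closed[OF compact_cantor_set] by auto
  moreover have "x < a" "b < y" using assms by (simp_all add: a_def b_def)
  then have "z \<in> - cantor_set \<inter> {x<..<y}" using z by auto
  ultimately obtain e where e: "e > 0" "ball z e \<subseteq> - cantor_set \<inter> {x<..<y}" by (meson open_contains_ball)
  obtain q where "z < of_rat q" "of_rat q < z + e" using of_rat_dense[of z "z + e"] e by auto
  then have "of_rat q \<in> ball z e" by (auto simp: dist_real_def)
  then have "of_rat q \<in> - cantor_set \<inter> {x<..<y}" using e(2) by blast
  then show ?thesis by auto
qed

lemma cantor_set_homeomorphic_Cantor_space:
  "top_of_set cantor_set homeomorphic_space Cantor_space"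
proof (rule homeomorphic_Cantor_space[where \<C> = "(\<lambda>q. {x \<in> cantor_set. x < of_rat q}) ` {q::rat. of_rat q \<notin> cantor_set}"])
  show "compact_space (top_of_set cantor_set)" using compact_cantor_set by (simp add: compact_space_subtopology)
  show "topspace (top_of_set cantor_set) \<noteq> {}" using cantor_set_ends by auto
next
  show "\<not> openin (top_of_set cantor_set) {x}" for x by (rule cantor_set_perfect)
next
  show "countable ((\<lambda>q. {x \<in> cantor_set. x < of_rat q}) ` {q::rat. of_rat q \<notin> cantor_set})"
    by (intro countable_image) auto
next
  fix A assume "A \<in> (\<lambda>q. {x \<in> cantor_set. x < of_rat q}) ` {q::rat. of_rat q \<notin> cantor_set}"
  then obtain q :: rat where q: "of_rat q \<notin> cantor_set" "A = {x \<in> cantor_set. x < of_rat q}" by auto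
  have "A = cantor_set \<inter> {..<of_rat q}" using q by auto
  then have "openin (top_of_set cantor_set) A" by (metis openin_open_Int open_lessThan)
  moreover have "A = cantor_set \<inter> {..of_rat q}" using q by (auto simp: less_le)
  then have "closedin (top_of_set cantor_set) A" by (metis closedin_closed_Int closed_atMost)
  ultimately show "openin (top_of_set cantor_set) A \<and> closedin (top_of_set cantor_set) A" ..
next
  fix x y assume xy: "x \<in> topspace (top_of_set cantor_set)" "y \<in> topspace (top_of_set cantor_set)" "x \<noteq> y"
  have "\<exists>q::rat. of_rat q \<notin> cantor_set \<and> min x y < of_rat q \<and> of_rat q < max x y"
    using cantor_set_gap[of "min x y" "max x y"] xy(3) by (metis max_less_iff_conj min_less_iff_conj less_max_iff_disj linorder_neqE_linordered_idom min_less_iff_disj)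
  then obtain q :: rat where q: "of_rat q \<notin> cantor_set" "min x y < of_rat q" "of_rat q < max x y" by blast
  then have "x \<in> {x \<in> cantor_set. x < of_rat q} \<longleftrightarrow> y \<notin> {x \<in> cantor_set. x < of_rat q}"
    using xy by (auto simp: min_def max_def split: if_splits)
  then show "\<exists>A\<in>(\<lambda>q. {x \<in> cantor_set. x < of_rat q}) ` {q::rat. of_rat q \<notin> cantor_set}. x \<in> A \<longleftrightarrow> y \<notin> A"
    by (intro bexI[of _ "{x \<in> cantor_set. x < of_rat q}"] imageI) (use q(1) in simp_all)
qed

lemma second_countable_euclideanreal: "second_countable euclideanreal"
proof -
  obtain \<B> :: "real set set" where \<B>: "countable \<B>" "topological_basis \<B>"
    using ex_countable_basis by blast
  then have "\<exists>V\<in>\<B>. x \<in> V \<and> V \<subseteq> U" if "open U" "x \<in> U" for U x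
    using that by (meson topological_basisE)
  then show ?thesis
    unfolding second_countable_def using \<B> by (auto intro!: exI[of _ \<B>] simp: topological_basis_open)
qed

section \<open>Profinite groups\<close>

text \<open>
  Directedness makes the finite intersection property automatic.
\<close>

lemma compact_space_directed_Inter:
  assumes X: "compact_space X" and ne: "\<A> \<noteq> {}"
    and closed: "\<And>A. A \<in> \<A> \<Longrightarrow> closedin X A \<and> A \<noteq> {}"
    and directed: "\<And>A B. A \<in> \<A> \<Longrightarrow> B \<in> \<A> \<Longrightarrow> \<exists>C\<in>\<A>. C \<subseteq> A \<inter> B"
  shows "\<Inter>\<A> \<noteq> {}"
proof -
  have "\<exists>C\<in>\<A>. C \<subseteq> \<Inter>\<F>" if "finite \<F>" "\<F> \<subseteq> \<A>" for \<F>
    using that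
  proof (induction \<F>)
    case empty then show ?case using ne by auto
  next
    case (insert A \<F>)
    then obtain C where "C \<in> \<A>" "C \<subseteq> \<Inter>\<F>" by auto
    moreover obtain D where "D \<in> \<A>" "D \<subseteq> A \<inter> C" using directed insert.prems calculation(1) by blast
    ultimately show ?case by (intro bexI[of _ D]) auto
  qed
  then have "\<Inter>\<F> \<noteq> {}" if "finite \<F> \<and> \<F> \<subseteq> \<A>" for \<F>
    using that closed by (metis subset_empty)
  then show ?thesis using X closed unfolding compact_space_fip by blast
qed

lemma inverse_limit_group_simps:
  "carrier (inverse_limit_group I leq F \<phi>) =
    {x \<in> (\<Pi>\<^sub>E i\<in>I. carrier (F i)). \<forall>i\<in>I. \<forall>j\<in>I. leq i j \<longrightarrow> \<phi> i j (x j) = x i}"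
  "\<one>\<^bsub>inverse_limit_group I leq F \<phi>\<^esub> = (\<lambda>i\<in>I. \<one>\<^bsub>F i\<^esub>)"
  "x \<otimes>\<^bsub>inverse_limit_group I leq F \<phi>\<^esub> y = (\<lambda>i\<in>I. x i \<otimes>\<^bsub>F i\<^esub> y i)"
  by (simp_all add: inverse_limit_group_def)

lemma inverse_systemD:
  assumes "inverse_system I leq F \<phi>"
  shows "I \<noteq> {}"
    and "\<And>i. i \<in> I \<Longrightarrow> group (F i)"
    and "\<And>i j. i \<in> I \<Longrightarrow> j \<in> I \<Longrightarrow> \<exists>k\<in>I. leq i k \<and> leq j k"
    and "\<And>i j k. i \<in> I \<Longrightarrow> j \<in> I \<Longrightarrow> k \<in> I \<Longrightarrow> leq i j \<Longrightarrow> leq j k \<Longrightarrow> leq i k"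
    and "\<And>i j. i \<in> I \<Longrightarrow> j \<in> I \<Longrightarrow> leq i j \<Longrightarrow> \<phi> i j \<in> hom (F j) (F i)"
  by (insert assms, unfold inverse_system_def, (elim conjE, blast)+)

lemma topspace_inverse_limit:
  "topspace (inverse_limit_topology I leq F \<phi>) = carrier (inverse_limit_group I leq F \<phi>)"
  by (auto simp: inverse_limit_topology_def inverse_limit_group_simps)

lemma Hausdorff_inverse_limit: "Hausdorff_space (inverse_limit_topology I leq F \<phi>)"
  unfolding inverse_limit_topology_def
  by (intro Hausdorff_space_subtopology) (simp add: Hausdorff_space_product_topology)

lemma compact_inverse_limit:
  assumes sys: "inverse_system I leq F \<phi>" and fin: "\<And>i. i \<in> I \<Longrightarrow> finite (carrier (F i))"
  shows "compact_space (inverse_limit_topology I leq F \<phi>)"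
proof -
  let ?P = "product_topology (\<lambda>i. discrete_topology (carrier (F i))) I"
  have P: "compact_space ?P"
    using fin by (auto simp: compact_space_product_topology compact_space_discrete_topology)
  let ?E = "\<lambda>i j. {x \<in> topspace ?P. \<phi> i j (x j) = x i}"
  have cl: "closedin ?P (?E i j)" if ij: "i \<in> I" "j \<in> I" "leq i j" for i j
  proof (rule closedin_continuous_maps_eq)
    show "Hausdorff_space (discrete_topology (carrier (F i)))" by simp
    have "\<phi> i j \<in> hom (F j) (F i)" by (rule inverse_systemD(5)[OF sys ij])
    then have disc: "continuous_map (discrete_topology (carrier (F j))) (discrete_topology (carrier (F i))) (\<phi> i j)"
      by (auto simp: hom_def)
    have "continuous_map ?P (discrete_topology (carrier (F j))) (\<lambda>x. x j)"
      by (rule continuous_map_product_projection[OF ij(2)])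
    from continuous_map_compose[OF this disc]
    show "continuous_map ?P (discrete_topology (carrier (F i))) (\<lambda>x. \<phi> i j (x j))" by (simp add: o_def)
    show "continuous_map ?P (discrete_topology (carrier (F i))) (\<lambda>x. x i)"
      by (rule continuous_map_product_projection[OF ij(1)])
  qed
  have "carrier (inverse_limit_group I leq F \<phi>) = \<Inter>(insert (topspace ?P) {?E i j | i j. i \<in> I \<and> j \<in> I \<and> leq i j})"
    by (auto simp: inverse_limit_group_simps)
  also have "closedin ?P \<dots>" by (rule closedin_Inter) (use cl closedin_topspace[of ?P] in blast)+
  finally show ?thesis unfolding inverse_limit_topology_def
    using compact_space_subtopology closedin_compact_space[OF P] by blast
qed

lemma inverse_system_upper_bound:
  assumes sys: "inverse_system I leq F \<phi>" and "finite J" "J \<subseteq> I"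
  shows "\<exists>k\<in>I. \<forall>j\<in>J. leq j k"
  using assms(2,3)
proof (induction J)
  case empty then show ?case using inverse_systemD(1)[OF sys] by auto
next
  case (insert i J)
  then obtain k where k: "k \<in> I" "\<forall>j\<in>J. leq j k" by auto
  then obtain l where l: "l \<in> I" "leq i l" "leq k l"
    using inverse_systemD(3)[OF sys, of i k] insert.prems by blast
  have "leq j l" if "j \<in> insert i J" for j
    using that k l inverse_systemD(4)[OF sys, of j k l] insert.prems by blast
  then show ?case using l(1) by blast
qed

text \<open>
  A neighbourhood of the identity in the limit only restricts finitely many coordinates. If \<open>k\<close> is an
  upper bound of these, then an element whose \<open>k\<close>-th coordinate is trivial satisfies all the
  restrictions.
\<close>

lemma inverse_limit_small_kernel:
  fixes G :: "('a, 'm) monoid_scheme"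
  assumes lim: "inverse_limit_of_class P G T" and U: "openin T U" "\<one>\<^bsub>G\<^esub> \<in> U"
  obtains F :: "'a set monoid" and h where "P F" "group F" "h \<in> hom G F"
    "openin T (kernel G F h)" "kernel G F h \<subseteq> U"
proof -
  obtain I :: "'a set set" and leq and F :: "'a set \<Rightarrow> 'a set monoid" and \<phi> f where
    sys: "inverse_system I leq F \<phi>" and P: "\<forall>i\<in>I. P (F i)" and
    iso: "f \<in> iso G (inverse_limit_group I leq F \<phi>)" and
    homeo: "homeomorphic_map T (inverse_limit_topology I leq F \<phi>) f"
    using lim unfolding inverse_limit_of_class_def by blast
  have tg: "topological_group G T" using lim by (simp add: inverse_limit_of_class_def)
  then interpret group G by (simp add: topological_group_def)
  have topT: "topspace T = carrier G" using tg by (simp add: topological_group_def)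
  let ?L = "inverse_limit_group I leq F \<phi>"
  let ?P = "product_topology (\<lambda>i. discrete_topology (carrier (F i))) I"
  have f_car: "f x \<in> carrier ?L" if "x \<in> carrier G" for x
    using iso that by (auto simp: iso_def hom_def)
  have f_mult: "f (x \<otimes>\<^bsub>G\<^esub> y) = (\<lambda>i\<in>I. f x i \<otimes>\<^bsub>F i\<^esub> f y i)" if "x \<in> carrier G" "y \<in> carrier G" for x y
    using iso that by (auto simp: iso_def hom_def inverse_limit_group_simps)
  have f_inj: "inj_on f (carrier G)" using iso by (auto simp: iso_def bij_betw_def)
  note grpF = inverse_systemD(2)[OF sys]
  have h_hom: "(\<lambda>x. f x i) \<in> hom G (F i)" if i: "i \<in> I" for i
    using f_car f_mult i by (auto simp: hom_def inverse_limit_group_simps)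
  have f_one: "f \<one>\<^bsub>G\<^esub> i = \<one>\<^bsub>F i\<^esub>" if i: "i \<in> I" for i
    using hom_one[OF h_hom[OF i] is_group grpF[OF i]] .
  have "openin (inverse_limit_topology I leq F \<phi>) (f ` U)"
    using homeo U(1) homeomorphic_map_openness_eq by blast
  then obtain V where V: "openin ?P V" "f ` U = V \<inter> carrier ?L"
    by (auto simp: inverse_limit_topology_def openin_subtopology)
  have "f \<one>\<^bsub>G\<^esub> \<in> V" using U(2) V(2) by blast
  then obtain W where W: "finite {i \<in> I. W i \<noteq> topspace (discrete_topology (carrier (F i)))}"
    "f \<one>\<^bsub>G\<^esub> \<in> Pi\<^sub>E I W" "Pi\<^sub>E I W \<subseteq> V"
    using V(1) unfolding openin_product_topology_alt by meson
  let ?J = "{i \<in> I. W i \<noteq> carrier (F i)}"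
  have "finite ?J" using W(1) by simp
  then obtain k where k: "k \<in> I" "\<forall>j\<in>?J. leq j k"
    using inverse_system_upper_bound[OF sys, of ?J] by blast
  let ?h = "\<lambda>x. f x k"
  have "kernel G (F k) ?h \<subseteq> U"
  proof
    fix x assume "x \<in> kernel G (F k) ?h"
    then have x: "x \<in> carrier G" "f x k = \<one>\<^bsub>F k\<^esub>" by (auto simp: kernel_def)
    have fx: "f x \<in> carrier ?L" by (rule f_car[OF x(1)])
    have "f x i \<in> W i" if i: "i \<in> I" for i
    proof (cases "W i = carrier (F i)")
      case True
      then show ?thesis using fx i by (auto simp: inverse_limit_group_simps)
    next
      case False
      then have ik: "leq i k" using k(2) i by blast
      then have "\<phi> i k \<in> hom (F k) (F i)" by (rule inverse_systemD(5)[OF sys i k(1)])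
      then have "\<phi> i k \<one>\<^bsub>F k\<^esub> = \<one>\<^bsub>F i\<^esub>" using grpF i k(1) hom_one by blast
      moreover have "\<phi> i k (f x k) = f x i" using fx i k(1) ik by (auto simp: inverse_limit_group_simps)
      ultimately have "f x i = f \<one>\<^bsub>G\<^esub> i" using x(2) f_one[OF i] by simp
      then show ?thesis using W(2) i by auto
    qed
    then have "f x \<in> Pi\<^sub>E I W" using fx by (auto simp: inverse_limit_group_simps PiE_iff)
    then have "f x \<in> f ` U" using W(3) V(2) fx by blast
    then obtain u where u: "u \<in> U" "f x = f u" by blast
    have "u \<in> carrier G" using u(1) openin_subset[OF U(1)] topT by blast
    then have "x = u" using f_inj x(1) u(2) by (auto simp: inj_on_def)
    then show "x \<in> U" using u(1) by simp
  qed
  moreover have "openin T (kernel G (F k) ?h)"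
  proof -
    have "continuous_map T (inverse_limit_topology I leq F \<phi>) f"
      using homeo by (simp add: homeomorphic_eq_everything_map)
    then have "continuous_map T ?P f"
      unfolding inverse_limit_topology_def by (simp add: continuous_map_in_subtopology)
    from continuous_map_compose[OF this continuous_map_product_projection[OF k(1)]]
    have "continuous_map T (discrete_topology (carrier (F k))) ?h" by (simp add: o_def)
    then have "openin T {x \<in> topspace T. ?h x \<in> {\<one>\<^bsub>F k\<^esub>}}"
      by (rule openin_continuous_map_preimage)
         (use grpF[OF k(1)] in \<open>simp add: group.is_monoid monoid.one_closed\<close>)
    then show ?thesis by (simp add: kernel_def topT)
  qed
  ultimately show thesis using that[of "F k" ?h] P k(1) grpF h_hom by blast
qed

text \<open>
  Compact Hausdorff groups in which the open normal subgroups form a base at the identity: the inverse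
  system is left behind, and open subgroups are again of this kind.
\<close>

locale profinite = group G for G :: "('a, 'm) monoid_scheme" (structure) +
  fixes T :: "'a topology"
  assumes topological_group: "topological_group G T"
    and compact: "compact_space T"
    and Hausdorff: "Hausdorff_space T"
    and open_normal_basis: "openin T U \<Longrightarrow> \<one> \<in> U \<Longrightarrow> \<exists>N. N \<lhd> G \<and> openin T N \<and> N \<subseteq> U"

lemma profinite_groupD:
  fixes G :: "('a, 'm) monoid_scheme"
  assumes "profinite_group G T"
  shows "profinite G T"
proof -
  have lim: "inverse_limit_of_class (\<lambda>F. finite (carrier F)) G T"
    using assms by (simp add: profinite_group_def)
  then have tg: "topological_group G T" by (simp add: inverse_limit_of_class_def)
  then interpret group G by (simp add: topological_group_def)
  obtain I :: "'a set set" and leq and F :: "'a set \<Rightarrow> 'a set monoid" and \<phi> f where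
    sys: "inverse_system I leq F \<phi>" and fin: "\<forall>i\<in>I. finite (carrier (F i))" and
    homeo: "homeomorphic_map T (inverse_limit_topology I leq F \<phi>) f"
    using lim unfolding inverse_limit_of_class_def by blast
  have hs: "T homeomorphic_space inverse_limit_topology I leq F \<phi>"
    using homeo by (rule homeomorphic_map_imp_homeomorphic_space)
  show ?thesis
  proof
    show "compact_space T"
      using homeomorphic_compact_space[OF hs] compact_inverse_limit[OF sys] fin by blast
    show "Hausdorff_space T"
      using homeomorphic_Hausdorff_space[OF hs] Hausdorff_inverse_limit by blast
    fix U assume U: "openin T U" "\<one>\<^bsub>G\<^esub> \<in> U"
    obtain F :: "'a set monoid" and h where h: "group F" "h \<in> hom G F"
      "openin T (kernel G F h)" "kernel G F h \<subseteq> U"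
      using inverse_limit_small_kernel[OF lim U] by blast
    then interpret group_hom G F h by (simp add: group_hom_def group_hom_axioms_def is_group)
    show "\<exists>N. N \<lhd> G \<and> openin T N \<and> N \<subseteq> U" using normal_kernel h by blast
  qed (rule tg)
qed

context profinite
begin

lemma topspace_eq: "topspace T = carrier G"
  using topological_group by (simp add: topological_group_def)

lemma continuous_map_mult: "continuous_map (prod_topology T T) T (\<lambda>(x, y). x \<otimes> y)"
  using topological_group by (simp add: topological_group_def)

lemma continuous_map_left_translation:
  assumes "a \<in> carrier G" shows "continuous_map T T (\<lambda>x. a \<otimes> x)"
proof -
  have "continuous_map T (prod_topology T T) (\<lambda>x. (a, x))"
    using assms by (intro continuous_map_pairedI) (auto simp: topspace_eq)
  from continuous_map_compose[OF this continuous_map_mult] show ?thesis by (simp add: o_def)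
qed

lemma continuous_map_right_translation:
  assumes "a \<in> carrier G" shows "continuous_map T T (\<lambda>x. x \<otimes> a)"
proof -
  have "continuous_map T (prod_topology T T) (\<lambda>x. (x, a))"
    using assms by (intro continuous_map_pairedI) (auto simp: topspace_eq)
  from continuous_map_compose[OF this continuous_map_mult] show ?thesis by (simp add: o_def)
qed

lemma openin_r_coset:
  assumes U: "openin T U" and a: "a \<in> carrier G" shows "openin T (U #> a)"
proof -
  have sub: "U \<subseteq> carrier G" using openin_subset[OF U] topspace_eq by simp
  have "U #> a = {x \<in> topspace T. x \<otimes> inv a \<in> U}"
  proof (intro equalityI subsetI)
    fix x assume "x \<in> U #> a"
    then obtain u where "u \<in> U" "x = u \<otimes> a" by (auto simp: r_coset_def)
    then show "x \<in> {x \<in> topspace T. x \<otimes> inv a \<in> U}" using a sub by (auto simp: topspace_eq m_assoc)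
  next
    fix x assume x: "x \<in> {x \<in> topspace T. x \<otimes> inv a \<in> U}"
    then have "x = (x \<otimes> inv a) \<otimes> a" using a by (simp add: topspace_eq m_assoc)
    then show "x \<in> U #> a" using x unfolding r_coset_def by blast
  qed
  then show ?thesis
    using openin_continuous_map_preimage[OF continuous_map_right_translation[of "inv a"] U] a by simp
qed

lemma l_coset_eq_preimage:
  assumes sub: "U \<subseteq> carrier G" and a: "a \<in> carrier G"
  shows "a <# U = {x \<in> topspace T. inv a \<otimes> x \<in> U}"
proof (intro equalityI subsetI)
  fix x assume "x \<in> a <# U"
  then obtain u where "u \<in> U" "x = a \<otimes> u" by (auto simp: l_coset_def)
  then show "x \<in> {x \<in> topspace T. inv a \<otimes> x \<in> U}"
    using a sub by (auto simp: topspace_eq m_assoc[symmetric])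
next
  fix x assume x: "x \<in> {x \<in> topspace T. inv a \<otimes> x \<in> U}"
  then have "x = a \<otimes> (inv a \<otimes> x)" using a by (simp add: topspace_eq m_assoc[symmetric])
  then show "x \<in> a <# U" using x unfolding l_coset_def by blast
qed

lemma openin_l_coset:
  assumes U: "openin T U" and a: "a \<in> carrier G" shows "openin T (a <# U)"
  using openin_continuous_map_preimage[OF continuous_map_left_translation[of "inv a"] U] a
    l_coset_eq_preimage[OF _ a, of U] openin_subset[OF U] by (simp add: topspace_eq)

lemma closedin_l_coset:
  assumes U: "closedin T U" and a: "a \<in> carrier G" shows "closedin T (a <# U)"
  using closedin_continuous_map_preimage[OF continuous_map_left_translation[of "inv a"] U] a
    l_coset_eq_preimage[OF _ a, of U] closedin_subset[OF U] by (simp add: topspace_eq)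

lemma openin_set_mult:
  assumes A: "A \<subseteq> carrier G" and U: "openin T U" shows "openin T (A <#> U)"
proof -
  have "A <#> U = (\<Union>a\<in>A. a <# U)" by (auto simp: set_mult_def l_coset_def)
  then show ?thesis using openin_l_coset[OF U] A by (auto intro!: openin_Union)
qed

lemma openin_subgroup_supset:
  assumes K: "subgroup K G" and NK: "N \<subseteq> K" and N: "openin T N" and ne: "\<one> \<in> N"
  shows "openin T K"
proof -
  show ?thesis using openin_set_mult[OF subgroup.subset[OF K] N] set_mult_absorb(1)[OF ne K NK] by simp
qed

lemma closedin_open_subgroup:
  assumes H: "subgroup H G" and op: "openin T H" shows "closedin T H"
proof -
  interpret H: subgroup H G by fact
  have "carrier G - H = (\<Union>a\<in>carrier G - H. H #> a)"
  proof (intro equalityI subsetI)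
    fix x assume "x \<in> carrier G - H"
    then show "x \<in> (\<Union>a\<in>carrier G - H. H #> a)" using rcos_self[OF _ H] by blast
  next
    fix x assume "x \<in> (\<Union>a\<in>carrier G - H. H #> a)"
    then obtain a h where a: "a \<in> carrier G" "a \<notin> H" "h \<in> H" "x = h \<otimes> a" by (auto simp: r_coset_def)
    have "x \<notin> H"
    proof
      assume "x \<in> H"
      then have "inv h \<otimes> x \<in> H" using a(3) by blast
      then show False using a H.mem_carrier by (simp add: m_assoc[symmetric])
    qed
    then show "x \<in> carrier G - H" using a by auto
  qed
  also have "openin T \<dots>" using openin_r_coset[OF op] by (auto intro!: openin_Union)
  finally show ?thesis using H.subset by (simp add: closedin_def topspace_eq)
qed

lemma finite_rcosets_open_subgroup:
  assumes H: "subgroup H G" and op: "openin T H" shows "finite (rcosets H)"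
proof -
  have un: "\<Union>(rcosets H) = carrier G" by (rule rcosets_part_G[OF H])
  have "\<And>X. X \<in> rcosets H \<Longrightarrow> openin T X" using openin_r_coset[OF op] by (auto simp: RCOSETS_def)
  then obtain \<F> where F: "finite \<F>" "\<F> \<subseteq> rcosets H" "topspace T \<subseteq> \<Union>\<F>"
    using compact un unfolding compact_space_alt topspace_eq by (metis order_refl)
  have "rcosets H \<subseteq> \<F>"
  proof
    fix X assume X: "X \<in> rcosets H"
    then obtain x where x: "x \<in> X" using subgroup.rcosets_non_empty[OF H X] by blast
    then have "x \<in> carrier G" using X un by blast
    then obtain Y where Y: "Y \<in> \<F>" "x \<in> Y" using F(3) topspace_eq by blast
    then have "X = Y" using rcos_disjoint[OF H] X x F(2) by (auto simp: pairwise_def disjnt_def)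
    then show "X \<in> \<F>" using Y by simp
  qed
  then show ?thesis using F(1) finite_subset by blast
qed

text \<open>
  A closed subgroup is the intersection of the open subgroups \<open>H N\<close>.
\<close>

lemma separated_from_closed_subgroup:
  assumes H: "subgroup H G" and cl: "closedin T H" and x: "x \<in> carrier G" "x \<notin> H"
  shows "\<exists>N. N \<lhd> G \<and> openin T N \<and> x \<notin> H <#> N"
proof -
  interpret H: subgroup H G by fact
  let ?U = "{y \<in> topspace T. x \<otimes> y \<in> topspace T - H}"
  have "openin T ?U"
    by (rule openin_continuous_map_preimage[OF continuous_map_left_translation[OF x(1)]]) (use cl in blast)
  moreover have "\<one> \<in> ?U" using x by (simp add: topspace_eq)
  ultimately obtain N where N: "N \<lhd> G" "openin T N" "N \<subseteq> ?U" using open_normal_basis by blast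
  interpret N: normal N G by fact
  have "x \<notin> H <#> N"
  proof
    assume "x \<in> H <#> N"
    then obtain h n where hn: "h \<in> H" "n \<in> N" "x = h \<otimes> n" by (auto simp: set_mult_def)
    then have "x \<otimes> inv n = h" by (simp add: m_assoc)
    moreover have "x \<otimes> inv n \<notin> H" using N(3) N.m_inv_closed[OF hn(2)] by blast
    ultimately show False using hn(1) by simp
  qed
  then show ?thesis using N by blast
qed

text \<open>
  The converse of \<open>inverse_limit_small_kernel\<close>: \<open>G\<close> is the inverse limit of its quotients by a base of
  open normal subgroups, ordered by reverse inclusion. A compatible family of cosets is a directed
  family of nonempty closed sets, so by compactness it has a common point.
\<close>

lemma inverse_limit_of_quotients:
  assumes M: "\<M> \<noteq> {}" "\<And>M. M \<in> \<M> \<Longrightarrow> M \<lhd> G \<and> openin T M \<and> P (G Mod M)"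
    and directed: "\<And>M N. M \<in> \<M> \<Longrightarrow> N \<in> \<M> \<Longrightarrow> \<exists>L\<in>\<M>. L \<subseteq> M \<inter> N"
    and basis: "\<And>U. openin T U \<Longrightarrow> \<one> \<in> U \<Longrightarrow> \<exists>M\<in>\<M>. M \<subseteq> U"
  shows "inverse_limit_of_class P G T"
proof -
  \<comment> \<open>For \<open>j \<subseteq> i\<close> the product with \<open>i\<close> sends the coset \<open>j x\<close> to \<open>i x\<close>, as a projection of the system should.\<close>
  define leq :: "'a set \<Rightarrow> 'a set \<Rightarrow> bool" where "leq i j \<longleftrightarrow> j \<subseteq> i" for i j
  define F where "F M = G Mod M" for M
  define \<phi> :: "'a set \<Rightarrow> 'a set \<Rightarrow> 'a set \<Rightarrow> 'a set" where "\<phi> i j X = i <#> X" for i j X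
  have carF: "carrier (F M) = (\<lambda>x. M #> x) ` carrier G" for M by (simp add: F_def carrier_FactGroup)
  have sub: "M \<subseteq> carrier G" if "M \<in> \<M>" for M
    using M(2)[OF that] normal_imp_subgroup subgroup.subset by blast
  have \<phi>: "\<phi> i j (j #> x) = i #> x" if "i \<in> \<M>" "j \<in> \<M>" "j \<subseteq> i" "x \<in> carrier G" for i j x
  proof -
    interpret i: normal i G using M(2)[OF that(1)] by blast
    interpret j: normal j G using M(2)[OF that(2)] by blast
    have "i <#> j = i" by (rule set_mult_absorb(1)[OF j.one_closed i.subgroup_axioms that(3)])
    then show ?thesis unfolding \<phi>_def using setmult_rcos_assoc[OF i.subset j.subset that(4)] by simp
  qed
  have sys: "inverse_system \<M> leq F \<phi>"
    unfolding inverse_system_def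
  proof (intro conjI ballI impI)
    show "\<M> \<noteq> {}" by (rule M(1))
    show "leq i i" for i by (simp add: leq_def)
    show "i = j" if "leq i j" "leq j i" for i j using that by (auto simp: leq_def)
    show "leq i k" if "leq i j" "leq j k" for i j k using that by (auto simp: leq_def)
    show "\<exists>k\<in>\<M>. leq i k \<and> leq j k" if "i \<in> \<M>" "j \<in> \<M>" for i j
      using directed[OF that] by (auto simp: leq_def)
    show "group (F i)" if "i \<in> \<M>" for i unfolding F_def using M(2)[OF that] normal.factorgroup_is_group by blast
    show "\<phi> i j \<in> hom (F j) (F i)" if ij: "i \<in> \<M>" "j \<in> \<M>" "leq i j" for i j
    proof -
      interpret i: normal i G using M(2)[OF ij(1)] by blast
      interpret j: normal j G using M(2)[OF ij(2)] by blast
      have ji: "j \<subseteq> i" using ij(3) by (simp add: leq_def)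
      show ?thesis
      proof (rule homI)
        fix X assume "X \<in> carrier (F j)"
        then show "\<phi> i j X \<in> carrier (F i)" using \<phi>[OF ij(1,2) ji] by (auto simp: carF)
      next
        fix X Y assume "X \<in> carrier (F j)" "Y \<in> carrier (F j)"
        then obtain x y where xy: "x \<in> carrier G" "y \<in> carrier G" "X = j #> x" "Y = j #> y"
          by (auto simp: carF)
        show "\<phi> i j (X \<otimes>\<^bsub>F j\<^esub> Y) = \<phi> i j X \<otimes>\<^bsub>F i\<^esub> \<phi> i j Y"
          using xy \<phi>[OF ij(1,2) ji] by (simp add: F_def j.rcos_sum i.rcos_sum)
      qed
    qed
    show "\<phi> i i x = x" if "i \<in> \<M>" "x \<in> carrier (F i)" for i x
      using that \<phi>[of i i] by (auto simp: carF)
    show "\<phi> i j (\<phi> j k x) = \<phi> i k x" if "i \<in> \<M>" "j \<in> \<M>" "k \<in> \<M>" "leq i j" "leq j k" and x: "x \<in> carrier (F k)" for i j k x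
    proof -
      obtain y where "y \<in> carrier G" "x = k #> y" using x by (auto simp: carF)
      moreover have "j \<subseteq> i" "k \<subseteq> j" "k \<subseteq> i" using that by (auto simp: leq_def)
      ultimately show ?thesis using \<phi> that(1-3) by simp
    qed
  qed
  let ?L = "inverse_limit_group \<M> leq F \<phi>"
  let ?LT = "inverse_limit_topology \<M> leq F \<phi>"
  let ?P = "product_topology (\<lambda>i. discrete_topology (carrier (F i))) \<M>"
  define f where "f x = (\<lambda>M\<in>\<M>. M #> x)" for x
  have f_car: "f x \<in> carrier ?L" if x: "x \<in> carrier G" for x
    using x \<phi> by (auto simp: f_def inverse_limit_group_simps carF leq_def)
  have f_hom: "f \<in> hom G ?L"
  proof (rule homI[OF f_car])
    fix x y assume xy: "x \<in> carrier G" "y \<in> carrier G"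
    show "f (x \<otimes> y) = f x \<otimes>\<^bsub>?L\<^esub> f y"
      unfolding inverse_limit_group_simps
    proof
      fix M
      show "f (x \<otimes> y) M = (\<lambda>i\<in>\<M>. f x i \<otimes>\<^bsub>F i\<^esub> f y i) M"
        using xy normal.rcos_sum[of M G x y] M(2)[of M] by (auto simp: f_def F_def)
    qed
  qed
  have f_inj: "inj_on f (carrier G)"
  proof (rule inj_onI, rule ccontr)
    fix x y assume xy: "x \<in> carrier G" "y \<in> carrier G" "f x = f y" "x \<noteq> y"
    have mem: "x \<otimes> inv y \<in> M" if "M \<in> \<M>" for M
    proof -
      interpret M: normal M G using M(2)[OF that] by blast
      have "M #> x = M #> y" using fun_cong[OF xy(3), of M] that by (simp add: f_def)
      then show ?thesis using M.rcos_module_imp[OF is_group xy(2), of x] rcos_self[OF xy(1) M.subgroup_axioms] by simp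
    qed
    have ne: "x \<otimes> inv y \<noteq> \<one>" using xy by (simp add: inv_solve_right')
    then obtain U where "openin T U" "\<one> \<in> U" "x \<otimes> inv y \<notin> U"
      using Hausdorff xy(1,2) unfolding Hausdorff_space_def topspace_eq
      by (metis disjnt_iff inv_closed m_closed one_closed)
    then show False using basis mem by blast
  qed
  have f_surj: "carrier ?L \<subseteq> f ` carrier G"
  proof
    fix y assume y: "y \<in> carrier ?L"
    have yM: "y M \<in> rcosets M" if "M \<in> \<M>" for M
      using y that by (auto simp: inverse_limit_group_simps F_def FactGroup_def)
    have cl: "closedin T (y M) \<and> y M \<noteq> {}" if MM: "M \<in> \<M>" for M
    proof -
      interpret M: normal M G using M(2)[OF MM] by blast
      obtain x where x: "x \<in> carrier G" "y M = M #> x" using yM[OF MM] by (auto simp: RCOSETS_def)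
      then have "y M = x <# M" using M.coset_eq by blast
      moreover have "closedin T M" using closedin_open_subgroup M.subgroup_axioms M(2)[OF MM] by blast
      ultimately show ?thesis using closedin_l_coset x rcos_self[OF x(1) M.subgroup_axioms] by auto
    qed
    have mono: "y L \<subseteq> y M" if LM: "M \<in> \<M>" "L \<in> \<M>" "L \<subseteq> M" for L M
    proof -
      obtain x where x: "x \<in> carrier G" "y L = L #> x" using yM[OF LM(2)] by (auto simp: RCOSETS_def)
      have "y M = \<phi> M L (y L)" using y LM by (auto simp: inverse_limit_group_simps leq_def)
      also have "\<dots> = M #> x" using \<phi>[OF LM x(1)] x(2) by simp
      finally show ?thesis using x(2) LM(3) by (auto simp: r_coset_def)
    qed
    have "\<Inter>(y ` \<M>) \<noteq> {}"
    proof (rule compact_space_directed_Inter[OF compact])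
      fix A B assume "A \<in> y ` \<M>" "B \<in> y ` \<M>"
      then obtain M N where MN: "M \<in> \<M>" "N \<in> \<M>" "A = y M" "B = y N" by blast
      then obtain L where L: "L \<in> \<M>" "L \<subseteq> M \<inter> N" using directed by blast
      then have "y L \<subseteq> A \<inter> B" using mono[OF MN(1) L(1)] mono[OF MN(2) L(1)] MN(3,4) by simp
      then show "\<exists>C\<in>y ` \<M>. C \<subseteq> A \<inter> B" using L(1) by blast
    qed (use cl M(1) in auto)
    then obtain x where x: "\<And>M. M \<in> \<M> \<Longrightarrow> x \<in> y M" by blast
    have xG: "x \<in> carrier G"
    proof -
      obtain M where M0: "M \<in> \<M>" using M(1) by blast
      then show ?thesis using x[OF M0] cl[OF M0] closedin_subset topspace_eq by blast
    qed
    have "f x = y"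
    proof
      fix M
      show "f x M = y M"
      proof (cases "M \<in> \<M>")
        case True
        interpret M: normal M G using M(2)[OF True] by blast
        obtain z where z: "z \<in> carrier G" "y M = M #> z" using yM[OF True] by (auto simp: RCOSETS_def)
        then show ?thesis using repr_independence[OF _ z(1) M.subgroup_axioms, of x] x[OF True] True
          by (simp add: f_def)
      next
        case False
        then show ?thesis using y by (auto simp: f_def inverse_limit_group_simps PiE_iff extensional_def)
      qed
    qed
    then show "y \<in> f ` carrier G" using xG by blast
  qed
  have iso: "f \<in> iso G ?L"
    using f_hom f_inj f_surj f_car by (auto simp: iso_def bij_betw_def)
  have "homeomorphic_map T ?LT f"
  proof (rule continuous_imp_homeomorphic_map[OF _ compact Hausdorff_inverse_limit])
    have "continuous_map T ?P f"
      unfolding continuous_map_componentwise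
    proof (intro conjI ballI)
      show "f ` topspace T \<subseteq> extensional \<M>" by (auto simp: f_def)
      fix M assume MM: "M \<in> \<M>"
      interpret M: normal M G using M(2)[OF MM] by blast
      have op: "openin T {x \<in> topspace T. f x M \<in> U}" for U
      proof (subst openin_subopen, intro ballI)
        fix x assume x: "x \<in> {x \<in> topspace T. f x M \<in> U}"
        have xc: "x \<in> carrier G" using x topspace_eq by simp
        have "M #> x \<subseteq> {x \<in> topspace T. f x M \<in> U}"
        proof
          fix z assume z: "z \<in> M #> x"
          then have "z \<in> carrier G" using r_coset_subset_G[OF M.subset xc] by blast
          moreover have "M #> x = M #> z" by (rule repr_independence[OF z xc M.subgroup_axioms])
          ultimately show "z \<in> {x \<in> topspace T. f x M \<in> U}" using x MM by (simp add: f_def topspace_eq)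
        qed
        then show "\<exists>V. openin T V \<and> x \<in> V \<and> V \<subseteq> {x \<in> topspace T. f x M \<in> U}"
          using openin_r_coset[of M x] M(2)[OF MM] xc rcos_self[OF xc M.subgroup_axioms] by blast
      qed
      show "continuous_map T (discrete_topology (carrier (F M))) (\<lambda>x. f x M)"
        unfolding continuous_map_def using op MM by (auto simp: f_def carF topspace_eq)
    qed
    then show "continuous_map T ?LT f"
      unfolding inverse_limit_topology_def using f_car
      by (auto intro!: continuous_map_into_subtopology simp: topspace_eq)
    show "f ` topspace T = topspace ?LT"
      using f_surj f_car by (auto simp: topspace_inverse_limit topspace_eq)
    show "inj_on f (topspace T)" using f_inj by (simp add: topspace_eq)
  qed
  moreover have "\<forall>M\<in>\<M>. P (F M)" using M(2) by (simp add: F_def)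
  ultimately show ?thesis
    unfolding inverse_limit_of_class_def using topological_group sys iso by blast
qed

lemma profinite_open_subgroup:
  assumes H: "subgroup H G" and op: "openin T H"
  shows "profinite (G\<lparr>carrier := H\<rparr>) (subtopology T H)"
proof -
  let ?GH = "G\<lparr>carrier := H\<rparr>"
  interpret H: subgroup H G by fact
  interpret HG: group "?GH" by (rule H.subgroup_is_group[OF is_group])
  show ?thesis
  proof
    show "topological_group ?GH (subtopology T H)"
      unfolding topological_group_def
    proof (intro conjI)
      show "group ?GH" by (rule HG.is_group)
      show "topspace (subtopology T H) = carrier ?GH"
        using H.subset by (auto simp: topspace_eq)
      have "continuous_map (prod_topology (subtopology T H) (subtopology T H)) T (\<lambda>(x, y). x \<otimes> y)"
        unfolding subtopology_Times[symmetric] by (rule continuous_map_from_subtopology[OF continuous_map_mult])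
      then show "continuous_map (prod_topology (subtopology T H) (subtopology T H)) (subtopology T H)
          (\<lambda>(x, y). x \<otimes>\<^bsub>?GH\<^esub> y)"
        by (auto intro!: continuous_map_into_subtopology)
      have "continuous_map T T (\<lambda>x. inv x)" using topological_group by (simp add: topological_group_def)
      then have "continuous_map (subtopology T H) T (\<lambda>x. inv x)"
        by (rule continuous_map_from_subtopology)
      then have "continuous_map (subtopology T H) (subtopology T H) (\<lambda>x. inv x)"
        by (rule continuous_map_into_subtopology) auto
      then show "continuous_map (subtopology T H) (subtopology T H) (\<lambda>x. inv\<^bsub>?GH\<^esub> x)"
        by (rule continuous_map_eq) (simp add: m_inv_consistent[OF H])
    qed
    show "compact_space (subtopology T H)"
      by (intro compact_space_subtopology closedin_compact_space compact closedin_open_subgroup H op)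
    show "Hausdorff_space (subtopology T H)" by (rule Hausdorff_space_subtopology[OF Hausdorff])
    fix U assume U: "openin (subtopology T H) U" "\<one>\<^bsub>?GH\<^esub> \<in> U"
    then have "openin T U" "U \<subseteq> H" using op by (auto simp: openin_open_subtopology)
    then obtain N where N: "N \<lhd> G" "openin T N" "N \<subseteq> U" using open_normal_basis[of U] U(2) by auto
    have "N \<lhd> ?GH"
      using normal_restrict_supergroup[OF H N(1)] N(3) \<open>U \<subseteq> H\<close> by blast
    moreover have "openin (subtopology T H) N"
      using N \<open>U \<subseteq> H\<close> op by (auto simp: openin_open_subtopology)
    ultimately show "\<exists>N. N \<lhd> ?GH \<and> openin (subtopology T H) N \<and> N \<subseteq> U" using N(3) by blast
  qed
qed

end

section \<open>The space of closed subgroups\<close>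

context profinite
begin

text \<open>
  Label the cosets of \<open>M\<close> by numbers below \<open>n\<close>. The permutations by which the elements of \<open>S\<close> act on the
  labels, together with the label of \<open>M\<close> itself, determine which elements of the dense subgroup
  generated by \<open>S\<close> belong to \<open>M\<close>, and these determine the open and closed set \<open>M\<close>.
\<close>

lemma finite_open_subgroups_of_index:
  assumes S: "finite S" "S \<subseteq> carrier G" and dense: "T closure_of (generate G S) = carrier G"
  shows "finite {M. subgroup M G \<and> openin T M \<and> card (rcosets M) = n}"
proof -
  let ?\<M> = "{M. subgroup M G \<and> openin T M \<and> card (rcosets M) = n}"
  let ?S = "S \<union> m_inv G ` S"
  have S': "?S \<subseteq> carrier G" "finite ?S" using S by auto
  have "\<exists>b. bij_betw b (rcosets M) {..<n}" if "M \<in> ?\<M>" for M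
    using that finite_rcosets_open_subgroup ex_bij_betw_finite_nat[of "rcosets M"] by (auto simp: atLeast0LessThan)
  then obtain b where b: "\<And>M. M \<in> ?\<M> \<Longrightarrow> bij_betw (b M) (rcosets M) {..<n}" by metis
  define c where "c M = inv_into (rcosets M) (b M)" for M
  define act where "act M g = (\<lambda>k\<in>{..<n}. b M (c M k #> g))" for M g
  \<comment> \<open>The inverses of the generators are recorded as well, for \<open>generate\<close> adds them as generators.\<close>
  define data where "data M = (b M M, \<lambda>g\<in>?S. act M g)" for M
  have c: "c M k \<in> rcosets M" "b M (c M k) = k" if "M \<in> ?\<M>" "k < n" for M k
    using b[OF that(1)] that(2) unfolding c_def
    by (auto simp: bij_betw_def inv_into_into f_inv_into_f)
  have cb: "c M (b M X) = X" if "M \<in> ?\<M>" "X \<in> rcosets M" for M X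
    using b[OF that(1)] that(2) unfolding c_def by (simp add: bij_betw_inv_into_left)
  have bn: "b M X < n" if "M \<in> ?\<M>" "X \<in> rcosets M" for M X
    using b[OF that(1)] that(2) by (auto simp: bij_betw_def)
  have trans: "X #> g \<in> rcosets M" if "M \<in> ?\<M>" "X \<in> rcosets M" "g \<in> carrier G" for M X g
    using that subgroup.subset[of M G] by (auto simp: RCOSETS_def coset_mult_assoc)
  have sub: "X \<subseteq> carrier G" if "M \<in> ?\<M>" "X \<in> rcosets M" for M X
    using that rcosets_part_G[of M] by blast
  have self: "M \<in> rcosets M" if "M \<in> ?\<M>" for M
    using that subgroup.subgroup_in_rcosets[OF _ is_group] by blast
  have act_one: "act M \<one> = (\<lambda>k\<in>{..<n}. k)" if "M \<in> ?\<M>" for M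
    unfolding act_def using c[OF that] sub[OF that c(1)[OF that]] by (intro restrict_ext) (simp add: coset_mult_one)
  have act_mult: "act M (g \<otimes> h) = (\<lambda>k\<in>{..<n}. act M h (act M g k))"
    if M: "M \<in> ?\<M>" and g: "g \<in> carrier G" and h: "h \<in> carrier G" for M g h
    unfolding act_def
  proof (rule restrict_ext)
    fix k assume "k \<in> {..<n}"
    then have k: "k < n" by simp
    have X: "c M k #> g \<in> rcosets M" using trans[OF M c(1)[OF M k] g] .
    show "b M (c M k #> (g \<otimes> h)) = (\<lambda>k\<in>{..<n}. b M (c M k #> h)) ((\<lambda>k\<in>{..<n}. b M (c M k #> g)) k)"
      using k bn[OF M X] cb[OF M X] coset_mult_assoc[OF sub[OF M c(1)[OF M k]] g h] by simp
  qed
  have gen_car: "g \<in> carrier G" if "g \<in> generate G S" for g using generate_in_carrier[OF S(2) that] .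
  have "inj_on data ?\<M>"
  proof (rule inj_onI)
    fix M M' assume M: "M \<in> ?\<M>" and M': "M' \<in> ?\<M>" and eq: "data M = data M'"
    have eqS: "act M g = act M' g" if "g \<in> ?S" for g
    proof -
      have "(\<lambda>g\<in>?S. act M g) g = (\<lambda>g\<in>?S. act M' g) g" using eq unfolding data_def by (metis prod.inject)
      then show ?thesis using that by simp
    qed
    have act_eq: "act M g = act M' g" if "g \<in> generate G S" for g
      using that
    proof (induction g rule: generate.induct)
      case one then show ?case using act_one[OF M] act_one[OF M'] by simp
    next
      case (incl h) then show ?case using eqS by blast
    next
      case (inv h) then show ?case using eqS by blast
    next
      case (eng h1 h2)
      then show ?case using act_mult[OF M gen_car gen_car] act_mult[OF M' gen_car gen_car] by simp
    qed
    have mem: "g \<in> M \<longleftrightarrow> act M g (b M M) = b M M" if M: "M \<in> ?\<M>" and g: "g \<in> carrier G" for M g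
    proof -
      interpret M: subgroup M G using M by blast
      have "act M g (b M M) = b M (M #> g)"
        using bn[OF M self[OF M]] cb[OF M self[OF M]] by (simp add: act_def)
      moreover have "b M (M #> g) = b M M \<longleftrightarrow> M #> g = M"
        using cb[OF M self[OF M]] cb[OF M trans[OF M self[OF M] g]] by metis
      moreover have "M #> g = M \<longleftrightarrow> g \<in> M"
        using coset_join1[OF _ g M.subgroup_axioms] coset_join2[OF g M.subgroup_axioms] by blast
      ultimately show ?thesis by simp
    qed
    have same: "g \<in> M \<longleftrightarrow> g \<in> M'" if "g \<in> generate G S" for g
      using mem[OF M gen_car[OF that]] mem[OF M' gen_car[OF that]] act_eq[OF that] eq by (simp add: data_def)
    have "A \<subseteq> B" if A: "A \<in> ?\<M>" and B: "B \<in> ?\<M>" and AB: "\<And>g. g \<in> generate G S \<Longrightarrow> g \<in> A \<Longrightarrow> g \<in> B" for A B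
    proof (rule ccontr)
      assume "\<not> A \<subseteq> B"
      then obtain x where x: "x \<in> A - B" by blast
      have "openin T (A - B)" using A B closedin_open_subgroup by (auto intro: openin_diff)
      moreover have "x \<in> T closure_of (generate G S)"
        unfolding dense using x A subgroup.subset by blast
      ultimately obtain y where "y \<in> generate G S" "y \<in> A - B" using x unfolding in_closure_of by blast
      then show False using AB by blast
    qed
    then show "M = M'" using M M' same by blast
  qed
  moreover have "data ` ?\<M> \<subseteq> {..<n} \<times> (?S \<rightarrow>\<^sub>E ({..<n} \<rightarrow>\<^sub>E {..<n}))"
  proof (rule image_subsetI)
    fix M assume MM: "M \<in> ?\<M>"
    have "act M g \<in> {..<n} \<rightarrow>\<^sub>E {..<n}" if "g \<in> ?S" for g
      using bn[OF MM trans[OF MM c(1)[OF MM]]] that S' by (auto simp: act_def)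
    then show "data M \<in> {..<n} \<times> (?S \<rightarrow>\<^sub>E ({..<n} \<rightarrow>\<^sub>E {..<n}))"
      using bn[OF MM self[OF MM]] unfolding data_def by auto
  qed
  moreover have "finite ({..<n} \<times> (?S \<rightarrow>\<^sub>E ({..<n} \<rightarrow>\<^sub>E {..<n})))"
    using S'(2) by (intro finite_cartesian_product finite_PiE) auto
  ultimately show ?thesis by (rule inj_on_finite)
qed

lemma closed_subgroupsD:
  assumes "H \<in> closed_subgroups G T" shows "subgroup H G" "closedin T H" "H \<subseteq> carrier G"
  using assms subgroup.subset by (auto simp: closed_subgroups_def)

lemma open_subgroup_in_closed_subgroups:
  assumes "subgroup H G" "openin T H" shows "H \<in> closed_subgroups G T"
  using assms closedin_open_subgroup by (simp add: closed_subgroups_def)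

lemma set_mult_open_normal:
  assumes "subgroup K G" "N \<lhd> G" "openin T N"
  shows "subgroup (K <#> N) G" "openin T (K <#> N)"
  using set_mult_normal_subgroup[OF assms(1,2)] openin_set_mult[OF _ assms(3)] subgroup.subset[OF assms(1)] by auto

lemma basic_nbhd_self: "H \<in> closed_subgroups G T \<Longrightarrow> H \<in> basic_nbhd G T H N"
  by (simp add: basic_nbhd_def)

lemma basic_nbhd_cong: "K \<in> basic_nbhd G T H N \<Longrightarrow> basic_nbhd G T K N = basic_nbhd G T H N"
  by (simp add: basic_nbhd_def)

lemma basic_nbhd_mono:
  assumes M: "subgroup M G" and N: "subgroup N G" and MN: "M \<subseteq> N" and H: "H \<in> closed_subgroups G T"
  shows "basic_nbhd G T H M \<subseteq> basic_nbhd G T H N"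
proof
  fix K assume K: "K \<in> basic_nbhd G T H M"
  then have "K <#> N = H <#> N"
    using set_mult_coarser[OF M N MN, of K] set_mult_coarser[OF M N MN, of H] closed_subgroupsD(3) H
    by (auto simp: basic_nbhd_def)
  then show "K \<in> basic_nbhd G T H N" using K by (simp add: basic_nbhd_def)
qed

lemma carrier_open_normal: "carrier G \<lhd> G" "openin T (carrier G)"
  using normal_self openin_topspace[of T] topspace_eq by auto

lemma open_normal_Int:
  assumes "M \<lhd> G" "openin T M" "N \<lhd> G" "openin T N"
  shows "M \<inter> N \<lhd> G" "openin T (M \<inter> N)"
  using assms normal_subgroup_intersect by auto

lemma topspace_subgroup_space: "topspace (subgroup_space G T) = closed_subgroups G T"
  unfolding subgroup_space_def topology_generated_by_topspace
proof (intro equalityI subsetI)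
  fix H assume "H \<in> closed_subgroups G T"
  then show "H \<in> \<Union>{basic_nbhd G T H N | H N. H \<in> closed_subgroups G T \<and> N \<lhd> G \<and> openin T N}"
    using basic_nbhd_self carrier_open_normal by blast
qed (auto simp: basic_nbhd_def)

lemma openin_basic_nbhd:
  assumes "H \<in> closed_subgroups G T" "N \<lhd> G" "openin T N"
  shows "openin (subgroup_space G T) (basic_nbhd G T H N)"
  unfolding subgroup_space_def by (rule topology_generated_by_Basis) (use assms in blast)

text \<open>
  The generating sets form a base: by \<open>basic_nbhd_cong\<close> each of them is a basic neighbourhood of any of
  its points, and \<open>B(H, M \<inter> N) \<subseteq> B(H, M) \<inter> B(H, N)\<close>.
\<close>

lemma openin_subgroup_space_imp:
  assumes "openin (subgroup_space G T) U" and "H \<in> U"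
  shows "\<exists>N. N \<lhd> G \<and> openin T N \<and> basic_nbhd G T H N \<subseteq> U"
proof -
  have "generate_topology_on {basic_nbhd G T H N | H N. H \<in> closed_subgroups G T \<and> N \<lhd> G \<and> openin T N} U"
    using assms(1) unfolding subgroup_space_def by (rule openin_topology_generated_by)
  then show ?thesis using assms(2)
  proof (induction arbitrary: H rule: generate_topology_on.induct)
    case Empty then show ?case by simp
  next
    case (Int a b)
    obtain M N where MN: "M \<lhd> G" "openin T M" "basic_nbhd G T H M \<subseteq> a"
      "N \<lhd> G" "openin T N" "basic_nbhd G T H N \<subseteq> b"
      using Int.IH(1)[of H] Int.IH(2)[of H] Int.prems by blast
    have "generate_topology_on {basic_nbhd G T H N | H N. H \<in> closed_subgroups G T \<and> N \<lhd> G \<and> openin T N} a"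
      by (rule Int.hyps(1))
    then have "openin (subgroup_space G T) a"
      unfolding subgroup_space_def by (simp add: openin_topology_generated_by_iff)
    then have H: "H \<in> closed_subgroups G T"
      using openin_subset Int.prems topspace_subgroup_space by blast
    have "basic_nbhd G T H (M \<inter> N) \<subseteq> a \<inter> b"
      using basic_nbhd_mono[OF _ _ _ H, of "M \<inter> N"] normal_imp_subgroup open_normal_Int(1)[OF MN(1,2,4,5)]
        MN by blast
    then show ?case using open_normal_Int[OF MN(1,2,4,5)] by blast
  next
    case (UN K)
    then obtain k where "k \<in> K" "H \<in> k" by blast
    then obtain N where "N \<lhd> G" "openin T N" "basic_nbhd G T H N \<subseteq> k" using UN.IH by blast
    then show ?case using \<open>k \<in> K\<close> by blast
  next
    case (Basis s)
    then obtain H' N where "N \<lhd> G" "openin T N" "s = basic_nbhd G T H' N" by blast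
    then show ?case using basic_nbhd_cong Basis.prems by blast
  qed
qed

lemma closedin_basic_nbhd:
  assumes H: "H \<in> closed_subgroups G T" and N: "N \<lhd> G" "openin T N"
  shows "closedin (subgroup_space G T) (basic_nbhd G T H N)"
  unfolding closedin_def topspace_subgroup_space
proof
  show "basic_nbhd G T H N \<subseteq> closed_subgroups G T" by (auto simp: basic_nbhd_def)
  have "closed_subgroups G T - basic_nbhd G T H N = (\<Union>K\<in>closed_subgroups G T - basic_nbhd G T H N. basic_nbhd G T K N)"
    by (auto simp: basic_nbhd_def)
  also have "openin (subgroup_space G T) \<dots>" using openin_basic_nbhd N by (auto intro!: openin_Union)
  finally show "openin (subgroup_space G T) (closed_subgroups G T - basic_nbhd G T H N)" .
qed

text \<open>
  Each \<open>H N\<close> is a union of cosets of \<open>N\<close>, of which there are finitely many.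
\<close>

lemma finite_set_mult_images:
  assumes N: "N \<lhd> G" "openin T N"
  shows "finite ((\<lambda>H. H <#> N) ` closed_subgroups G T)"
proof -
  interpret N: normal N G by fact
  have "(\<lambda>H. H <#> N) ` closed_subgroups G T \<subseteq> \<Union> ` Pow (rcosets N)"
  proof clarify
    fix H assume H: "H \<in> closed_subgroups G T"
    have Hc: "H \<subseteq> carrier G" using closed_subgroupsD(3)[OF H] .
    have "H <#> N = (\<Union>h\<in>H. h <# N)" by (auto simp: set_mult_def l_coset_def)
    also have "\<dots> = \<Union>((\<lambda>h. N #> h) ` H)" using N.coset_eq Hc by auto
    finally have "H <#> N = \<Union>((\<lambda>h. N #> h) ` H)" .
    moreover have "(\<lambda>h. N #> h) ` H \<subseteq> rcosets N" using Hc by (auto simp: RCOSETS_def)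
    ultimately show "H <#> N \<in> \<Union> ` Pow (rcosets N)" by blast
  qed
  moreover have "finite (\<Union> ` Pow (rcosets N))"
    using finite_rcosets_open_subgroup[OF N.subgroup_axioms N(2)] by simp
  ultimately show ?thesis by (rule finite_subset)
qed

text \<open>
  The identification of \<open>S(G)\<close> with the inverse limit of the finite sets \<open>S(G/N)\<close>, where a subgroup of
  \<open>G/N\<close> is represented by its preimage \<open>A N\<close>. The subgroup sought is the intersection \<open>H\<close> of all \<open>A N\<close>.
  For \<open>x \<in> A N\<close> the sets \<open>x N \<inter> A M\<close> with \<open>M \<subseteq> N\<close> are nonempty, closed and directed; a common
  point of them lies in \<open>H\<close> and shows that \<open>x \<in> H N\<close>.
\<close>

lemma compatible_family_is_subgroup:
  assumes A: "\<And>N. N \<lhd> G \<Longrightarrow> openin T N \<Longrightarrow> \<exists>K\<in>closed_subgroups G T. A N = K <#> N"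
    and compat: "\<And>M N. M \<lhd> G \<Longrightarrow> openin T M \<Longrightarrow> N \<lhd> G \<Longrightarrow> openin T N \<Longrightarrow> M \<subseteq> N \<Longrightarrow> A M <#> N = A N"
  shows "\<exists>H\<in>closed_subgroups G T. \<forall>N. N \<lhd> G \<longrightarrow> openin T N \<longrightarrow> A N = H <#> N"
proof -
  let ?\<N> = "{N. N \<lhd> G \<and> openin T N}"
  define H where "H = \<Inter>(A ` ?\<N>)"
  have A': "subgroup (A N) G" "openin T (A N)" if N: "N \<lhd> G" "openin T N" for N
  proof -
    obtain K where K: "K \<in> closed_subgroups G T" "A N = K <#> N" using A[OF N] by blast
    then show "subgroup (A N) G" "openin T (A N)" using set_mult_open_normal[OF closed_subgroupsD(1)[OF K(1)] N] by auto
  qed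
  have A_ne: "A ` ?\<N> \<noteq> {}" using carrier_open_normal by blast
  have AN: "A N <#> N = A N" if N: "N \<lhd> G" "openin T N" for N using compat[OF N N] by simp
  have A_mono: "A M \<subseteq> A N" if M: "M \<lhd> G" "openin T M" and N: "N \<lhd> G" "openin T N" and MN: "M \<subseteq> N" for M N
    using subset_set_mult(1)[OF subgroup.subset[OF A'(1)[OF M]], of N] compat[OF M N MN]
      subgroup.one_closed[OF normal_imp_subgroup[OF N(1)]] by simp
  have Hs: "subgroup H G" unfolding H_def by (rule subgroups_Inter) (use A' A_ne in auto)
  have "closedin T H" unfolding H_def
    by (rule closedin_Inter[OF A_ne]) (use A' closedin_open_subgroup in blast)
  then have H: "H \<in> closed_subgroups G T" using Hs by (simp add: closed_subgroups_def)
  have "A N = H <#> N" if N: "N \<lhd> G" "openin T N" for N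
  proof
    have "H \<subseteq> A N" using N by (auto simp: H_def)
    then have "H <#> N \<subseteq> A N <#> N" by (rule mono_set_mult) simp
    then show "H <#> N \<subseteq> A N" using AN[OF N] by simp
  next
    interpret N: normal N G using N(1) .
    show "A N \<subseteq> H <#> N"
    proof
      fix x assume x: "x \<in> A N"
      have xc: "x \<in> carrier G" using x A'(1)[OF N] subgroup.subset by blast
      let ?\<F> = "(\<lambda>M. (x <# N) \<inter> A M) ` {M. M \<lhd> G \<and> openin T M \<and> M \<subseteq> N}"
      have "\<Inter>?\<F> \<noteq> {}"
      proof (rule compact_space_directed_Inter[OF compact])
        show "?\<F> \<noteq> {}" using N by blast
      next
        fix C assume "C \<in> ?\<F>"
        then obtain M where M: "M \<lhd> G" "openin T M" "M \<subseteq> N" "C = (x <# N) \<inter> A M" by blast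
        have "closedin T N" using closedin_open_subgroup N N.subgroup_axioms by blast
        then have "closedin T C" unfolding M(4)
          using closedin_l_coset[OF _ xc] closedin_open_subgroup[OF A'[OF M(1,2)]] by blast
        moreover have "x \<in> A M <#> N" using x compat[OF M(1,2) N M(3)] by simp
        then obtain a n where an: "a \<in> A M" "n \<in> N" "x = a \<otimes> n" by (auto simp: set_mult_def)
        have "a \<in> carrier G" using an(1) A'(1)[OF M(1,2)] subgroup.subset by blast
        then have "a = x \<otimes> inv n" using an by (simp add: m_assoc)
        then have "a \<in> x <# N" using an(2) unfolding l_coset_def by blast
        then have "a \<in> C" using M(4) an(1) by blast
        ultimately show "closedin T C \<and> C \<noteq> {}" by blast
      next
        fix C D assume "C \<in> ?\<F>" "D \<in> ?\<F>"
        then obtain M L where M: "M \<lhd> G" "openin T M" "M \<subseteq> N" "C = (x <# N) \<inter> A M"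
          and L: "L \<lhd> G" "openin T L" "L \<subseteq> N" "D = (x <# N) \<inter> A L" by blast
        note ints = open_normal_Int[OF M(1,2) L(1,2)]
        have "A (M \<inter> L) \<subseteq> A M" "A (M \<inter> L) \<subseteq> A L" using A_mono[OF ints M(1,2)] A_mono[OF ints L(1,2)] by auto
        then have "(x <# N) \<inter> A (M \<inter> L) \<subseteq> C \<inter> D" using M(4) L(4) by blast
        moreover have "(x <# N) \<inter> A (M \<inter> L) \<in> ?\<F>" using ints M(3) by blast
        ultimately show "\<exists>E\<in>?\<F>. E \<subseteq> C \<inter> D" by blast
      qed
      then obtain h where h: "\<And>M. M \<lhd> G \<Longrightarrow> openin T M \<Longrightarrow> M \<subseteq> N \<Longrightarrow> h \<in> (x <# N) \<inter> A M" by blast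
      have "h \<in> A M" if M: "M \<lhd> G" "openin T M" for M
        using h[of "M \<inter> N"] open_normal_Int[OF M N] A_mono[OF open_normal_Int[OF M N] M] by blast
      then have hH: "h \<in> H" by (auto simp: H_def)
      obtain n where n: "n \<in> N" "h = x \<otimes> n" using h[OF N] by (auto simp: l_coset_def)
      then have "x = h \<otimes> inv n" using xc by (simp add: m_assoc)
      then show "x \<in> H <#> N" using hH n(1) unfolding set_mult_def by blast
    qed
  qed
  then show ?thesis using H by blast
qed

text \<open>
  The compatible families form a closed subset of a product of finite discrete spaces, and \<open>S(G)\<close> is the
  continuous image of this compact set under the map taking a family to its intersection.
\<close>

lemma compact_subgroup_space: "compact_space (subgroup_space G T)"
proof -
  let ?\<N> = "{N. N \<lhd> G \<and> openin T N}"
  let ?D = "\<lambda>N. (\<lambda>H. H <#> N) ` closed_subgroups G T"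
  let ?P = "product_topology (\<lambda>N. discrete_topology (?D N)) ?\<N>"
  let ?e = "\<lambda>H. \<lambda>N\<in>?\<N>. H <#> N"
  let ?Y = "?e ` closed_subgroups G T"
  have P: "compact_space ?P"
    using finite_set_mult_images by (auto simp: compact_space_product_topology compact_space_discrete_topology)
  let ?E = "\<lambda>M N. {A \<in> topspace ?P. A M <#> N = A N}"
  have cl: "closedin ?P (?E M N)" if M: "M \<in> ?\<N>" and N: "N \<in> ?\<N>" and MN: "M \<subseteq> N" for M N
  proof (rule closedin_continuous_maps_eq)
    show "Hausdorff_space (discrete_topology (?D N))" by simp
    show "continuous_map ?P (discrete_topology (?D N)) (\<lambda>A. A N)"
      by (rule continuous_map_product_projection[OF N])
    have disc: "continuous_map (discrete_topology (?D M)) (discrete_topology (?D N)) (\<lambda>X. X <#> N)"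
      using set_mult_coarser[of M N] normal_imp_subgroup[of M G] normal_imp_subgroup[of N G] M N MN closed_subgroupsD(3) by (auto simp: image_iff)
    have "continuous_map ?P (discrete_topology (?D M)) (\<lambda>A. A M)"
      by (rule continuous_map_product_projection[OF M])
    from continuous_map_compose[OF this disc]
    show "continuous_map ?P (discrete_topology (?D N)) (\<lambda>A. A M <#> N)" by (simp add: o_def)
  qed
  have Y_eq: "?Y = \<Inter>(insert (topspace ?P) {?E M N | M N. M \<in> ?\<N> \<and> N \<in> ?\<N> \<and> M \<subseteq> N})"
  proof (intro equalityI subsetI)
    fix A assume "A \<in> ?Y"
    then obtain H where H: "H \<in> closed_subgroups G T" "A = ?e H" by blast
    have top: "A \<in> topspace ?P" using H by auto
    moreover have "A M <#> N = A N" if "M \<in> ?\<N>" "N \<in> ?\<N>" "M \<subseteq> N" for M N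
      using set_mult_coarser[of M N H] normal_imp_subgroup[of M G] normal_imp_subgroup[of N G] that H closed_subgroupsD(3)[OF H(1)] by simp
    ultimately show "A \<in> \<Inter>(insert (topspace ?P) {?E M N | M N. M \<in> ?\<N> \<and> N \<in> ?\<N> \<and> M \<subseteq> N})" by blast
  next
    fix A assume A: "A \<in> \<Inter>(insert (topspace ?P) {?E M N | M N. M \<in> ?\<N> \<and> N \<in> ?\<N> \<and> M \<subseteq> N})"
    then have top: "A \<in> topspace ?P" by blast
    have "A M <#> N = A N" if "M \<lhd> G" "openin T M" "N \<lhd> G" "openin T N" "M \<subseteq> N" for M N
      using A that by blast
    moreover have "\<exists>K\<in>closed_subgroups G T. A N = K <#> N" if "N \<lhd> G" "openin T N" for N
      using top that by (auto simp: PiE_iff)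
    ultimately obtain H where H: "H \<in> closed_subgroups G T" "\<forall>N. N \<lhd> G \<longrightarrow> openin T N \<longrightarrow> A N = H <#> N"
      using compatible_family_is_subgroup[of A] by blast
    have "A = ?e H" using H(2) top by (auto simp: PiE_iff extensional_def fun_eq_iff)
    then show "A \<in> ?Y" using H(1) by blast
  qed
  have "closedin ?P ?Y"
    unfolding Y_eq by (rule closedin_Inter) (use cl closedin_topspace[of ?P] in blast)+
  then have cptY: "compact_space (subtopology ?P ?Y)"
    by (rule compact_space_subtopology[OF closedin_compact_space[OF P]])
  define g where "g A = \<Inter>(A ` ?\<N>)" for A :: "'a set \<Rightarrow> 'a set"
  have g: "g (?e H) = H" if H: "H \<in> closed_subgroups G T" for H
  proof -
    have "g (?e H) = (\<Inter>N\<in>?\<N>. H <#> N)" by (simp add: g_def)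
    also have "\<dots> = H"
    proof
      show "H \<subseteq> (\<Inter>N\<in>?\<N>. H <#> N)"
        using subset_set_mult(1)[OF closed_subgroupsD(3)[OF H]] normal_imp_subgroup subgroup.one_closed by blast
      show "(\<Inter>N\<in>?\<N>. H <#> N) \<subseteq> H"
      proof (rule ccontr)
        assume "\<not> ?thesis"
        then obtain x where x: "x \<in> (\<Inter>N\<in>?\<N>. H <#> N)" "x \<notin> H" by blast
        have "x \<in> H <#> carrier G" using x(1) carrier_open_normal by blast
        then have "x \<in> carrier G" using closed_subgroupsD(3)[OF H] by (auto simp: set_mult_def)
        then show False using separated_from_closed_subgroup[OF closed_subgroupsD(1,2)[OF H]] x by blast
      qed
    qed
    finally show ?thesis .
  qed
  have "?Y \<subseteq> topspace ?P" unfolding Y_eq by blast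
  then have topY: "topspace (subtopology ?P ?Y) = ?Y" by (rule topspace_subtopology_subset)
  have cont: "continuous_map (subtopology ?P ?Y) (subgroup_space G T) g"
    unfolding subgroup_space_def continuous_on_generated_topo_iff
  proof (intro conjI allI impI)
    fix U assume "U \<in> {basic_nbhd G T H N | H N. H \<in> closed_subgroups G T \<and> N \<lhd> G \<and> openin T N}"
    then obtain H N where HN: "H \<in> closed_subgroups G T" "N \<in> ?\<N>" "U = basic_nbhd G T H N" by blast
    have "g -` U \<inter> topspace (subtopology ?P ?Y) = {A \<in> topspace (subtopology ?P ?Y). A N \<in> {H <#> N}}"
      unfolding topY using g HN(2,3) by (auto simp: basic_nbhd_def)
    also have "openin (subtopology ?P ?Y) \<dots>"
      by (rule openin_continuous_map_preimage[OF continuous_map_from_subtopology[OF continuous_map_product_projection[OF HN(2)]]])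
         (use HN(1) in auto)
    finally show "openin (subtopology ?P ?Y) (g -` U \<inter> topspace (subtopology ?P ?Y))" .
  next
    show "g ` topspace (subtopology ?P ?Y) \<subseteq> \<Union>{basic_nbhd G T H N | H N. H \<in> closed_subgroups G T \<and> N \<lhd> G \<and> openin T N}"
      unfolding topY using g topspace_subgroup_space[unfolded subgroup_space_def topology_generated_by_topspace] by auto
  qed
  have img: "g ` topspace (subtopology ?P ?Y) = topspace (subgroup_space G T)"
    unfolding topY topspace_subgroup_space image_image using g by simp
  show ?thesis
    using image_compactin[OF cptY[unfolded compact_space_def] cont] unfolding compact_space_def img .
qed

text \<open>
  If \<open>{H} = B(H, N)\<close>, then \<open>H N = H\<close>, because \<open>H N\<close> belongs to \<open>B(H, N)\<close>; so \<open>N \<subseteq> H\<close>.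
\<close>

lemma isolated_subgroup_iff:
  "(\<exists>H. openin (subgroup_space G T) {H}) \<longleftrightarrow>
   (\<exists>H N. subgroup H G \<and> N \<lhd> G \<and> openin T N \<and> N \<subseteq> H \<and>
     (\<forall>K. subgroup K G \<longrightarrow> closedin T K \<longrightarrow> K <#> N = H \<longrightarrow> K = H))"
proof
  assume "\<exists>H. openin (subgroup_space G T) {H}"
  then obtain H where op: "openin (subgroup_space G T) {H}" by blast
  then have H: "H \<in> closed_subgroups G T" using openin_subset topspace_subgroup_space by blast
  note Hs = closed_subgroupsD[OF H]
  obtain N where N: "N \<lhd> G" "openin T N" "basic_nbhd G T H N \<subseteq> {H}"
    using openin_subgroup_space_imp[OF op] by blast
  note HN = set_mult_open_normal[OF Hs(1) N(1,2)]
  note Ns = normal_imp_subgroup[OF N(1)]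
  have "(H <#> N) <#> N = H <#> N" using set_mult_coarser[OF Ns Ns _ Hs(3)] by simp
  then have "H <#> N \<in> basic_nbhd G T H N"
    using open_subgroup_in_closed_subgroups[OF HN] by (simp add: basic_nbhd_def)
  then have eq: "H <#> N = H" using N(3) by blast
  have "N \<subseteq> H" using subset_set_mult(2)[OF subgroup.subset[OF Ns] subgroup.one_closed[OF Hs(1)]] eq by simp
  moreover have "K = H" if "subgroup K G" "closedin T K" "K <#> N = H" for K
  proof -
    have "K \<in> basic_nbhd G T H N" using that eq by (simp add: basic_nbhd_def closed_subgroups_def)
    then show ?thesis using N(3) by blast
  qed
  ultimately show "\<exists>H N. subgroup H G \<and> N \<lhd> G \<and> openin T N \<and> N \<subseteq> H \<and>
     (\<forall>K. subgroup K G \<longrightarrow> closedin T K \<longrightarrow> K <#> N = H \<longrightarrow> K = H)" using Hs(1) N(1,2) by blast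
next
  assume "\<exists>H N. subgroup H G \<and> N \<lhd> G \<and> openin T N \<and> N \<subseteq> H \<and>
     (\<forall>K. subgroup K G \<longrightarrow> closedin T K \<longrightarrow> K <#> N = H \<longrightarrow> K = H)"
  then obtain H N where H: "subgroup H G" and N: "N \<lhd> G" "openin T N" "N \<subseteq> H"
    and frat: "\<And>K. subgroup K G \<Longrightarrow> closedin T K \<Longrightarrow> K <#> N = H \<Longrightarrow> K = H" by blast
  have "openin T H"
    using openin_subgroup_supset[OF H N(3,2)] subgroup.one_closed[OF normal_imp_subgroup[OF N(1)]] .
  then have Hc: "H \<in> closed_subgroups G T" by (rule open_subgroup_in_closed_subgroups[OF H])
  have "H <#> N = H" by (rule set_mult_absorb(1)[OF subgroup.one_closed[OF normal_imp_subgroup[OF N(1)]] H N(3)])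
  then have "basic_nbhd G T H N = {H}"
    using frat Hc by (auto simp: basic_nbhd_def closed_subgroups_def)
  then show "\<exists>H. openin (subgroup_space G T) {H}" using openin_basic_nbhd[OF Hc N(1,2)] by metis
qed

lemma countable_open_normal_basis:
  assumes "second_countable T"
  obtains \<N> where "countable \<N>" "\<And>N. N \<in> \<N> \<Longrightarrow> N \<lhd> G \<and> openin T N"
    "\<And>U. openin T U \<Longrightarrow> \<one> \<in> U \<Longrightarrow> \<exists>N\<in>\<N>. N \<subseteq> U"
proof -
  obtain \<B> where B: "countable \<B>" "\<forall>V\<in>\<B>. openin T V" "\<forall>U x. openin T U \<and> x \<in> U \<longrightarrow> (\<exists>V\<in>\<B>. x \<in> V \<and> V \<subseteq> U)"
    using assms unfolding second_countable_def by blast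
  have "\<exists>N. N \<lhd> G \<and> openin T N \<and> N \<subseteq> V" if "V \<in> {V \<in> \<B>. \<one> \<in> V}" for V
    using open_normal_basis B(2) that by blast
  then obtain n where n: "\<And>V. V \<in> {V \<in> \<B>. \<one> \<in> V} \<Longrightarrow> n V \<lhd> G \<and> openin T (n V) \<and> n V \<subseteq> V" by metis
  show thesis
  proof (rule that[of "n ` {V \<in> \<B>. \<one> \<in> V}"])
    show "countable (n ` {V \<in> \<B>. \<one> \<in> V})" using B(1) by (intro countable_image) (auto intro: countable_subset)
    show "N \<lhd> G \<and> openin T N" if "N \<in> n ` {V \<in> \<B>. \<one> \<in> V}" for N using that n by blast
    fix U assume "openin T U" "\<one> \<in> U"
    then obtain V where "V \<in> {V \<in> \<B>. \<one> \<in> V}" "V \<subseteq> U" using B(3) by blast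
    then show "\<exists>N\<in>n ` {V \<in> \<B>. \<one> \<in> V}. N \<subseteq> U" using n by blast
  qed
qed

lemma countable_separating_clopens:
  assumes "second_countable T"
  obtains \<C> where "countable \<C>"
    "\<And>A. A \<in> \<C> \<Longrightarrow> openin (subgroup_space G T) A \<and> closedin (subgroup_space G T) A"
    "\<And>H K. H \<in> closed_subgroups G T \<Longrightarrow> K \<in> closed_subgroups G T \<Longrightarrow> H \<noteq> K \<Longrightarrow> \<exists>A\<in>\<C>. H \<in> A \<longleftrightarrow> K \<notin> A"
proof -
  obtain \<N> where N: "countable \<N>" "\<And>N. N \<in> \<N> \<Longrightarrow> N \<lhd> G \<and> openin T N"
    "\<And>U. openin T U \<Longrightarrow> \<one> \<in> U \<Longrightarrow> \<exists>N\<in>\<N>. N \<subseteq> U" using countable_open_normal_basis[OF assms] by blast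
  define \<C> where "\<C> = (\<Union>N\<in>\<N>. (\<lambda>H. basic_nbhd G T H N) ` closed_subgroups G T)"
  have fin: "finite ((\<lambda>H. basic_nbhd G T H N) ` closed_subgroups G T)" if "N \<in> \<N>" for N
  proof -
    have "(\<lambda>H. basic_nbhd G T H N) ` closed_subgroups G T =
      (\<lambda>X. {K \<in> closed_subgroups G T. K <#> N = X}) ` (\<lambda>H. H <#> N) ` closed_subgroups G T"
      by (simp add: image_image basic_nbhd_def)
    then show ?thesis using finite_set_mult_images N(2)[OF that] by simp
  qed
  show thesis
  proof (rule that[of \<C>])
    show "countable \<C>" unfolding \<C>_def using N(1) fin by (intro countable_UN) (auto intro: countable_finite)
    show "openin (subgroup_space G T) A \<and> closedin (subgroup_space G T) A" if "A \<in> \<C>" for A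
      using that N(2) openin_basic_nbhd closedin_basic_nbhd by (auto simp: \<C>_def)
    have sep: "\<exists>A\<in>\<C>. H \<in> A \<and> K \<notin> A" if H: "H \<in> closed_subgroups G T" and K: "K \<in> closed_subgroups G T"
      and x: "x \<in> H" "x \<notin> K" for H K x
    proof -
      have xc: "x \<in> carrier G" using x(1) closed_subgroupsD(3)[OF H] by blast
      obtain M where M: "M \<lhd> G" "openin T M" "x \<notin> K <#> M"
        using separated_from_closed_subgroup[OF closed_subgroupsD(1,2)[OF K] xc x(2)] by blast
      obtain N' where N': "N' \<in> \<N>" "N' \<subseteq> M"
        using N(3)[OF M(2)] subgroup.one_closed[OF normal_imp_subgroup[OF M(1)]] by blast
      have "K <#> N' \<subseteq> K <#> M" by (rule mono_set_mult[OF _ N'(2)]) simp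
      then have "x \<notin> K <#> N'" using M(3) by blast
      moreover have "x \<in> H <#> N'"
        using subset_set_mult(1)[OF closed_subgroupsD(3)[OF H]] x(1) normal_imp_subgroup
          subgroup.one_closed N(2)[OF N'(1)] by blast
      ultimately have "K \<notin> basic_nbhd G T H N'" by (auto simp: basic_nbhd_def)
      then show ?thesis using basic_nbhd_self[OF H] N'(1) H unfolding \<C>_def by blast
    qed
    show "\<exists>A\<in>\<C>. H \<in> A \<longleftrightarrow> K \<notin> A"
      if H: "H \<in> closed_subgroups G T" and K: "K \<in> closed_subgroups G T" and ne: "H \<noteq> K" for H K
    proof (cases "H \<subseteq> K")
      case True
      then obtain x where "x \<in> K" "x \<notin> H" using ne by blast
      then show ?thesis using sep[OF K H] by blast
    next
      case False
      then obtain x where "x \<in> H" "x \<notin> K" by blast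
      then show ?thesis using sep[OF H K] by blast
    qed
  qed
qed

text \<open>
  The clopen set \<open>B(N, N)\<close> consists of the closed subgroups \<open>K\<close> with \<open>K N = N\<close>, that is, of those contained
  in \<open>N\<close>; its largest element is \<open>N\<close>. In a second countable compact space a clopen set is a finite union
  of basic open sets, so there are only countably many clopen sets, hence countably many \<open>N\<close>.
\<close>

lemma second_countable_if_subgroup_space:
  assumes sc: "second_countable (subgroup_space G T)"
  shows "second_countable T"
proof -
  let ?S = "subgroup_space G T"
  let ?\<N> = "{N. N \<lhd> G \<and> openin T N}"
  obtain \<B> where B: "countable \<B>" "\<forall>V\<in>\<B>. openin ?S V" "\<forall>U x. openin ?S U \<and> x \<in> U \<longrightarrow> (\<exists>V\<in>\<B>. x \<in> V \<and> V \<subseteq> U)"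
    using sc unfolding second_countable_def by blast
  let ?b = "\<lambda>N. basic_nbhd G T N N"
  have Nc: "N \<in> closed_subgroups G T" if "N \<in> ?\<N>" for N
    using that open_subgroup_in_closed_subgroups normal_imp_subgroup by blast
  have "?b N \<in> \<Union> ` {\<F>. \<F> \<subseteq> \<B> \<and> finite \<F>}" if N: "N \<in> ?\<N>" for N
  proof -
    have op: "openin ?S (?b N)" and cl: "closedin ?S (?b N)"
      using openin_basic_nbhd[OF Nc[OF N]] closedin_basic_nbhd[OF Nc[OF N]] N by auto
    have cpt: "compactin ?S (?b N)" by (rule closedin_compact_space[OF compact_subgroup_space cl])
    let ?\<V> = "{V \<in> \<B>. V \<subseteq> ?b N}"
    have "?b N \<subseteq> \<Union>?\<V>" using B(3) op by blast
    then obtain \<F> where F: "finite \<F>" "\<F> \<subseteq> ?\<V>" "?b N \<subseteq> \<Union>\<F>"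
      using cpt B(2) unfolding compactin_def by (metis (mono_tags, lifting) mem_Collect_eq)
    then have "?b N = \<Union>\<F>" by blast
    then show ?thesis using F by blast
  qed
  then have "countable (?b ` ?\<N>)"
    using countable_subset[of "?b ` ?\<N>" "\<Union> ` {\<F>. \<F> \<subseteq> \<B> \<and> finite \<F>}"] countable_Collect_finite_subset[OF B(1)]
    by (simp add: image_subset_iff conj_commute)
  moreover have "inj_on ?b ?\<N>"
  proof (rule inj_onI)
    have "A \<subseteq> C" if A: "A \<in> ?\<N>" and C: "C \<in> ?\<N>" and eq: "?b A = ?b C" for A C
    proof -
      have As: "subgroup A G" and Cs: "subgroup C G" using A C normal_imp_subgroup by auto
      have "A \<in> ?b C" using basic_nbhd_self[OF Nc[OF A]] eq by blast
      then have "A <#> C = C"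
        using set_mult_absorb(1)[OF subgroup.one_closed[OF Cs] Cs] by (simp add: basic_nbhd_def)
      then show ?thesis using subset_set_mult(1)[OF subgroup.subset[OF As] subgroup.one_closed[OF Cs]] by simp
    qed
    then show "M = N" if "M \<in> ?\<N>" "N \<in> ?\<N>" "?b M = ?b N" for M N using that by blast
  qed
  ultimately have cN: "countable ?\<N>" by (rule countable_image_inj_on)
  define \<D> where "\<D> = (\<Union>N\<in>?\<N>. rcosets N)"
  have "countable \<D>" unfolding \<D>_def
    using cN finite_rcosets_open_subgroup normal_imp_subgroup by (intro countable_UN) (auto intro: countable_finite)
  moreover have "openin T V" if "V \<in> \<D>" for V
    using that openin_r_coset by (auto simp: \<D>_def RCOSETS_def)
  moreover have "\<exists>V\<in>\<D>. x \<in> V \<and> V \<subseteq> U" if U: "openin T U" "x \<in> U" for U x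
  proof -
    have xc: "x \<in> carrier G" using openin_subset[OF U(1)] U(2) topspace_eq by blast
    have sub: "U \<subseteq> carrier G" using openin_subset[OF U(1)] topspace_eq by blast
    have "openin T (U #> inv x)" using openin_r_coset[OF U(1)] xc by simp
    moreover have "\<one> = x \<otimes> inv x" using xc by simp
    then have "\<one> \<in> U #> inv x" using U(2) unfolding r_coset_def by blast
    ultimately obtain N where N: "N \<lhd> G" "openin T N" "N \<subseteq> U #> inv x" using open_normal_basis by blast
    have "N #> x \<subseteq> (U #> inv x) #> x" using N(3) by (auto simp: r_coset_def)
    also have "\<dots> = U" using xc sub by (simp add: coset_mult_assoc)
    finally have "N #> x \<subseteq> U" .
    moreover have "x \<in> N #> x" using rcos_self[OF xc normal_imp_subgroup[OF N(1)]] .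
    moreover have "N #> x \<in> \<D>" using N xc by (auto simp: \<D>_def RCOSETS_def)
    ultimately show ?thesis by blast
  qed
  ultimately show ?thesis unfolding second_countable_def by blast
qed

end

section \<open>Isolated points of the space of closed subgroups\<close>

context profinite
begin

lemma mem_order_prime_divisors_iff:
  "p \<in> order_prime_divisors G T \<longleftrightarrow>
    prime p \<and> (\<exists>N. N \<lhd> G \<and> openin T N \<and> p dvd card (rcosets N))"
proof (cases "prime p")
  case True
  have pos: "card (rcosets N) \<noteq> 0" if "N \<lhd> G" "openin T N" for N
    using finite_rcosets_open_subgroup[of N] that normal_imp_subgroup[of N G]
      subgroup.subgroup_in_rcosets[of N G] is_group by auto
  have "1 \<le> profinite_order G T p \<longleftrightarrow> 0 < profinite_order G T p"
    by (metis ileI1 one_eSuc zero_less_one order_less_le_trans)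
  also have "\<dots> \<longleftrightarrow> (\<exists>N\<in>{N. N \<lhd> G \<and> openin T N}. 0 < enat (multiplicity p (card (rcosets N))))"
    unfolding profinite_order_def by (rule less_SUP_iff)
  also have "\<dots> \<longleftrightarrow> (\<exists>N. N \<lhd> G \<and> openin T N \<and> 0 < multiplicity p (card (rcosets N)))"
    by (auto simp: zero_enat_def)
  also have "\<dots> \<longleftrightarrow> (\<exists>N. N \<lhd> G \<and> openin T N \<and> p dvd card (rcosets N))"
    using pos True by (metis prime_multiplicity_gt_zero_iff prime_elem_multiplicity_eq_zero_iff prime_imp_prime_elem neq0_conv)
  finally show ?thesis using True by (simp add: order_prime_divisors_def)
qed (simp add: order_prime_divisors_def)

lemma open_subgroup_has_normal_core:
  assumes "subgroup M G" "openin T M"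
  obtains N where "N \<lhd> G" "openin T N" "N \<subseteq> M"
  using open_normal_basis[OF assms(2) subgroup.one_closed[OF assms(1)]] by blast

text \<open>
  Some \<open>K N \<inter> H\<close> is a proper open subgroup of \<open>H\<close>, and among the proper open subgroups containing \<open>K\<close> one of
  least index is maximal.
\<close>

lemma closed_proper_subset_maximal:
  assumes H: "subgroup H G" "openin T H" and K: "subgroup K G" "closedin T K" and KH: "K \<subset> H"
  obtains M where "subgroup M G" "openin T M" "K \<subseteq> M" "M \<subset> H"
    "\<And>L. subgroup L G \<Longrightarrow> M \<subseteq> L \<Longrightarrow> L \<subseteq> H \<Longrightarrow> L = M \<or> L = H"
proof -
  let ?P = "\<lambda>M. subgroup M G \<and> openin T M \<and> K \<subseteq> M \<and> M \<subset> H"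
  obtain x where x: "x \<in> H" "x \<notin> K" using KH by blast
  have xc: "x \<in> carrier G" using x(1) subgroup.subset[OF H(1)] by blast
  obtain N where N: "N \<lhd> G" "openin T N" "x \<notin> K <#> N"
    using separated_from_closed_subgroup[OF K xc x(2)] by blast
  note KN = set_mult_open_normal[OF K(1) N(1,2)]
  have "K \<subseteq> K <#> N"
    by (rule subset_set_mult(1)[OF subgroup.subset[OF K(1)] subgroup.one_closed[OF normal_imp_subgroup[OF N(1)]]])
  then have "?P ((K <#> N) \<inter> H)"
    using subgroups_Inter_pair[OF KN(1) H(1)] KN(2) H(2) KH N(3) x(1) by blast
  from ex_has_least_nat[of ?P, OF this, of "\<lambda>M. card (rcosets M)"]
  obtain M where M: "?P M" and least': "\<forall>L. ?P L \<longrightarrow> card (rcosets M) \<le> card (rcosets L)"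
    by (elim exE conjE) (rule that, intro conjI)
  have least: "card (rcosets M) \<le> card (rcosets L)" if "?P L" for L using least' that by blast
  show thesis
  proof (rule that)
    show "subgroup M G" "openin T M" "K \<subseteq> M" "M \<subset> H" using M by auto
    fix L assume L: "subgroup L G" "M \<subseteq> L" "L \<subseteq> H"
    show "L = M \<or> L = H"
    proof (rule ccontr)
      assume ne: "\<not> (L = M \<or> L = H)"
      have oL: "openin T L" using openin_subgroup_supset[OF L(1,2)] M subgroup.one_closed by blast
      then have le: "card (rcosets M) \<le> card (rcosets L)" using least[of L] L M ne by blast
      have tower: "card (rcosets M) = card (rcosets L) * card (rcosets\<^bsub>G\<lparr>carrier := L\<rparr>\<^esub> M)"
        using card_rcosets_tower[OF _ L(1,2)] M by blast
      have M0: "card (rcosets M) \<noteq> 0"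
        using finite_rcosets_open_subgroup[of M] M subgroup.subgroup_in_rcosets[OF _ is_group] by fastforce
      then have "card (rcosets\<^bsub>G\<lparr>carrier := L\<rparr>\<^esub> M) = 1"
        using tower le by (metis One_nat_def Suc_leI le_antisym mult_is_0 mult_le_cancel1 nat_mult_1_right neq0_conv)
      then obtain X where X: "rcosets\<^bsub>G\<lparr>carrier := L\<rparr>\<^esub> M = {X}" by (rule card_1_singletonE)
      obtain l where l: "l \<in> L" "l \<notin> M" using ne L(2) by blast
      have lc: "l \<in> carrier G" using l(1) subgroup.subset[OF L(1)] by blast
      have "M #> y = X" if "y \<in> L" for y using X that by (auto simp: RCOSETS_def)
      then have "M #> l = M #> \<one>" using l(1) subgroup.one_closed[OF L(1)] by metis
      then have "M #> l = M" using M subgroup.subset by (metis coset_mult_one)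
      then show False using coset_join1[OF _ lc] M l(2) by blast
    qed
  qed
qed

text \<open>
  With \<open>H\<close> open and pronilpotent, the maximal open subgroups of \<open>H\<close> have index \<open>|G : H| p\<close> in \<open>G\<close>, where the
  prime \<open>p\<close> divides the order of \<open>G\<close>. So there are finitely many of them, and their intersection contains
  an open normal subgroup of \<open>G\<close>.
\<close>

lemma isolated_subgroup_if:
  assumes tfg: "topologically_finitely_generated G T" and vpn: "virtually_pronilpotent G T"
    and primes: "finite (order_prime_divisors G T)"
  shows "\<exists>H. openin (subgroup_space G T) {H}"
proof -
  obtain S where S: "finite S" "S \<subseteq> carrier G" "T closure_of (generate G S) = carrier G"
    using tfg unfolding topologically_finitely_generated_def by blast
  obtain H where H: "subgroup H G" "openin T H"
    and pn: "pronilpotent_group (G\<lparr>carrier := H\<rparr>) (subtopology T H)"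
    using vpn unfolding virtually_pronilpotent_def by blast
  let ?H = "G\<lparr>carrier := H\<rparr>"
  interpret H: subgroup H G by fact
  interpret HG: profinite ?H "subtopology T H" by (rule profinite_open_subgroup[OF H])
  let ?\<M> = "{M. subgroup M G \<and> openin T M \<and> M \<subset> H \<and> (\<forall>L. subgroup L G \<longrightarrow> M \<subseteq> L \<longrightarrow> L \<subseteq> H \<longrightarrow> L = M \<or> L = H)}"
  have idx: "\<exists>p\<in>order_prime_divisors G T. card (rcosets M) = card (rcosets H) * p" if M: "M \<in> ?\<M>" for M
  proof -
    have Ms: "subgroup M G" and Mo: "openin T M" and MH: "M \<subset> H" using M by auto
    have MsH: "subgroup M ?H" using subgroup_incl[OF Ms H(1)] MH by blast
    have MoH: "openin (subtopology T H) M" using Mo MH H(2) by (auto simp: openin_open_subtopology)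
    obtain F :: "'a set monoid" and h where h: "nilpotent_group F" "group F" "h \<in> hom ?H F"
      "kernel ?H F h \<subseteq> M"
      using inverse_limit_small_kernel[OF pn[unfolded pronilpotent_group_def] MoH subgroup.one_closed[OF MsH]]
      by blast
    then obtain n where n: "lower_central_series F n = {\<one>\<^bsub>F\<^esub>}" unfolding nilpotent_group_def by blast
    have gh: "group_hom ?H F h" by (intro group_hom.intro group_hom_axioms.intro HG.is_group h)
    have "lower_central_series ?H n \<subseteq> kernel ?H F h"
      using group_hom.lower_central_series_hom[OF gh, of n] HG.lower_central_series_subset[of n] n
      unfolding kernel_def by blast
    then have nil: "lower_central_series ?H n \<subseteq> M" using h(4) by blast
    have "prime (card (rcosets\<^bsub>?H\<^esub> M))"
    proof (rule HG.maximal_subgroup_prime_index[OF MsH _ _ _ nil])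
      show "M \<noteq> carrier ?H" using MH by auto
      show "finite (rcosets\<^bsub>?H\<^esub> M)" by (rule HG.finite_rcosets_open_subgroup[OF MsH MoH])
      fix K assume K: "subgroup K ?H" "M \<subseteq> K"
      have "subgroup K G" by (rule incl_subgroup[OF H(1) K(1)])
      moreover have "K \<subseteq> H" using subgroup.subset[OF K(1)] by simp
      ultimately show "K = M \<or> K = carrier ?H" using M K(2) by auto
    qed
    moreover have tower: "card (rcosets M) = card (rcosets H) * card (rcosets\<^bsub>?H\<^esub> M)"
      using card_rcosets_tower[OF Ms H(1)] MH by blast
    moreover obtain N where N: "N \<lhd> G" "openin T N" "N \<subseteq> M" using open_subgroup_has_normal_core[OF Ms Mo] by blast
    have "card (rcosets N) = card (rcosets M) * card (rcosets\<^bsub>G\<lparr>carrier := M\<rparr>\<^esub> N)"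
      by (rule card_rcosets_tower[OF normal_imp_subgroup[OF N(1)] Ms N(3)])
    then have "card (rcosets\<^bsub>?H\<^esub> M) dvd card (rcosets N)" unfolding tower by (simp add: dvd_mult dvd_mult2)
    ultimately have "card (rcosets\<^bsub>?H\<^esub> M) \<in> order_prime_divisors G T"
      using N mem_order_prime_divisors_iff by blast
    then show ?thesis using tower by blast
  qed
  have "?\<M> \<subseteq> (\<Union>p\<in>order_prime_divisors G T. {M. subgroup M G \<and> openin T M \<and> card (rcosets M) = card (rcosets H) * p})"
    using idx by blast
  moreover have "finite (\<Union>p\<in>order_prime_divisors G T. {M. subgroup M G \<and> openin T M \<and> card (rcosets M) = card (rcosets H) * p})"
    using primes finite_open_subgroups_of_index[OF S] by blast
  ultimately have fin: "finite ?\<M>" by (rule finite_subset)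
  \<comment> \<open>The Frattini subgroup of \<open>H\<close>; including \<open>H\<close> covers the case that there is no maximal open subgroup.\<close>
  let ?\<Phi> = "\<Inter>(insert H ?\<M>)"
  have "subgroup ?\<Phi> G" by (rule subgroups_Inter) (use H in auto)
  moreover have "openin T ?\<Phi>" by (rule openin_Inter) (use fin H in auto)
  ultimately obtain N where N: "N \<lhd> G" "openin T N" "N \<subseteq> ?\<Phi>" using open_subgroup_has_normal_core by blast
  have "K = H" if K: "subgroup K G" "closedin T K" and KN: "K <#> N = H" for K
  proof (rule ccontr)
    assume ne: "K \<noteq> H"
    have "K \<subseteq> H"
      using subset_set_mult(1)[OF subgroup.subset[OF K(1)] subgroup.one_closed[OF normal_imp_subgroup[OF N(1)]]] KN
      by simp
    then have "K \<subset> H" using ne by blast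
    from closed_proper_subset_maximal[OF H K this] obtain M where M: "subgroup M G" "openin T M" "K \<subseteq> M" "M \<subset> H"
      "\<forall>L. subgroup L G \<longrightarrow> M \<subseteq> L \<longrightarrow> L \<subseteq> H \<longrightarrow> L = M \<or> L = H" by metis
    then have "M \<in> ?\<M>" by blast
    then have "N \<subseteq> M" using N(3) by blast
    then have "K <#> N \<subseteq> M" using M(3) subgroup.m_closed[OF M(1)] by (auto simp: set_mult_def)
    then show False using KN M(4) by blast
  qed
  moreover have "N \<subseteq> H" using N(3) by blast
  ultimately show ?thesis unfolding isolated_subgroup_iff using H(1) N(1,2) by blast
qed

text \<open>
  For each open normal subgroup \<open>N\<close> the product of the generated subgroup with \<open>N\<close> is an open subgroup,
  so it is all of \<open>G\<close>; thus the generated subgroup meets every coset of \<open>N\<close>.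
\<close>

lemma dense_generate_if_open_subgroups:
  assumes S: "S \<subseteq> carrier G" and top: "\<And>L. subgroup L G \<Longrightarrow> openin T L \<Longrightarrow> S \<subseteq> L \<Longrightarrow> L = carrier G"
  shows "T closure_of (generate G S) = carrier G"
proof
  show "T closure_of (generate G S) \<subseteq> carrier G" using closure_of_subset_topspace topspace_eq by metis
  show "carrier G \<subseteq> T closure_of (generate G S)"
  proof
    fix x assume x: "x \<in> carrier G"
    have "\<exists>y\<in>generate G S. y \<in> U" if U: "x \<in> U" "openin T U" for U
    proof -
      have sub: "U \<subseteq> carrier G" using openin_subset[OF U(2)] topspace_eq by simp
      have "openin T (inv x <# U)" using openin_l_coset[OF U(2)] x by simp
      moreover have "\<one> = inv x \<otimes> x" using x by simp
      then have "\<one> \<in> inv x <# U" using U(1) unfolding l_coset_def by blast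
      ultimately obtain N where N: "N \<lhd> G" "openin T N" "N \<subseteq> inv x <# U" using open_normal_basis by blast
      interpret N: normal N G using N(1) .
      have g: "subgroup (generate G S) G" by (rule generate_is_subgroup[OF S])
      have "S \<subseteq> generate G S <#> N"
        using subset_set_mult(1)[OF subgroup.subset[OF g] N.one_closed] generate.incl[of _ S G] by blast
      then have "generate G S <#> N = carrier G" using top set_mult_open_normal[OF g N(1,2)] by blast
      then have "x \<in> generate G S <#> N" using x by simp
      then obtain y n where yn: "y \<in> generate G S" "n \<in> N" "x = y \<otimes> n" unfolding set_mult_def by blast
      have yc: "y \<in> carrier G" using generate_in_carrier[OF S yn(1)] .
      then have y: "y = x \<otimes> inv n" using yn by (simp add: m_assoc)
      have "inv n \<in> inv x <# U" using N(3) yn(2) by blast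
      then obtain u where u: "u \<in> U" "inv n = inv x \<otimes> u" by (auto simp: l_coset_def)
      have "u \<in> carrier G" using u(1) sub by blast
      then have "y = u" using y u(2) x by (simp add: inv_mult_cancel)
      then show ?thesis using yn(1) u(1) by blast
    qed
    then show "x \<in> T closure_of (generate G S)" unfolding in_closure_of using x topspace_eq by blast
  qed
qed

text \<open>
  Topological generation is tested on open subgroups \<open>L\<close> containing representatives of the cosets of \<open>N\<close> in
  \<open>H\<close> and of \<open>H\<close> in \<open>G\<close>: the former give \<open>(L \<inter> H) N = H\<close>, whence \<open>L \<inter> H = H\<close>. The group \<open>N\<close> itself is
  pronilpotent, since the lower central series of \<open>N\<close> reaches into every open normal subgroup of \<open>G\<close>
  inside \<open>N\<close>; and all primes dividing the order of \<open>G\<close> already divide \<open>|G : N|\<close>.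
\<close>

lemma isolated_subgroup_only_if:
  assumes "\<exists>H. openin (subgroup_space G T) {H}"
  shows "topologically_finitely_generated G T" "virtually_pronilpotent G T" "finite (order_prime_divisors G T)"
proof -
  obtain H N where H: "subgroup H G" and N: "N \<lhd> G" "openin T N" "N \<subseteq> H"
    and frat: "\<And>K. subgroup K G \<Longrightarrow> closedin T K \<Longrightarrow> K <#> N = H \<Longrightarrow> K = H"
    using assms unfolding isolated_subgroup_iff by blast
  interpret H: subgroup H G by fact
  interpret N: normal N G using N(1) .
  have Hop: "openin T H" using openin_subgroup_supset[OF H N(3,2)] by simp
  show "topologically_finitely_generated G T"
  proof -
    obtain R where R: "finite R" "R \<subseteq> H" "\<And>L. N \<subseteq> L \<Longrightarrow> subgroup L G \<Longrightarrow> R \<subseteq> L \<Longrightarrow> H \<subseteq> L"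
      using coset_representatives[OF N.subgroup_axioms finite_rcosets_open_subgroup[OF N.subgroup_axioms N(2)] H N(3)] by blast
    obtain S where S: "finite S" "S \<subseteq> carrier G" "\<And>L. H \<subseteq> L \<Longrightarrow> subgroup L G \<Longrightarrow> S \<subseteq> L \<Longrightarrow> carrier G \<subseteq> L"
      using coset_representatives[OF H finite_rcosets_open_subgroup[OF H Hop] subgroup_self H.subset] by blast
    have "L = carrier G" if L: "subgroup L G" "openin T L" "R \<union> S \<subseteq> L" for L
    proof -
      interpret L: subgroup L G using L(1) .
      let ?K = "L \<inter> H"
      have K: "subgroup ?K G" "openin T ?K" using subgroups_Inter_pair[OF L(1) H] L(2) Hop by auto
      have KN: "subgroup (?K <#> N) G" by (rule set_mult_open_normal(1)[OF K(1) N(1,2)])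
      have "?K <#> N \<subseteq> H" using N(3) by (auto simp: set_mult_def)
      moreover have "H \<subseteq> ?K <#> N"
      proof (rule R(3)[OF _ KN])
        show "N \<subseteq> ?K <#> N" using subset_set_mult(2)[OF N.subset subgroup.one_closed[OF K(1)]] .
        show "R \<subseteq> ?K <#> N"
          using subset_set_mult(1)[OF subgroup.subset[OF K(1)] N.one_closed] L(3) R(2) by blast
      qed
      ultimately have "?K <#> N = H" by blast
      then have "?K = H" by (rule frat[OF K(1) closedin_open_subgroup[OF K]])
      then have "carrier G \<subseteq> L" using S(3)[OF _ L(1)] L(3) by blast
      then show ?thesis using L.subset by blast
    qed
    then have "T closure_of (generate G (R \<union> S)) = carrier G"
      using R(2) S(2) H.subset by (intro dense_generate_if_open_subgroups) auto
    then show ?thesis unfolding topologically_finitely_generated_def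
      using R(1,2) S(1,2) H.subset by (intro exI[of _ "R \<union> S"]) auto
  qed
  let ?H = "G\<lparr>carrier := H\<rparr>"
  interpret HG: profinite ?H "subtopology T H" by (rule profinite_open_subgroup[OF H Hop])
  have NH: "N \<lhd> ?H" using normal_restrict_supergroup[OF H N(1,3)] .
  have key: "(\<exists>n. lower_central_series (G\<lparr>carrier := N\<rparr>) n \<subseteq> M) \<and>
    (\<forall>p. prime p \<longrightarrow> p dvd card (rcosets\<^bsub>?H\<^esub> M) \<longrightarrow> p dvd card (rcosets\<^bsub>?H\<^esub> N))"
    if M: "M \<lhd> G" "openin T M" "M \<subseteq> N" for M
  proof -
    have MH: "M \<lhd> ?H" using normal_restrict_supergroup[OF H M(1)] M(3) N(3) by blast
    have fin: "finite (rcosets\<^bsub>?H\<^esub> M)"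
    proof (rule HG.finite_rcosets_open_subgroup[OF normal_imp_subgroup[OF MH]])
      show "openin (subtopology T H) M" using M N(3) Hop by (auto simp: openin_open_subtopology)
    qed
    have "\<forall>K. subgroup K ?H \<longrightarrow> M \<subseteq> K \<longrightarrow> K <#>\<^bsub>?H\<^esub> N = carrier ?H \<longrightarrow> K = carrier ?H"
    proof (intro allI impI)
      fix K assume K: "subgroup K ?H" "M \<subseteq> K" "K <#>\<^bsub>?H\<^esub> N = carrier ?H"
      have KG: "subgroup K G" by (rule incl_subgroup[OF H K(1)])
      have "openin T K" using openin_subgroup_supset[OF KG K(2) M(2)] subgroup.one_closed[OF normal_imp_subgroup[OF M(1)]] .
      then have "closedin T K" by (rule closedin_open_subgroup[OF KG])
      moreover have "K <#> N = H" using K(3) by (simp add: set_mult_def)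
      ultimately show "K = carrier ?H" using frat[OF KG] by simp
    qed
    from HG.nongenerators_nilpotent_and_primes[OF NH MH M(3) fin this] show ?thesis by simp
  qed
  show "virtually_pronilpotent G T"
    unfolding virtually_pronilpotent_def
  proof (intro exI conjI)
    show "subgroup N G" "openin T N" by (rule N.subgroup_axioms, rule N(2))
    let ?N = "G\<lparr>carrier := N\<rparr>"
    interpret NG: profinite ?N "subtopology T N" by (rule profinite_open_subgroup[OF N.subgroup_axioms N(2)])
    let ?\<M> = "{M. M \<lhd> G \<and> openin T M \<and> M \<subseteq> N}"
    show "pronilpotent_group ?N (subtopology T N)"
      unfolding pronilpotent_group_def
    proof (rule NG.inverse_limit_of_quotients[of ?\<M>])
      show "?\<M> \<noteq> {}" using N by blast
    next
      fix M assume "M \<in> ?\<M>"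
      then have M: "M \<lhd> G" "openin T M" "M \<subseteq> N" by auto
      have MN: "M \<lhd> ?N" using normal_restrict_supergroup[OF N.subgroup_axioms M(1,3)] .
      have Mo: "openin (subtopology T N) M" using M N(2) by (auto simp: openin_open_subtopology)
      have "finite (carrier (?N Mod M))"
        using NG.finite_rcosets_open_subgroup[OF normal_imp_subgroup[OF MN] Mo] by (simp add: FactGroup_def)
      moreover have "nilpotent_group (?N Mod M)" using key[OF M] nilpotent_quotient[OF MN] by blast
      ultimately show "M \<lhd> ?N \<and> openin (subtopology T N) M \<and> finite (carrier (?N Mod M)) \<and> nilpotent_group (?N Mod M)"
        using MN Mo by blast
    next
      fix L M assume "L \<in> ?\<M>" "M \<in> ?\<M>"
      then have "L \<inter> M \<in> ?\<M>" using open_normal_Int by blast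
      then show "\<exists>K\<in>?\<M>. K \<subseteq> L \<inter> M" by blast
    next
      fix U assume U: "openin (subtopology T N) U" "\<one>\<^bsub>?N\<^esub> \<in> U"
      then have "openin T U" "U \<subseteq> N" using N(2) by (auto simp: openin_open_subtopology)
      then show "\<exists>M\<in>?\<M>. M \<subseteq> U" using open_normal_basis[of U] U(2) by auto
    qed
  qed
  show "finite (order_prime_divisors G T)"
  proof (rule finite_subset)
    have N0: "card (rcosets N) \<noteq> 0"
      using finite_rcosets_open_subgroup[OF N.subgroup_axioms N(2)] N.subgroup_in_rcosets[OF is_group] by auto
    then show "finite {p. p dvd card (rcosets N)}" using finite_divisors_nat by simp
    have towerN: "card (rcosets N) = card (rcosets H) * card (rcosets\<^bsub>?H\<^esub> N)"
      by (rule card_rcosets_tower[OF N.subgroup_axioms H N(3)])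
    show "order_prime_divisors G T \<subseteq> {p. p dvd card (rcosets N)}"
    proof
      fix p assume "p \<in> order_prime_divisors G T"
      then obtain L where p: "prime p" and L: "L \<lhd> G" "openin T L" "p dvd card (rcosets L)"
        unfolding mem_order_prime_divisors_iff by blast
      let ?M = "L \<inter> N"
      note M = open_normal_Int[OF L(1,2) N(1,2)]
      have "card (rcosets ?M) = card (rcosets L) * card (rcosets\<^bsub>G\<lparr>carrier := L\<rparr>\<^esub> ?M)"
        by (rule card_rcosets_tower[OF normal_imp_subgroup[OF M(1)] normal_imp_subgroup[OF L(1)]]) blast
      then have "p dvd card (rcosets ?M)" using L(3) by simp
      moreover have "card (rcosets ?M) = card (rcosets H) * card (rcosets\<^bsub>?H\<^esub> ?M)"
        by (rule card_rcosets_tower[OF normal_imp_subgroup[OF M(1)] H]) (use N(3) in blast)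
      ultimately consider "p dvd card (rcosets H)" | "p dvd card (rcosets\<^bsub>?H\<^esub> ?M)"
        using p by (metis prime_dvd_mult_iff)
      then show "p \<in> {p. p dvd card (rcosets N)}"
      proof cases
        case 1 then show ?thesis unfolding towerN by simp
      next
        case 2
        then have "p dvd card (rcosets\<^bsub>?H\<^esub> N)" using key[OF M] p by blast
        then show ?thesis unfolding towerN by simp
      qed
    qed
  qed
qed

end

theorem corollary5p7:
  fixes G :: "('a, 'm) monoid_scheme" and T :: "'a topology"
  assumes "profinite_group G T"
  shows "subgroup_space G T homeomorphic_space top_of_set cantor_set \<longleftrightarrow>
    second_countable T \<and>
    \<not> (topologically_finitely_generated G T \<and>
       virtually_pronilpotent G T \<and>
       finite (order_prime_divisors G T))"
proof -
  interpret profinite G T by (rule profinite_groupD[OF assms])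
  let ?S = "subgroup_space G T"
  have isolated: "(\<exists>H. openin ?S {H}) \<longleftrightarrow> topologically_finitely_generated G T \<and>
       virtually_pronilpotent G T \<and> finite (order_prime_divisors G T)"
    using isolated_subgroup_if isolated_subgroup_only_if by blast
  show ?thesis
    unfolding isolated[symmetric]
  proof
    assume hs: "?S homeomorphic_space top_of_set cantor_set"
    have "second_countable (top_of_set cantor_set)"
      by (intro second_countable_subtopology second_countable_euclideanreal)
    then have "second_countable T"
      using homeomorphic_space_second_countability[OF hs] second_countable_if_subgroup_space by blast
    moreover have "\<not> (\<exists>H. openin ?S {H})"
    proof clarify
      fix H assume op: "openin ?S {H}"
      obtain f where "homeomorphic_map ?S (top_of_set cantor_set) f"
        using hs homeomorphic_space by blast
      then have "openin (top_of_set cantor_set) (f ` {H})"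
        using op homeomorphic_map_openness_eq by blast
      then show False using cantor_set_perfect by simp
    qed
    ultimately show "second_countable T \<and> \<not> (\<exists>H. openin ?S {H})" ..
  next
    assume *: "second_countable T \<and> \<not> (\<exists>H. openin ?S {H})"
    then obtain \<C> where C: "countable \<C>" "\<And>A. A \<in> \<C> \<Longrightarrow> openin ?S A \<and> closedin ?S A"
      "\<And>H K. H \<in> closed_subgroups G T \<Longrightarrow> K \<in> closed_subgroups G T \<Longrightarrow> H \<noteq> K \<Longrightarrow> \<exists>A\<in>\<C>. H \<in> A \<longleftrightarrow> K \<notin> A"
      using countable_separating_clopens by blast
    have "?S homeomorphic_space Cantor_space"
    proof (rule homeomorphic_Cantor_space[where \<C> = \<C>])
      show "compact_space ?S" by (rule compact_subgroup_space)
      show "topspace ?S \<noteq> {}"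
        using open_subgroup_in_closed_subgroups[OF subgroup_self carrier_open_normal(2)] topspace_subgroup_space by blast
    qed (use * C topspace_subgroup_space in auto)
    then show "?S homeomorphic_space top_of_set cantor_set"
      using cantor_set_homeomorphic_Cantor_space homeomorphic_space_sym homeomorphic_space_trans by blast
  qed
qed

end
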